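(* Let $(X,L)$ be an $n$-dimensional polarized toric manifold with spectral value $\mu$. If $\mu>\frac{n+2}{2}$, then $(X,L)$ is $\mathbb{Q}$-normal.
   Context: A polarized toric manifold $(X,L)$ is a smooth projective toric variety $X$ (over $\mathbb{C}$) together with an ample line bundle $L$ on $X$; equivalently, the pair defined by a smooth lattice polytope. Let $K_X$ be the canonical bundle of $X$. The (unnormalized) spectral value $\mu$ of $(X,L)$ is the supremum of all $t$ such that $tL+K_X$ has no global sections (for rational $t$ this means that $N(tL+K_X)$ has no nonzero global section for every positive integer $N$ with $Nt\in\mathbb{Z}$). The nef-value $\tau$ of $(X,L)$ is the infimum of all $t\in\mathbb{R}$ such that $tL+K_X$ is nef. $(X,L)$ is called $\mathbb{Q}$-normal if $\mu=\tau$. *)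

theory Defs
  imports
    "HOL-Analysis.Analysis"
    "HOL-Computational_Algebra.Formal_Laurent_Series"
    "HOL-Library.Poly_Mapping"
begin

text \<open>
  The polarized toric manifold \<open>(X, L)\<close> is given by its smooth lattice polytope \<open>P\<close>; the
  character lattice of the torus is \<open>M = int^'n\<close> and \<open>dim X = CARD('n)\<close>.  The variety \<open>X\<close> is
  covered by the affine charts \<open>U_v = Spec \<complex>[S_v]\<close>, one for each vertex \<open>v\<close> of \<open>P\<close>, where
  \<open>S_v\<close> consists of the lattice points of \<open>cone (P - v)\<close>, the dual of the maximal cone of the
  normal fan that belongs to \<open>v\<close>.
\<close>

subsection \<open>Smooth lattice polytopes\<close>

definition real_vec :: "int ^ 'n \<Rightarrow> real ^ 'n" where
  "real_vec m = (\<chi> i. real_of_int (vec_nth m i))"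

definition lattice_polytope :: "(real ^ 'n) set \<Rightarrow> bool" where
  "lattice_polytope P \<longleftrightarrow> (\<exists>V. finite V \<and> P = convex hull (real_vec ` V))"

definition vertices :: "(real ^ 'n) set \<Rightarrow> (int ^ 'n) set" where
  "vertices P = {v. real_vec v extreme_point_of P}"

definition primitive :: "int ^ 'n \<Rightarrow> bool" where
  "primitive u \<longleftrightarrow> Gcd (range (vec_nth u)) = 1"

text \<open>The primitive lattice vectors along the edges of \<open>P\<close> at the vertex \<open>v\<close>.\<close>

definition edge_dirs :: "(real ^ 'n) set \<Rightarrow> int ^ 'n \<Rightarrow> (int ^ 'n) set" where
  "edge_dirs P v =
     {u. primitive u \<and> (\<exists>k>0. closed_segment (real_vec v) (real_vec (v + k *s u)) edge_of P)}"

definition lattice_basis :: "(int ^ 'n) set \<Rightarrow> bool" where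
  "lattice_basis E \<longleftrightarrow>
     finite E \<and> (\<forall>m. \<exists>!c :: int ^ 'n \<Rightarrow> int. (\<forall>u. u \<notin> E \<longrightarrow> c u = 0) \<and> m = (\<Sum>u\<in>E. c u *s u))"

definition smooth_lattice_polytope :: "(real ^ 'n) set \<Rightarrow> bool" where
  "smooth_lattice_polytope P \<longleftrightarrow>
     lattice_polytope P \<and> aff_dim P = int CARD('n) \<and>
     (\<forall>v\<in>vertices P. lattice_basis (edge_dirs P v))"

subsection \<open>Charts, line bundles and global sections\<close>

definition chart_monoid :: "(real ^ 'n) set \<Rightarrow> int ^ 'n \<Rightarrow> (int ^ 'n) set" where
  "chart_monoid P v = {m. real_vec m \<in> cone hull ((\<lambda>x. x - real_vec v) ` P)}"

text \<open>\<open>U_v \<inter> U_w = Spec \<complex>[S_v + S_w]\<close>.\<close>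

definition overlap_monoid :: "(real ^ 'n) set \<Rightarrow> int ^ 'n \<Rightarrow> int ^ 'n \<Rightarrow> (int ^ 'n) set" where
  "overlap_monoid P v w = {a + b |a b. a \<in> chart_monoid P v \<and> b \<in> chart_monoid P w}"

text \<open>The coordinate ring of \<open>U_v\<close>, inside the ring \<open>\<complex>[M]\<close> of Laurent polynomials.\<close>

definition chart_ring :: "(real ^ 'n) set \<Rightarrow> int ^ 'n \<Rightarrow> (int ^ 'n \<Rightarrow>\<^sub>0 complex) set" where
  "chart_ring P v = {f. Poly_Mapping.keys f \<subseteq> chart_monoid P v}"

text \<open>
  A line bundle on \<open>X\<close> is represented by its Cartier data: a map \<open>m\<close> that assigns to each vertex
  \<open>v\<close> the exponent of a local generator \<open>\<chi>^(m v)\<close> on \<open>U_v\<close>.  Tensor products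
  are pointwise sums.  Restriction to the dense torus is injective on sections, so a global section
  is a Laurent polynomial that is a section over each chart.
\<close>

type_synonym 'n cartier = "int ^ 'n \<Rightarrow> int ^ 'n"

definition chart_sections ::
  "(real ^ 'n) set \<Rightarrow> 'n cartier \<Rightarrow> int ^ 'n \<Rightarrow> (int ^ 'n \<Rightarrow>\<^sub>0 complex) set" where
  "chart_sections P m v = (\<lambda>f. Poly_Mapping.single (m v) 1 * f) ` chart_ring P v"

definition global_sections ::
  "(real ^ 'n) set \<Rightarrow> 'n cartier \<Rightarrow> (int ^ 'n \<Rightarrow>\<^sub>0 complex) set" where
  "global_sections P m = {f. \<forall>v\<in>vertices P. f \<in> chart_sections P m v}"

text \<open>The ample bundle \<open>L\<close> of \<open>P\<close>; its sections are spanned by the \<open>\<chi>^m\<close> with \<open>m \<in> P\<close>.\<close>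

definition ample_bundle :: "'n cartier" where
  "ample_bundle v = v"

text \<open>
  The canonical bundle: the \<open>\<chi>^u\<close> with \<open>u \<in> edge_dirs P v\<close> are coordinates on \<open>U_v\<close>, an affine
  space, so the bundle of \<open>n\<close>-forms is generated there by the wedge product of
  the \<open>d\<chi>^u\<close>.  This is \<open>\<chi>^(\<Sum>u)\<close> times the wedge product of the \<open>d\<chi>^u / \<chi>^u\<close>, and the latter
  form does not depend on \<open>v\<close>, up to sign.
\<close>

definition canonical_bundle :: "(real ^ 'n) set \<Rightarrow> 'n cartier" where
  "canonical_bundle P v = (\<Sum>u\<in>edge_dirs P v. u)"

subsection \<open>Curves and degrees\<close>

text \<open>
  An irreducible complete curve on \<open>X\<close> is the closure of a point whose residue field \<open>K\<close> has
  transcendence degree 1 over \<open>\<complex>\<close>.  A point lying in \<open>U_v\<close> is given by the monoid homomorphism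
  \<open>\<phi>\<close> from \<open>S_v\<close> to \<open>K\<close> evaluating characters, and \<open>K\<close> is generated over \<open>\<complex>\<close> by the values of
  \<open>\<phi>\<close>.  (The value 0 is allowed, so \<open>\<phi>\<close> need not meet the torus.)  The completion of \<open>K\<close> at a place
  is isomorphic to \<open>\<complex>((t))\<close>, so all such \<open>K\<close> occur among the subfields of \<open>\<complex>((t))\<close>.
\<close>

definition subfield_over_complex :: "complex fls set \<Rightarrow> bool" where
  "subfield_over_complex K \<longleftrightarrow>
     range fls_const \<subseteq> K \<and>
     (\<forall>x\<in>K. \<forall>y\<in>K. x + y \<in> K \<and> x * y \<in> K) \<and> (\<forall>x\<in>K. - x \<in> K \<and> inverse x \<in> K)"

definition transcendental :: "complex fls \<Rightarrow> bool" where
  "transcendental x \<longleftrightarrow> (\<forall>p :: complex poly. poly (map_poly fls_const p) x = 0 \<longrightarrow> p = 0)"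

definition alg_dependent :: "complex fls \<Rightarrow> complex fls \<Rightarrow> bool" where
  "alg_dependent x y \<longleftrightarrow>
     (\<exists>F :: complex poly poly. F \<noteq> 0 \<and>
        poly (map_poly (\<lambda>c. poly (map_poly fls_const c) x) F) y = 0)"

definition trdeg_one :: "complex fls set \<Rightarrow> bool" where
  "trdeg_one K \<longleftrightarrow> (\<exists>x\<in>K. transcendental x) \<and> (\<forall>x\<in>K. \<forall>y\<in>K. alg_dependent x y)"

definition monoid_hom_on :: "(int ^ 'n) set \<Rightarrow> (int ^ 'n \<Rightarrow> complex fls) \<Rightarrow> bool" where
  "monoid_hom_on S \<phi> \<longleftrightarrow> \<phi> 0 = 1 \<and> (\<forall>a\<in>S. \<forall>b\<in>S. \<phi> (a + b) = \<phi> a * \<phi> b)"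

definition curve_field ::
  "(real ^ 'n) set \<Rightarrow> int ^ 'n \<Rightarrow> (int ^ 'n \<Rightarrow> complex fls) \<Rightarrow> complex fls set" where
  "curve_field P v \<phi> = subfield_over_complex hull (\<phi> ` chart_monoid P v)"

definition curve :: "(real ^ 'n) set \<Rightarrow> int ^ 'n \<Rightarrow> (int ^ 'n \<Rightarrow> complex fls) \<Rightarrow> bool" where
  "curve P v \<phi> \<longleftrightarrow>
     v \<in> vertices P \<and> monoid_hom_on (chart_monoid P v) \<phi> \<and> trdeg_one (curve_field P v \<phi>)"

text \<open>
  The points of the normalization of the curve are the places of \<open>K\<close>, that is, the normalized
  discrete valuations of \<open>K\<close> over \<open>\<complex>\<close>.  The value is set to 0 at 0 and outside \<open>K\<close>, so that each
  place is represented by exactly one function.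
\<close>

definition places :: "complex fls set \<Rightarrow> (complex fls \<Rightarrow> int) set" where
  "places K = {p.
     (\<forall>x. x \<notin> K - {0} \<longrightarrow> p x = 0) \<and>
     (\<forall>c. p (fls_const c) = 0) \<and>
     (\<forall>x\<in>K - {0}. \<forall>y\<in>K - {0}. p (x * y) = p x + p y) \<and>
     (\<forall>x\<in>K - {0}. \<forall>y\<in>K - {0}. x + y \<noteq> 0 \<longrightarrow> min (p x) (p y) \<le> p (x + y)) \<and>
     p ` (K - {0}) = UNIV}"

text \<open>
  The generic point \<open>\<phi>\<close> also lies in \<open>U_w\<close>, with \<open>\<theta>\<close> evaluating the characters regular on
  \<open>U_v \<inter> U_w\<close>, and all functions on \<open>U_w\<close> are regular at the place \<open>p\<close>; that is, the normalization
  sends \<open>p\<close> into \<open>U_w\<close>.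
\<close>

definition centered_in ::
  "(real ^ 'n) set \<Rightarrow> int ^ 'n \<Rightarrow> (int ^ 'n \<Rightarrow> complex fls) \<Rightarrow> (complex fls \<Rightarrow> int) \<Rightarrow>
   int ^ 'n \<Rightarrow> (int ^ 'n \<Rightarrow> complex fls) \<Rightarrow> bool" where
  "centered_in P v \<phi> p w \<theta> \<longleftrightarrow>
     w \<in> vertices P \<and> monoid_hom_on (overlap_monoid P v w) \<theta> \<and>
     (\<forall>a\<in>chart_monoid P v. \<theta> a = \<phi> a) \<and>
     (\<forall>b\<in>chart_monoid P w. \<theta> b \<noteq> 0 \<longrightarrow> p (\<theta> b) \<ge> 0)"

text \<open>
  The degree of the pullback of a line bundle to the normalization, computed from the rational
  section \<open>\<chi>^(m v)\<close>, which generates the bundle at the generic point of the curve.  At \<open>p\<close>, mapped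
  into \<open>U_w\<close>, its order of vanishing is that of its quotient by the local generator \<open>\<chi>^(m w)\<close>.  Only
  finitely many places contribute.
\<close>

definition section_order ::
  "(real ^ 'n) set \<Rightarrow> 'n cartier \<Rightarrow> int ^ 'n \<Rightarrow> (int ^ 'n \<Rightarrow> complex fls) \<Rightarrow>
   (complex fls \<Rightarrow> int) \<Rightarrow> int" where
  "section_order P m v \<phi> p =
     (THE k. \<exists>w \<theta>. centered_in P v \<phi> p w \<theta> \<and> k = p (\<theta> (m v - m w)))"

definition curve_degree ::
  "(real ^ 'n) set \<Rightarrow> 'n cartier \<Rightarrow> int ^ 'n \<Rightarrow> (int ^ 'n \<Rightarrow> complex fls) \<Rightarrow> int" where
  "curve_degree P m v \<phi> =
     (\<Sum>p | p \<in> places (curve_field P v \<phi>) \<and> section_order P m v \<phi> p \<noteq> 0. section_order P m v \<phi> p)"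

subsection \<open>Spectral value, nef-value and \<open>\<rat>\<close>-normality\<close>

text \<open>\<open>a L + N K_X\<close> for integers \<open>a\<close> and \<open>N\<close>.\<close>

definition adjoint_bundle :: "(real ^ 'n) set \<Rightarrow> int \<Rightarrow> int \<Rightarrow> 'n cartier" where
  "adjoint_bundle P a N v = a *s ample_bundle v + N *s canonical_bundle P v"

definition spectral_value :: "(real ^ 'n) set \<Rightarrow> real" where
  "spectral_value P = Sup {t. t \<in> \<rat> \<and>
     (\<forall>N>0. \<forall>a. of_int N * t = of_int a \<longrightarrow> global_sections P (adjoint_bundle P a N) = {0})}"

text \<open>Nefness of the \<open>\<real>\<close>-divisor \<open>t L + K_X\<close>, where \<open>t\<close> may be irrational.\<close>

definition adjoint_nef :: "(real ^ 'n) set \<Rightarrow> real \<Rightarrow> bool" where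
  "adjoint_nef P t \<longleftrightarrow>
     (\<forall>v \<phi>. curve P v \<phi> \<longrightarrow>
        t * of_int (curve_degree P ample_bundle v \<phi>)
          + of_int (curve_degree P (canonical_bundle P) v \<phi>) \<ge> 0)"

definition nef_value :: "(real ^ 'n) set \<Rightarrow> real" where
  "nef_value P = Inf {t. adjoint_nef P t}"

definition Q_normal :: "(real ^ 'n) set \<Rightarrow> bool" where
  "Q_normal P \<longleftrightarrow> spectral_value P = nef_value P"

end

theory Submission imports Defs begin

text \<open>
  Nefness of \<open>t L + K\<close> is tested on the edges of \<open>P\<close>, so the nef-value is the maximal slope \<open>d / l\<close>, where
  an edge of lattice length \<open>l\<close> has anticanonical degree \<open>d\<close>; one inequality uses the invariant curve of
  an edge, the other that for nef \<open>t L + K\<close> the section \<open>\<chi>^(t v + s v)\<close>, with \<open>s v\<close> the sum of the edge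
  directions at \<open>v\<close>, has nonnegative order at every place of a curve meeting the chart of \<open>v\<close>.

  Take an edge of maximal slope and, among those, of minimal length.  Its wall relation has all
  coefficients at most 1, so \<open>d \<le> n + 1\<close>.  If no coefficient is negative, comparing the facets at the
  two ends of the edge shows that \<open>t L + K\<close> has no sections for \<open>t < d / l\<close>, hence \<open>\<mu> = \<tau>\<close>.  Otherwise
  \<open>\<mu> > (n + 2) / 2\<close> forces \<open>l = 1\<close>, and \<open>P\<close> has a face that is a unimodular simplex of large dimension over
  which \<open>P\<close> widens in some direction; the lattice points in these slices give a section of \<open>t L + K\<close>
  for all rational \<open>t \<ge> (n + 2) / 2\<close>, a contradiction.
\<close>

subsection \<open>Edges of a polytope at a vertex\<close>

text \<open>The bound on \<open>\<mu>\<close> acts twice. By \<open>d \<le> n + 1\<close>, an edge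
  with \<open>l \<ge> 2\<close> would have slope at most \<open>(n + 1) / 2\<close>. For
  \<open>l = 1\<close> let \<open>I\<close> and \<open>J\<close> be the directions with wall
  coefficient 1 and at most 0, and \<open>s\<close> the sum of the coefficients over
  \<open>J\<close>. Then \<open>d = 1 + |I| + s\<close>, and \<open>2 d > n + 2\<close> makes
  \<open>D = |I| - |J| + s\<close> positive. The section puts weight \<open>|J| + D / 2\<close> on
  the slices and needs weight 1 more on \<open>v\<close>; the total \<open>(n + 2 + s) / 2\<close>
  stays within the bound. The work on places comes from testing nefness on all curves. A curve may
  lie in the boundary, where some characters vanish, so orders make sense only for the characters of
  its own torus orbit. Moreover the degrees of \<open>L\<close> and \<open>K\<close> are sums over
  different sets of places, and a sum over an infinite set is 0 by convention. To add them, one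
  finite set must carry both: the poles of the chart coordinates, whose finiteness rests on weak
  approximation.\<close>

definition cone_span :: "'a::real_vector \<Rightarrow> 'a set \<Rightarrow> 'a set" where
  "cone_span w G = {\<Sum>g\<in>G. c g *\<^sub>R (g - w) |c. \<forall>g\<in>G. 0 \<le> c g}"

lemma cone_spanI:
  assumes "\<And>g. g \<in> G \<Longrightarrow> 0 \<le> c g" and "z = (\<Sum>g\<in>G. c g *\<^sub>R (g - w))"
  shows "z \<in> cone_span w G"
  using assms unfolding cone_span_def by blast

lemma cone_spanE:
  assumes "z \<in> cone_span w G"
  obtains c where "\<And>g. g \<in> G \<Longrightarrow> 0 \<le> c g" "z = (\<Sum>g\<in>G. c g *\<^sub>R (g - w))"
  using assms unfolding cone_span_def by blast

lemma cone_span_generator: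
  assumes "finite G" "g \<in> G" shows "g - w \<in> cone_span w G"
proof (rule cone_spanI[where c = "\<lambda>h. if h = g then 1 else 0"])
  show "g - w = (\<Sum>h\<in>G. (if h = g then 1 else 0) *\<^sub>R (h - w))"
    using assms by (simp add: if_distrib[of "\<lambda>a. a *\<^sub>R _"] cong: if_cong)
qed auto

lemma cone_span_add:
  assumes "x \<in> cone_span w G" "y \<in> cone_span w G" shows "x + y \<in> cone_span w G"
proof -
  obtain c where c: "\<And>g. g \<in> G \<Longrightarrow> 0 \<le> c g" "x = (\<Sum>g\<in>G. c g *\<^sub>R (g - w))"
    by (rule cone_spanE[OF assms(1)]) blast
  obtain d where d: "\<And>g. g \<in> G \<Longrightarrow> 0 \<le> d g" "y = (\<Sum>g\<in>G. d g *\<^sub>R (g - w))"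
    by (rule cone_spanE[OF assms(2)]) blast
  show ?thesis
    by (rule cone_spanI[where c = "\<lambda>g. c g + d g"]) (auto simp: c d sum.distrib scaleR_add_left)
qed

lemma cone_span_scale:
  assumes "x \<in> cone_span w G" "0 \<le> a" shows "a *\<^sub>R x \<in> cone_span w G"
proof -
  obtain c where c: "\<And>g. g \<in> G \<Longrightarrow> 0 \<le> c g" "x = (\<Sum>g\<in>G. c g *\<^sub>R (g - w))"
    by (rule cone_spanE[OF assms(1)]) blast
  show ?thesis
    by (rule cone_spanI[where c = "\<lambda>g. a * c g"]) (auto simp: c assms(2) scaleR_sum_right)
qed

lemma cone_span_sum:
  assumes "\<And>i. i \<in> I \<Longrightarrow> x i \<in> cone_span w G" shows "sum x I \<in> cone_span w G"
  using assms
proof (induction I rule: infinite_finite_induct)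
  case (insert i I)
  then show ?case by (simp add: cone_span_add)
qed (auto intro: cone_spanI[where c = "\<lambda>_. 0"])

lemma cone_span_subset:
  assumes "\<And>h. h \<in> H \<Longrightarrow> h - w \<in> cone_span w G" shows "cone_span w H \<subseteq> cone_span w G"
proof
  fix z assume "z \<in> cone_span w H"
  then obtain c where c: "\<And>g. g \<in> H \<Longrightarrow> 0 \<le> c g" "z = (\<Sum>g\<in>H. c g *\<^sub>R (g - w))"
    by (rule cone_spanE) blast
  show "z \<in> cone_span w G"
    unfolding c(2) by (intro cone_span_sum cone_span_scale assms c)
qed

lemma convex_hull_diff_cone_span:
  assumes "finite V" "z \<in> convex hull V" shows "z - w \<in> cone_span w (V - {w})"
proof -
  obtain a where a: "\<And>v. v \<in> V \<Longrightarrow> 0 \<le> a v" "sum a V = 1" "z = (\<Sum>v\<in>V. a v *\<^sub>R v)"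
    using assms by (auto simp: convex_hull_finite)
  have "z - w = (\<Sum>v\<in>V. a v *\<^sub>R (v - w))"
    using a by (simp add: scaleR_diff_right sum_subtractf flip: scaleR_sum_left)
  also have "\<dots> = (\<Sum>v\<in>V-{w}. a v *\<^sub>R (v - w))"
    using assms(1) by (intro sum.mono_neutral_right) auto
  finally show ?thesis using a(1) by (intro cone_spanI[where c = a]) auto
qed

text \<open>A nontrivial relation, divided by its total weight, would write \<open>w\<close> as a
  convex combination of the other points of \<open>V\<close>; but the hull without its extreme point
  \<open>w\<close> is still convex and contains their hull.\<close>

lemma extreme_point_no_positive_relation:
  fixes V :: "'a::euclidean_space set"
  assumes "finite V" "w extreme_point_of convex hull V"
    and "\<And>v. v \<in> V - {w} \<Longrightarrow> 0 \<le> c v" "(\<Sum>v\<in>V-{w}. c v *\<^sub>R (v - w)) = 0"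
    and "v \<in> V - {w}"
  shows "c v = 0"
proof (rule ccontr)
  assume "c v \<noteq> 0"
  define s where "s = sum c (V - {w})"
  have s: "s > 0" unfolding s_def
    using assms \<open>c v \<noteq> 0\<close> by (intro sum_pos2[of _ v]) (auto simp: less_le)
  have "s *\<^sub>R w = (\<Sum>v\<in>V-{w}. c v *\<^sub>R v)"
    using assms(4) by (simp add: s_def scaleR_sum_left scaleR_diff_right sum_subtractf)
  then have "(1 / s) *\<^sub>R (s *\<^sub>R w) = (\<Sum>v\<in>V-{w}. (c v / s) *\<^sub>R v)"
    by (simp only: scaleR_sum_right scaleR_scaleR) simp
  then have "w = (\<Sum>v\<in>V-{w}. (c v / s) *\<^sub>R v)"
    using s by simp
  moreover have "(\<Sum>v\<in>V-{w}. c v / s) = 1"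
    using s by (simp add: s_def flip: sum_divide_distrib)
  ultimately have "w \<in> convex hull (V - {w})"
    using assms(1,3) s by (auto simp: convex_hull_finite less_imp_le intro!: exI[of _ "\<lambda>v. c v / s"] divide_nonneg_pos)
  moreover have "convex hull (V - {w}) \<subseteq> convex hull V - {w}"
    using assms(2) hull_subset[of V convex]
    by (intro hull_minimal) (auto simp: extreme_point_of_stillconvex)
  ultimately show False by blast
qed

text \<open>
  Directions that generate the tangent cone at \<open>w\<close> and cannot be omitted span extreme rays, so
  the corresponding rays cut out edges.
\<close>

lemma polytope_edges_at_vertex:
  fixes V :: "'a::euclidean_space set"
  assumes V: "finite V" and w: "w extreme_point_of convex hull V"
  obtains G b where "finite G" "\<And>z. z \<in> convex hull V \<Longrightarrow> z - w \<in> cone_span w G"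
    "\<And>g. g \<in> G \<Longrightarrow> closed_segment w (b g) edge_of convex hull V"
    "\<And>g. g \<in> G \<Longrightarrow> g \<in> closed_segment w (b g)"
proof -
  define P where "P = convex hull V"
  let ?Q = "\<lambda>G. G \<subseteq> V - {w} \<and> (\<forall>z\<in>P. z - w \<in> cone_span w G)"
  have "?Q (V - {w})"
    using convex_hull_diff_cone_span[OF V] by (auto simp: P_def)
  then obtain G where G: "?Q G" and Gmin: "\<And>H. ?Q H \<Longrightarrow> card G \<le> card H"
    using ex_has_least_nat[of ?Q "V - {w}" card] by blast
  have finG: "finite G" using G V finite_subset by blast
  have irred: "g - w \<notin> cone_span w (G - {g})" if "g \<in> G" for g
  proof
    assume *: "g - w \<in> cone_span w (G - {g})"
    have "cone_span w G \<subseteq> cone_span w (G - {g})"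
    proof (rule cone_span_subset)
      fix h assume "h \<in> G"
      then show "h - w \<in> cone_span w (G - {g})"
        using * finG by (cases "h = g") (auto intro!: cone_span_generator)
    qed
    then have "?Q (G - {g})" using G by auto
    from Gmin[OF this] show False using that finG
      by (metis card_Diff1_less not_less)
  qed
  have pointed: "c g = 0" if "\<And>g. g \<in> G \<Longrightarrow> 0 \<le> c g" "(\<Sum>g\<in>G. c g *\<^sub>R (g - w)) = 0" "g \<in> G" for c g
  proof -
    have "(if g \<in> G then c g else 0) = 0"
    proof (rule extreme_point_no_positive_relation[OF V w, where c = "\<lambda>g. if g \<in> G then c g else 0"])
      have "(\<Sum>v\<in>V-{w}. (if v \<in> G then c v else 0) *\<^sub>R (v - w)) = (\<Sum>v\<in>G. c v *\<^sub>R (v - w))"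
        using V G by (intro sum.mono_neutral_cong_right) auto
      then show "(\<Sum>v\<in>V-{w}. (if v \<in> G then c v else 0) *\<^sub>R (v - w)) = 0" using that by simp
    qed (use that G in auto)
    then show ?thesis using that by simp
  qed
  define R where "R g = {z\<in>P. \<exists>l\<ge>0. z - w = l *\<^sub>R (g - w)}" for g
  have wP: "w \<in> P" using w by (simp add: extreme_point_of_def P_def)
  have wR: "w \<in> R g" for g using wP by (auto simp: R_def intro: exI[of _ 0])
  have coll: "convex (R g)" for g
  proof (rule convexI)
    fix x y and u v :: real assume *: "x \<in> R g" "y \<in> R g" "0 \<le> u" "0 \<le> v" "u + v = 1"
    then obtain l m where lm: "l \<ge> 0" "x - w = l *\<^sub>R (g - w)" "m \<ge> 0" "y - w = m *\<^sub>R (g - w)"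
      by (auto simp: R_def)
    have "u *\<^sub>R x + v *\<^sub>R y - w = u *\<^sub>R (x - w) + v *\<^sub>R (y - w)"
      using arg_cong[OF *(5), of "\<lambda>t. t *\<^sub>R w"] by (simp add: algebra_simps)
    also have "\<dots> = (u * l + v * m) *\<^sub>R (g - w)"
      by (simp add: lm scaleR_add_left)
    finally show "u *\<^sub>R x + v *\<^sub>R y \<in> R g"
      using * lm unfolding R_def P_def
      by (auto intro!: exI[of _ "u * l + v * m"] convexD[OF convex_convex_hull])
  qed
  have face: "R g face_of P" if g: "g \<in> G" for g
    unfolding face_of_def
  proof (intro conjI ballI impI)
    show "convex (R g)" by (rule coll)
    show "R g \<subseteq> P" by (auto simp: R_def)
    have both: "a \<in> R g"
      if ab: "a \<in> P" "b \<in> P" "x \<in> R g" "x \<in> open_segment a b" for a b x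
    proof -
      obtain \<alpha> where \<alpha>: "\<And>g. g \<in> G \<Longrightarrow> 0 \<le> \<alpha> g" "a - w = (\<Sum>g\<in>G. \<alpha> g *\<^sub>R (g - w))"
        using cone_spanE[of "a - w" w G] G ab(1) by metis
      obtain \<beta> where \<beta>: "\<And>g. g \<in> G \<Longrightarrow> 0 \<le> \<beta> g" "b - w = (\<Sum>g\<in>G. \<beta> g *\<^sub>R (g - w))"
        using cone_spanE[of "b - w" w G] G ab(2) by metis
      obtain u where u: "0 < u" "u < 1" "x = (1 - u) *\<^sub>R a + u *\<^sub>R b"
        using ab(4) by (auto simp: in_segment)
      obtain l where l: "0 \<le> l" "x - w = l *\<^sub>R (g - w)" using ab(3) by (auto simp: R_def)
      define \<gamma> where "\<gamma> h = (1 - u) * \<alpha> h + u * \<beta> h" for h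
      have \<gamma>: "\<gamma> h \<ge> 0" if "h \<in> G" for h using \<alpha>(1) \<beta>(1) u that by (simp add: \<gamma>_def)
      have "x - w = (1 - u) *\<^sub>R (a - w) + u *\<^sub>R (b - w)"
        unfolding u(3) by (simp add: algebra_simps)
      also have "\<dots> = (\<Sum>h\<in>G. \<gamma> h *\<^sub>R (h - w))"
        by (simp add: \<alpha>(2) \<beta>(2) \<gamma>_def scaleR_sum_right scaleR_add_left sum.distrib)
      finally have eq: "l *\<^sub>R (g - w) = \<gamma> g *\<^sub>R (g - w) + (\<Sum>h\<in>G-{g}. \<gamma> h *\<^sub>R (h - w))"
        using l(2) finG g by (simp add: sum.remove)
      \<comment> \<open>Otherwise dividing by \<open>l - \<gamma> g\<close> expresses
        \<open>g - w\<close> through the other generators, against irredundancy.\<close>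
      have le: "l \<le> \<gamma> g"
      proof (rule ccontr)
        assume "\<not> l \<le> \<gamma> g"
        then have pos: "l - \<gamma> g > 0" by simp
        have "(l - \<gamma> g) *\<^sub>R (g - w) = (\<Sum>h\<in>G-{g}. \<gamma> h *\<^sub>R (h - w))"
          using eq by (simp add: algebra_simps)
        also have "\<dots> \<in> cone_span w (G - {g})" using \<gamma> by (intro cone_spanI[where c = \<gamma>]) auto
        finally have "(inverse (l - \<gamma> g) * (l - \<gamma> g)) *\<^sub>R (g - w) \<in> cone_span w (G - {g})"
          unfolding scaleR_scaleR[symmetric] by (rule cone_span_scale) (use pos in simp)
        moreover have "inverse (l - \<gamma> g) * (l - \<gamma> g) = 1" using pos by simp
        ultimately show False using irred[OF g] by (simp only: scaleR_one)
      qed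
      \<comment> \<open>With \<open>l\<close> moved across, the relation has nonnegative
        coefficients only, so \<open>pointed\<close> makes all of them vanish.\<close>
      have zero: "(if h = g then \<gamma> g - l else \<gamma> h) = 0" if "h \<in> G" for h
      proof (rule pointed[OF _ _ that])
        have "(\<Sum>h\<in>G. (if h = g then \<gamma> g - l else \<gamma> h) *\<^sub>R (h - w))
              = (\<gamma> g - l) *\<^sub>R (g - w) + (\<Sum>h\<in>G-{g}. \<gamma> h *\<^sub>R (h - w))"
          using finG g by (simp add: sum.remove)
        also have "\<dots> = 0" using eq by (simp add: algebra_simps)
        finally show "(\<Sum>h\<in>G. (if h = g then \<gamma> g - l else \<gamma> h) *\<^sub>R (h - w)) = 0" .
      qed (use \<gamma> le in auto)
      have "\<alpha> h = 0" if "h \<in> G - {g}" for h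
      proof -
        have "(1 - u) * \<alpha> h + u * \<beta> h = 0" using zero[of h] that by (auto simp: \<gamma>_def)
        moreover have "0 \<le> \<alpha> h" "0 \<le> \<beta> h" using that \<alpha> \<beta> by auto
        ultimately have "(1 - u) * \<alpha> h = 0"
          using u(1,2) by (smt (verit) mult_nonneg_nonneg)
        then show ?thesis using u by simp
      qed
      then have "a - w = \<alpha> g *\<^sub>R (g - w)"
        unfolding \<alpha>(2) using finG g by (simp add: sum.remove)
      then show ?thesis using ab(1) \<alpha>(1) g by (auto simp: R_def)
    qed
    fix a b x assume *: "a \<in> P" "b \<in> P" "x \<in> R g" "x \<in> open_segment a b"
    show "a \<in> R g" by (rule both[OF *])
    show "b \<in> R g" by (rule both[OF *(2,1,3)]) (use *(4) in \<open>simp add: open_segment_commute\<close>)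
  qed
  have "\<exists>b. closed_segment w b edge_of P \<and> g \<in> closed_segment w b" if g: "g \<in> G" for g
  proof -
    have gw: "g \<noteq> w" using G g by auto
    have "g \<in> V" using G g by auto
    then have "g \<in> P" unfolding P_def by (rule hull_inc)
    then have gR: "g \<in> R g" unfolding R_def by (auto intro!: exI[of _ "1::real"])
    have "compact P" using V by (simp add: P_def finite_imp_compact_convex_hull)
    then have "compact (R g)" using face_of_imp_compact[of P "R g"] face[OF g] by (simp add: P_def)
    moreover have "collinear (R g)"
    proof -
      have "\<exists>c. x = w + c *\<^sub>R (g - w)" if x: "x \<in> R g" for x
      proof -
        obtain l where "x - w = l *\<^sub>R (g - w)" using x by (auto simp: R_def)
        then show ?thesis by (intro exI[of _ l]) (simp add: algebra_simps)
      qed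
      then show ?thesis unfolding collinear_alt by blast
    qed
    ultimately obtain a b where ab: "R g = closed_segment a b"
      using compact_convex_collinear_segment[of "R g"] coll wR by blast
    have "w extreme_point_of R g"
      using w wR face[OF g] by (simp add: extreme_point_of_face P_def)
    then obtain b' where b': "R g = closed_segment w b'"
      using ab by (metis closed_segment_commute extreme_point_of_segment)
    then have "b' \<noteq> w" using gR gw by auto
    then have "aff_dim (closed_segment w b') = 1"
      by (simp add: segment_convex_hull aff_dim_convex_hull aff_dim_2)
    then show ?thesis using face[OF g] b' gR by (auto simp: edge_of_def)
  qed
  then obtain b where "\<And>g. g \<in> G \<Longrightarrow> closed_segment w (b g) edge_of P \<and> g \<in> closed_segment w (b g)"
    by metis
  then show thesis using that[of G b] finG G by (auto simp: P_def)
qed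

text \<open>The stopping rule of the simplex method: the edges at \<open>w\<close> generate the
  tangent cone, and \<open>f\<close> does not decrease along any of them. It turns knowledge about
  edges into facet inequalities.\<close>

lemma linear_local_min_vertex:
  fixes V :: "'a::euclidean_space set" and f :: "'a \<Rightarrow> real"
  assumes V: "finite V" and w: "w extreme_point_of convex hull V" and f: "linear f"
    and min: "\<And>b. closed_segment w b edge_of convex hull V \<Longrightarrow> f w \<le> f b"
    and z: "z \<in> convex hull V"
  shows "f w \<le> f z"
proof -
  obtain G b where G: "finite G" "\<And>z. z \<in> convex hull V \<Longrightarrow> z - w \<in> cone_span w G"
    "\<And>g. g \<in> G \<Longrightarrow> closed_segment w (b g) edge_of convex hull V"
    "\<And>g. g \<in> G \<Longrightarrow> g \<in> closed_segment w (b g)"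
    by (rule polytope_edges_at_vertex[OF V w]) blast
  obtain c where c: "\<And>g. g \<in> G \<Longrightarrow> 0 \<le> c g" "z - w = (\<Sum>g\<in>G. c g *\<^sub>R (g - w))"
    by (rule cone_spanE[OF G(2)[OF z]]) blast
  have "0 \<le> f (g - w)" if g: "g \<in> G" for g
  proof -
    obtain u where u: "0 \<le> u" "g = (1 - u) *\<^sub>R w + u *\<^sub>R b g"
      using G(4)[OF g] by (auto simp: in_segment)
    then have "g - w = u *\<^sub>R (b g - w)"
      by (simp add: algebra_simps)
    then have "f (g - w) = u * (f (b g) - f w)" using f by (simp add: linear_cmul linear_diff)
    then show ?thesis using u(1) min[OF G(3)[OF g]] by simp
  qed
  then have "0 \<le> (\<Sum>g\<in>G. c g * f (g - w))" using c(1) by (intro sum_nonneg) auto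
  also have "\<dots> = f (z - w)" unfolding c(2) using f by (simp add: linear_sum linear_cmul)
  finally show ?thesis using f by (simp add: linear_diff)
qed

subsection \<open>Lattice bases\<close>

text \<open>The dual basis of \<open>E\<close>. When \<open>E\<close> consists of the edge
  directions at a vertex, these functionals are the inner normals of the facets through that
  vertex.\<close>

definition lattice_coord :: "(int ^ 'n) set \<Rightarrow> int ^ 'n \<Rightarrow> int ^ 'n \<Rightarrow> int" where
  "lattice_coord E u m = (THE c. (\<forall>u. u \<notin> E \<longrightarrow> c u = 0) \<and> m = (\<Sum>u\<in>E. c u *s u)) u"

lemma lattice_coord_theI:
  fixes E :: "(int ^ 'n) set"
  assumes "lattice_basis E"
  shows "(\<forall>u. u \<notin> E \<longrightarrow> lattice_coord E u m = 0) \<and> m = (\<Sum>u\<in>E. lattice_coord E u m *s u)"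
proof -
  have "\<exists>!c :: int ^ 'n \<Rightarrow> int. (\<forall>u. u \<notin> E \<longrightarrow> c u = 0) \<and> m = (\<Sum>u\<in>E. c u *s u)"
    using assms unfolding lattice_basis_def by blast
  from theI'[OF this] show ?thesis unfolding lattice_coord_def .
qed

lemma lattice_coord_sum:
  "lattice_basis E \<Longrightarrow> (\<Sum>u\<in>E. lattice_coord E u m *s u) = m"
  using lattice_coord_theI by metis

lemma lattice_coord_unique:
  fixes E :: "(int ^ 'n) set"
  assumes "lattice_basis E" "m = (\<Sum>u\<in>E. c u *s u)" "u \<in> E"
  shows "lattice_coord E u m = c u"
proof -
  let ?Q = "\<lambda>c. (\<forall>u. u \<notin> E \<longrightarrow> c u = 0) \<and> m = (\<Sum>u\<in>E. c u *s u)"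
  have ex1: "\<exists>!c :: int ^ 'n \<Rightarrow> int. ?Q c"
    using assms unfolding lattice_basis_def by blast
  have 1: "?Q (\<lambda>u. lattice_coord E u m)" by (rule lattice_coord_theI[OF assms(1)])
  have "(\<Sum>u\<in>E. c u *s u) = (\<Sum>u\<in>E. (if u \<in> E then c u else 0) *s u)"
    by (rule sum.cong) simp_all
  from trans[OF assms(2) this] have 2: "?Q (\<lambda>u. if u \<in> E then c u else 0)"
    by (rule conjI[rotated]) simp
  obtain c0 where c0: "\<And>c. ?Q c \<Longrightarrow> c = c0" using ex1 by (rule ex1E) iprover
  have "(\<lambda>u. lattice_coord E u m) = (\<lambda>u. if u \<in> E then c u else 0)"
    unfolding c0[OF 1] c0[OF 2] ..
  from fun_cong[OF this, of u] show ?thesis by (simp only: assms(3) if_True)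
qed

lemma lattice_coord_add:
  assumes "lattice_basis E" "u \<in> E"
  shows "lattice_coord E u (a + b) = lattice_coord E u a + lattice_coord E u b"
proof (rule lattice_coord_unique[OF assms(1) _ assms(2)])
  have "a + b = (\<Sum>u\<in>E. lattice_coord E u a *s u) + (\<Sum>u\<in>E. lattice_coord E u b *s u)"
    by (simp only: lattice_coord_sum[OF assms(1)])
  then show "a + b = (\<Sum>u\<in>E. (lattice_coord E u a + lattice_coord E u b) *s u)"
    by (simp only: vector_sadd_rdistrib sum.distrib)
qed

lemma smult_sum_int: "k *s (\<Sum>u\<in>E. f u) = (\<Sum>u\<in>E. k *s (f u :: int ^ 'n))"
  by (simp add: vec_eq_iff sum_distrib_left)

lemma lattice_coord_smult:
  assumes "lattice_basis E" "u \<in> E"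
  shows "lattice_coord E u (k *s a) = k * lattice_coord E u a"
proof (rule lattice_coord_unique[OF assms(1) _ assms(2)])
  have "k *s a = k *s (\<Sum>u\<in>E. lattice_coord E u a *s u)"
    by (simp only: lattice_coord_sum[OF assms(1)])
  then show "k *s a = (\<Sum>u\<in>E. (k * lattice_coord E u a) *s u)"
    by (simp only: smult_sum_int vector_smult_assoc)
qed

lemma lattice_coord_0: "lattice_basis E \<Longrightarrow> u \<in> E \<Longrightarrow> lattice_coord E u 0 = 0"
  using lattice_coord_smult[of E u 0 0] by simp

lemma lattice_coord_minus:
  assumes "lattice_basis E" "u \<in> E" shows "lattice_coord E u (- a) = - lattice_coord E u a"
  using lattice_coord_add[OF assms, of a "- a"] lattice_coord_0[OF assms] by simp

lemma lattice_coord_diff: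
  assumes "lattice_basis E" "u \<in> E"
  shows "lattice_coord E u (a - b) = lattice_coord E u a - lattice_coord E u b"
  using lattice_coord_add[OF assms, of "a - b" b] by simp

lemma lattice_coord_sum_vec:
  assumes "lattice_basis E" "u \<in> E"
  shows "lattice_coord E u (\<Sum>i\<in>I. f i) = (\<Sum>i\<in>I. lattice_coord E u (f i))"
  by (induction I rule: infinite_finite_induct)
     (auto simp: lattice_coord_add[OF assms] lattice_coord_0[OF assms])

lemma lattice_coord_basis:
  assumes "lattice_basis E" "u \<in> E" "w \<in> E"
  shows "lattice_coord E u w = (if u = w then 1 else 0)"
proof (rule lattice_coord_unique[OF assms(1) _ assms(2)])
  have "finite E" using assms by (simp add: lattice_basis_def)
  have "(\<Sum>u\<in>E. (if u = w then 1 else 0) *s u) = (\<Sum>u\<in>E. if u = w then u else 0)"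
    by (intro sum.cong) auto
  then show "w = (\<Sum>u\<in>E. (if u = w then 1 else 0) *s u)"
    using \<open>finite E\<close> assms by simp
qed

lemma lattice_coord_eqI:
  assumes "lattice_basis E" "\<And>u. u \<in> E \<Longrightarrow> lattice_coord E u a = lattice_coord E u b"
  shows "a = b"
proof -
  have "(\<Sum>u\<in>E. lattice_coord E u a *s u) = (\<Sum>u\<in>E. lattice_coord E u b *s u)"
    using assms(2) by (intro sum.cong) auto
  then show ?thesis by (simp only: lattice_coord_sum[OF assms(1)])
qed

section \<open>Lattice coordinates of real vectors\<close>

lemma real_vec_add: "real_vec (a + b) = real_vec a + real_vec b"
  and real_vec_smult: "real_vec (k *s a) = real_of_int k *\<^sub>R real_vec a"
  and real_vec_eq_iff: "real_vec a = real_vec b \<longleftrightarrow> a = b"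
  by (simp_all add: real_vec_def vec_eq_iff)

lemma real_vec_sum: "real_vec (\<Sum>i\<in>I. f i) = (\<Sum>i\<in>I. real_vec (f i))"
  by (simp add: real_vec_def vec_eq_iff)

lemma inj_real_vec: "inj_on real_vec A"
  by (simp add: inj_on_def real_vec_eq_iff)

text \<open>The linear extension of \<open>lattice_coord\<close> from lattice to real vectors, given
  by its values on the standard basis; extreme points and cones live in the real space.\<close>

definition real_coord :: "(int ^ 'n) set \<Rightarrow> int ^ 'n \<Rightarrow> real ^ 'n \<Rightarrow> real" where
  "real_coord E u x = (\<Sum>j\<in>UNIV. x $ j * real_of_int (lattice_coord E u (axis j 1)))"

lemma linear_real_coord: "linear (real_coord E u)"
  by (rule linearI) (simp_all add: real_coord_def algebra_simps sum.distrib sum_distrib_left)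

lemma real_coord_real_vec:
  assumes "lattice_basis E" "u \<in> E"
  shows "real_coord E u (real_vec m) = real_of_int (lattice_coord E u m)"
proof -
  have "lattice_coord E u m = lattice_coord E u (\<Sum>j\<in>UNIV. (m $ j) *s axis j 1)"
    by (simp only: basis_expansion)
  also have "\<dots> = (\<Sum>j\<in>UNIV. m $ j * lattice_coord E u (axis j 1))"
    using assms by (simp add: lattice_coord_sum_vec lattice_coord_smult)
  finally show ?thesis by (simp add: real_coord_def real_vec_def)
qed

lemma real_coord_sum:
  fixes x :: "real ^ 'n"
  assumes E: "lattice_basis E" shows "(\<Sum>u\<in>E. real_coord E u x *\<^sub>R real_vec u) = x"
proof -
  let ?g = "\<lambda>x. \<Sum>u\<in>E. real_coord E u x *\<^sub>R real_vec u"
  have lin: "linear ?g"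
    using linear_real_coord[of E]
    by (intro linearI) (simp_all add: linear_add linear_cmul scaleR_add_left sum.distrib scaleR_sum_right)
  have "?g (axis j 1) = axis j 1" for j
  proof -
    have ax: "real_vec (axis j 1) = (axis j 1 :: real ^ 'n)"
      by (simp add: real_vec_def axis_def vec_eq_iff)
    have "?g (real_vec m) = real_vec m" for m
    proof -
      have "?g (real_vec m) = (\<Sum>u\<in>E. real_vec (lattice_coord E u m *s u))"
        using E by (intro sum.cong) (simp_all add: real_coord_real_vec real_vec_smult)
      also have "\<dots> = real_vec m" by (simp add: lattice_coord_sum[OF E] flip: real_vec_sum)
      finally show ?thesis .
    qed
    from this[of "axis j 1"] show ?thesis by (simp add: ax)
  qed
  then have "?g b = b" if "b \<in> Basis" for b using that by (auto simp: Basis_vec_def)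
  then have "?g = (\<lambda>x. x)" using linear_eq_stdbasis[OF lin linear_ident] by blast
  then show ?thesis by metis
qed

text \<open>The real images of a lattice basis form a basis of the real vector space, whose
  dimension is \<open>CARD('n)\<close>.\<close>

lemma card_lattice_basis:
  fixes E :: "(int ^ 'n) set"
  assumes E: "lattice_basis E" shows "card E = CARD('n)"
proof -
  let ?B = "real_vec ` E"
  have fin: "finite E" using E by (simp add: lattice_basis_def)
  have "independent ?B"
  proof (rule independent_if_scalars_zero)
    fix f x assume *: "(\<Sum>x\<in>?B. f x *\<^sub>R x) = 0" "x \<in> ?B"
    then obtain w where w: "w \<in> E" "x = real_vec w" by blast
    have "0 = real_coord E w (\<Sum>x\<in>?B. f x *\<^sub>R x)"
      using * linear_real_coord[of E w] by (simp add: linear_0)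
    also have "\<dots> = (\<Sum>u\<in>E. f (real_vec u) * real_coord E w (real_vec u))"
      using linear_real_coord[of E w]
      by (simp add: sum.reindex[OF inj_real_vec] linear_sum linear_cmul)
    also have "\<dots> = (\<Sum>u\<in>E. if u = w then f (real_vec u) else 0)"
      using E w by (intro sum.cong) (auto simp: real_coord_real_vec lattice_coord_basis)
    also have "\<dots> = f x" using fin w by simp
    finally show "f x = 0" by simp
  qed (use fin in simp)
  moreover have "UNIV \<subseteq> span ?B"
  proof
    fix x :: "real ^ 'n"
    have "(\<Sum>u\<in>E. real_coord E u x *\<^sub>R real_vec u) \<in> span ?B"
      by (intro span_sum span_scale span_base) auto
    then show "x \<in> span ?B" by (simp add: real_coord_sum[OF E])
  qed
  ultimately have "card ?B = dim (UNIV :: (real ^ 'n) set)"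
    by (intro basis_card_eq_dim) auto
  then show ?thesis by (simp add: card_image[OF inj_real_vec])
qed

lemma primitive_multiple:
  fixes d :: "int ^ 'n"
  assumes "d \<noteq> 0"
  obtains k u where "k > 0" "primitive u" "d = k *s u"
proof -
  define k where "k = Gcd (range (vec_nth d))"
  have k0: "k \<noteq> 0" using assms by (auto simp: k_def Gcd_0_iff vec_eq_iff)
  have "k \<ge> 0" using Gcd_int_greater_eq_0 by (auto simp: k_def)
  then have k: "k > 0" using k0 by simp
  define u where "u = (\<chi> i. d $ i div k)"
  have dvd: "k dvd d $ i" for i unfolding k_def by (rule Gcd_dvd) auto
  then have d: "d = k *s u" by (simp add: u_def vec_eq_iff)
  have "vec_nth d = (\<lambda>i. k * vec_nth u i)" using dvd by (simp add: u_def fun_eq_iff)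
  then have "range (vec_nth d) = (*) k ` range (vec_nth u)" by (simp only: image_image)
  then have "k = Gcd ((*) k ` range (vec_nth u))" by (simp only: k_def)
  also have "\<dots> = k * Gcd (range (vec_nth u))"
    using k by (simp add: Gcd_mult abs_mult)
  finally have "primitive u" using k by (simp add: primitive_def)
  then show thesis using that k d by blast
qed

lemma primitive_uminus:
  assumes "primitive u" shows "primitive (- u)"
proof -
  have "1 dvd Gcd (range (vec_nth (- u)))" by simp
  moreover have "Gcd (range (vec_nth (- u))) dvd Gcd (range (vec_nth u))"
  proof (rule Gcd_greatest)
    fix b assume "b \<in> range (vec_nth u)"
    then obtain i where "b = u $ i" by blast
    then have "- b = (- u) $ i" by simp
    then have "- b \<in> range (vec_nth (- u))" by (rule range_eqI)
    from Gcd_dvd[OF this] show "Gcd (range (vec_nth (- u))) dvd b" by (simp only: dvd_minus_iff)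
  qed
  ultimately show ?thesis
    using assms Gcd_int_greater_eq_0[of "range (vec_nth (- u))"]
    by (simp add: primitive_def)
qed

subsection \<open>Smooth polytopes in terms of vertices and edge directions\<close>

locale smooth_polytope =
  fixes P :: "(real ^ 'n) set"
  assumes smooth: "smooth_lattice_polytope P"
begin

abbreviation V :: "(int ^ 'n) set" where "V \<equiv> vertices P"
abbreviation E :: "int ^ 'n \<Rightarrow> (int ^ 'n) set" where "E \<equiv> edge_dirs P"
abbreviation coord :: "int ^ 'n \<Rightarrow> int ^ 'n \<Rightarrow> int ^ 'n \<Rightarrow> int" where
  "coord v \<equiv> lattice_coord (E v)"

lemma basis: "v \<in> V \<Longrightarrow> lattice_basis (E v)"
  using smooth by (simp add: smooth_lattice_polytope_def)

lemma finite_E: "v \<in> V \<Longrightarrow> finite (E v)"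
  using basis by (simp add: lattice_basis_def)

lemma card_E: "v \<in> V \<Longrightarrow> card (E v) = CARD('n)"
  using basis by (rule card_lattice_basis)

text \<open>The extreme points are among the lattice points that span \<open>P\<close>, so
  \<open>vertices\<close>, which records only lattice points, misses none of them, and Krein-Milman
  recovers \<open>P\<close>.\<close>

lemma extreme_points_P: "{x. x extreme_point_of P} = real_vec ` V"
  and finite_V: "finite V" and P_eq: "P = convex hull (real_vec ` V)"
proof -
  obtain W where W: "finite W" "P = convex hull (real_vec ` W)"
    using smooth unfolding smooth_lattice_polytope_def lattice_polytope_def by blast
  have sub: "{x. x extreme_point_of P} \<subseteq> real_vec ` W"
    using extreme_point_of_convex_hull W by blast
  then show eq: "{x. x extreme_point_of P} = real_vec ` V" by (auto simp: vertices_def)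
  have "real_vec ` V \<subseteq> real_vec ` W" using sub eq by blast
  then have "V \<subseteq> W" by (simp add: inj_image_subset_iff inj_real_vec)
  then show "finite V" using W finite_subset by blast
  show "P = convex hull (real_vec ` V)"
    using W Krein_Milman_polytope[of "real_vec ` W"] eq by simp
qed

lemma convex_P: "convex P"
  by (subst P_eq) (rule convex_convex_hull)

lemma V_nonempty: "V \<noteq> {}"
proof
  assume "V = {}"
  then have "aff_dim P = -1" by (subst P_eq) simp
  then show False using smooth by (simp add: smooth_lattice_polytope_def)
qed

lemma edge_endpoint:
  assumes "v \<in> V" "u \<in> E v"
  obtains k where "k > 0" "v + k *s u \<in> V" "- u \<in> E (v + k *s u)"
proof -
  obtain k where k: "k > 0" "closed_segment (real_vec v) (real_vec (v + k *s u)) edge_of P"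
    and u: "primitive u"
    using assms(2) by (auto simp: edge_dirs_def)
  let ?w = "v + k *s u"
  have "real_vec ?w extreme_point_of closed_segment (real_vec v) (real_vec ?w)"
    by (simp add: extreme_point_of_segment)
  then have w: "?w \<in> V"
    using k(2) extreme_point_of_face unfolding edge_of_def vertices_def by blast
  have bk: "?w + k *s (- u) = v" by (simp add: vec_eq_iff)
  have "closed_segment (real_vec ?w) (real_vec (?w + k *s (- u))) edge_of P"
    unfolding bk by (subst closed_segment_commute) (rule k(2))
  then have "- u \<in> E ?w"
    using k(1) primitive_uminus[OF u] unfolding edge_dirs_def by (intro CollectI conjI exI[of _ k])
  from that[OF k(1) w this] show thesis .
qed

text \<open>An edge at \<open>v\<close> is a positive multiple of some direction in
  \<open>E v\<close>, on which the coordinate is 0 or 1. Hence it is minimal at \<open>v\<close>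
  among the neighbours and so on all of \<open>P\<close>: the coordinates are facet
  functionals.\<close>

lemma real_coord_vertex_le:
  assumes v: "v \<in> V" and u: "u \<in> E v" and z: "z \<in> P"
  shows "real_coord (E v) u (real_vec v) \<le> real_coord (E v) u z"
proof -
  let ?f = "real_coord (E v) u"
  have ext: "real_vec v extreme_point_of convex hull (real_vec ` V)"
  proof (rule subst[OF P_eq, where P = "\<lambda>Q. real_vec v extreme_point_of Q"])
    show "real_vec v extreme_point_of P" using v by (simp add: vertices_def)
  qed
  have min: "?f (real_vec v) \<le> ?f b"
    if b: "closed_segment (real_vec v) b edge_of convex hull (real_vec ` V)" for b
  proof -
    have e: "closed_segment (real_vec v) b edge_of P" by (rule ssubst[OF P_eq, where P = "\<lambda>Q. _ edge_of Q"]) (rule b)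
    have "b extreme_point_of closed_segment (real_vec v) b" by (simp add: extreme_point_of_segment)
    then have "b extreme_point_of P" using e extreme_point_of_face unfolding edge_of_def by blast
    then obtain b' where b': "b = real_vec b'" using extreme_points_P by auto
    have "b' \<noteq> v"
    proof
      assume "b' = v"
      then have "aff_dim (closed_segment (real_vec v) b) = 0" using b' by simp
      then show False using e by (simp add: edge_of_def)
    qed
    then obtain k y where ky: "k > 0" "primitive y" "b' - v = k *s y"
      using primitive_multiple[of "b' - v"] by auto
    have "b' = v + k *s y" using ky(3) by (simp add: algebra_simps)
    then have y: "y \<in> E v" using e ky b' by (auto simp: edge_dirs_def)
    have "0 \<le> lattice_coord (E v) u (b' - v)"
      using basis[OF v] u y ky by (simp add: lattice_coord_smult lattice_coord_basis)
    then have "lattice_coord (E v) u v \<le> lattice_coord (E v) u b'"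
      using basis[OF v] u by (simp add: lattice_coord_diff)
    then show ?thesis using basis[OF v] u b' by (simp add: real_coord_real_vec)
  qed
  have zz: "z \<in> convex hull (real_vec ` V)" by (rule subst[OF P_eq, where P = "\<lambda>Q. z \<in> Q"]) (rule z)
  show ?thesis
    by (rule linear_local_min_vertex[OF finite_imageI[OF finite_V] ext linear_real_coord min zz])
qed

lemma coord_nonneg:
  assumes "v \<in> V" "u \<in> E v" "w \<in> V" shows "coord v u (w - v) \<ge> 0"
proof -
  have "real_vec w \<in> P" using assms(3) by (simp add: vertices_def extreme_point_of_def)
  from real_coord_vertex_le[OF assms(1,2) this] show ?thesis
    using assms basis by (simp add: real_coord_real_vec lattice_coord_diff)
qed

text \<open>The chart is an affine space: its monoid is freely generated by the edge directions. One
  inclusion is the facet inequality; for the other, each edge direction is a positive multiple of a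
  difference of points of \<open>P\<close>.\<close>

lemma chart_monoid_iff:
  assumes v: "v \<in> V"
  shows "m \<in> chart_monoid P v \<longleftrightarrow> (\<forall>u\<in>E v. coord v u m \<ge> 0)"
proof
  let ?K = "(\<lambda>x. x - real_vec v) ` P"
  assume "m \<in> chart_monoid P v"
  then have m: "real_vec m \<in> cone hull ?K" by (simp add: chart_monoid_def)
  have "convex ?K" by (simp add: convex_translation_subtract convex_P)
  show "\<forall>u\<in>E v. coord v u m \<ge> 0"
  proof
    fix u assume u: "u \<in> E v"
    obtain c z where cz: "c \<ge> 0" "z \<in> P" "real_vec m = c *\<^sub>R (z - real_vec v)"
      using m unfolding cone_hull_expl by auto
    have "real_of_int (coord v u m) = c * (real_coord (E v) u z - real_coord (E v) u (real_vec v))"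
      using cz(3) basis[OF v] u linear_real_coord[of "E v" u]
      by (simp add: linear_cmul linear_diff flip: real_coord_real_vec)
    also have "\<dots> \<ge> 0" using cz real_coord_vertex_le[OF v u] by simp
    finally show "coord v u m \<ge> 0" by simp
  qed
next
  let ?K = "(\<lambda>x. x - real_vec v) ` P"
  assume *: "\<forall>u\<in>E v. coord v u m \<ge> 0"
  have conv: "convex (cone hull ?K)" by (intro convex_cone_hull) (simp add: convex_translation_subtract convex_P)
  have vP: "real_vec v \<in> P" using v by (simp add: vertices_def extreme_point_of_def)
  have zero: "0 \<in> cone hull ?K" using vP by (intro hull_inc) (auto simp: image_iff)
  have c: "cone (cone hull ?K)" by (rule cone_cone_hull)
  have add: "x + y \<in> cone hull ?K" if "x \<in> cone hull ?K" "y \<in> cone hull ?K" for x y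
    using conv c that convex_cone[of "cone hull ?K"] by blast
  have gen: "real_vec u \<in> cone hull ?K" if u: "u \<in> E v" for u
  proof -
    obtain k where k: "k > 0" "v + k *s u \<in> V" by (rule edge_endpoint[OF v u]) iprover
    have "real_vec (v + k *s u) - real_vec v \<in> cone hull ?K"
      using k(2) by (intro hull_inc imageI) (simp add: vertices_def extreme_point_of_def)
    then have "real_of_int k *\<^sub>R real_vec u \<in> cone hull ?K" by (simp add: real_vec_add real_vec_smult)
    then have "(1 / real_of_int k) *\<^sub>R real_of_int k *\<^sub>R real_vec u \<in> cone hull ?K"
      by (rule mem_cone[OF c]) (use k(1) in simp)
    then show ?thesis using k(1) by simp
  qed
  have "(\<Sum>u\<in>F. real_of_int (coord v u m) *\<^sub>R real_vec u) \<in> cone hull ?K" if "F \<subseteq> E v" for F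
    using that
  proof (induction F rule: infinite_finite_induct)
    case (insert u F)
    then have "real_of_int (coord v u m) *\<^sub>R real_vec u \<in> cone hull ?K"
      using * gen by (intro mem_cone[OF c]) auto
    with insert show ?case by (simp add: add)
  qed (use zero in auto)
  from this[of "E v"] have "real_vec m \<in> cone hull ?K"
    by (simp add: lattice_coord_sum[OF basis[OF v]] flip: real_vec_smult real_vec_sum)
  then show "m \<in> chart_monoid P v" by (simp add: chart_monoid_def)
qed

end

context smooth_polytope
begin

lemmas coord_simps = lattice_coord_add[OF basis] lattice_coord_diff[OF basis]
  lattice_coord_minus[OF basis] lattice_coord_smult[OF basis] lattice_coord_0[OF basis]
  lattice_coord_basis[OF basis] lattice_coord_sum_vec[OF basis]

abbreviation can :: "int ^ 'n \<Rightarrow> int ^ 'n" where "can \<equiv> canonical_bundle P"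

lemma coord_can: "v \<in> V \<Longrightarrow> u \<in> E v \<Longrightarrow> coord v u (can v) = 1"
  by (simp add: canonical_bundle_def coord_simps finite_E)

lemma coord_expand:
  assumes "v \<in> V" "u \<in> E v" "w \<in> V"
  shows "coord v u m = (\<Sum>e\<in>E w. coord w e m * coord v u e)"
proof -
  have "coord v u m = coord v u (\<Sum>e\<in>E w. coord w e m *s e)"
    using assms by (simp only: lattice_coord_sum[OF basis])
  also have "\<dots> = (\<Sum>e\<in>E w. coord w e m * coord v u e)"
    using assms(1,2) by (simp only: lattice_coord_sum_vec[OF basis] lattice_coord_smult[OF basis])
  finally show ?thesis .
qed

subsection \<open>Facets and edges\<close>

text \<open>The edge starts on the facet and ends at a vertex, where the facet inequality
  holds.\<close>

lemma coord_edge_nonneg: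
  assumes "v \<in> V" "u \<in> E v" "w \<in> V" "coord v u (w - v) = 0" "e \<in> E w"
  shows "coord v u e \<ge> 0"
proof -
  obtain k where k: "k > 0" "w + k *s e \<in> V"
    by (rule edge_endpoint[OF assms(3,5)]) iprover
  have "0 \<le> coord v u ((w - v) + k *s e)"
    using coord_nonneg[OF assms(1,2) k(2)] by (simp add: algebra_simps)
  then have "0 \<le> k * coord v u e" using assms by (simp add: coord_simps)
  then show ?thesis using k(1) by (simp add: zero_le_mult_iff)
qed

text \<open>
  The functional is a combination of the facet functionals at \<open>w\<close> with nonnegative integer
  coefficients.  A facet functional with positive coefficient vanishes where the functional does, so
  it is an integer multiple of it; hence only one term occurs, with coefficient 1.
\<close>

lemma shared_facet:
  assumes v: "v \<in> V" and u: "u \<in> E v" and w: "w \<in> V" and tight: "coord v u (w - v) = 0"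
  obtains e where "e \<in> E w" "\<And>m. coord v u m = coord w e m"
proof -
  have nonneg: "coord v u e \<ge> 0" if "e \<in> E w" for e
    by (rule coord_edge_nonneg[OF v u w tight that])
  have "\<exists>e\<in>E w. coord v u e \<noteq> 0"
  proof (rule ccontr)
    assume "\<not> ?thesis"
    then have "coord v u u = 0" using coord_expand[OF v u w, of u] by simp
    then show False using v u by (simp add: coord_simps)
  qed
  then obtain e where e: "e \<in> E w" and "coord v u e \<noteq> 0" by blast
  then have pos: "coord v u e > 0" using nonneg[OF e] by simp
  have zero: "coord w e (z - w) = 0" if z: "z \<in> V" "coord v u (z - v) = 0" for z
  proof -
    have "(\<Sum>e\<in>E w. coord w e (z - w) * coord v u e) = coord v u (z - w)"
      by (rule coord_expand[OF v u w, symmetric])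
    also have "\<dots> = 0" using z tight v u by (simp add: coord_simps)
    finally have "coord w e (z - w) * coord v u e = 0"
      by (rule sum_nonneg_0[OF finite_E[OF w] _ _ e, rotated])
         (intro mult_nonneg_nonneg nonneg coord_nonneg[OF w _ z(1)])
    then show ?thesis using pos by simp
  qed
  have edge: "coord w e l = 0" if l: "l \<in> E v" "l \<noteq> u" for l
  proof -
    obtain k where k: "k > 0" "v + k *s l \<in> V"
      by (rule edge_endpoint[OF v l(1)]) iprover
    have "coord w e (v + k *s l - w) = 0"
      by (rule zero[OF k(2)]) (use v u l in \<open>simp add: coord_simps\<close>)
    moreover have "coord w e (v - w) = 0"
      by (rule zero[OF v]) (use v u in \<open>simp add: coord_simps\<close>)
    ultimately show ?thesis using w e k(1) by (simp add: coord_simps)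
  qed
  have multiple: "coord w e m = coord v u m * coord w e u" for m
  proof -
    have "coord w e m = (\<Sum>l\<in>E v. coord v l m * coord w e l)" by (rule coord_expand[OF w e v])
    also have "\<dots> = (\<Sum>l\<in>E v. if l = u then coord v u m * coord w e u else 0)"
      using edge by (intro sum.cong) auto
    also have "\<dots> = coord v u m * coord w e u" using finite_E[OF v] u by simp
    finally show ?thesis .
  qed
  have "coord v u e * coord w e u = 1" using multiple[of e] w e by (simp add: coord_simps)
  then have "coord w e u = 1" using pos by (auto simp: zmult_eq_1_iff)
  then have "coord v u m = coord w e m" for m using multiple[of m] by simp
  with e show thesis by (rule that)
qed

text \<open>The facet is one of those through \<open>w\<close>, and the sum of the edge directions
  at \<open>w\<close> has coordinate 1 for each of them.\<close>

lemma coord_can_tight: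
  assumes "v \<in> V" "u \<in> E v" "w \<in> V" "coord v u (w - v) = 0" shows "coord v u (can w) = 1"
proof -
  obtain e where e: "e \<in> E w" and eq: "\<And>m. coord v u m = coord w e m"
    by (rule shared_facet[OF assms]) iprover
  show ?thesis unfolding eq[of "can w"] by (rule coord_can[OF assms(3) e])
qed

definition edge_len :: "int ^ 'n \<Rightarrow> int ^ 'n \<Rightarrow> int" where
  "edge_len v u = (SOME k. k > 0 \<and> v + k *s u \<in> V \<and> - u \<in> E (v + k *s u))"

definition neighbour :: "int ^ 'n \<Rightarrow> int ^ 'n \<Rightarrow> int ^ 'n" where
  "neighbour v u = v + edge_len v u *s u"

text \<open>The anticanonical degree of the invariant curve of the edge: by
  \<open>can_neighbour\<close> the local generators of the canonical bundle at the two ends differ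
  by this multiple of \<open>u\<close>.\<close>

definition edge_deg :: "int ^ 'n \<Rightarrow> int ^ 'n \<Rightarrow> int" where
  "edge_deg v u = coord v u (can v - can (neighbour v u))"

lemma
  assumes "v \<in> V" "u \<in> E v"
  shows edge_len_pos: "edge_len v u > 0" and neighbour_in_V: "neighbour v u \<in> V"
    and neighbour_edge: "- u \<in> E (neighbour v u)"
proof -
  have "\<exists>k. k > 0 \<and> v + k *s u \<in> V \<and> - u \<in> E (v + k *s u)"
    by (rule edge_endpoint[OF assms]) iprover
  from someI_ex[OF this]
  show "edge_len v u > 0" "neighbour v u \<in> V" "- u \<in> E (neighbour v u)"
    by (simp_all add: edge_len_def neighbour_def)
qed

text \<open>Every facet through \<open>v\<close> other than that of \<open>u\<close> contains the
  whole edge, so both canonical exponents have coordinate 1 there; only the coordinate of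
  \<open>u\<close> can differ.\<close>

lemma can_neighbour:
  assumes "v \<in> V" "u \<in> E v" shows "can (neighbour v u) = can v - edge_deg v u *s u"
proof (rule lattice_coord_eqI[OF basis[OF assms(1)]])
  fix l assume l: "l \<in> E v"
  show "coord v l (can (neighbour v u)) = coord v l (can v - edge_deg v u *s u)"
  proof (cases "l = u")
    case True
    then show ?thesis using assms by (simp add: coord_simps edge_deg_def)
  next
    case False
    have "neighbour v u - v = edge_len v u *s u" by (simp add: neighbour_def)
    then have "coord v l (neighbour v u - v) = 0"
      using False assms l by (simp add: coord_simps)
    then have "coord v l (can (neighbour v u)) = 1"
      using coord_can_tight[OF assms(1) l neighbour_in_V[OF assms]] by simp
    then show ?thesis using False assms l coord_can by (simp add: coord_simps)
  qed
qed

subsection \<open>Nefness on the edges\<close>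

definition edge_nef :: "real \<Rightarrow> bool" where
  "edge_nef t \<longleftrightarrow> (\<forall>v\<in>V. \<forall>u\<in>E v. t * edge_len v u \<ge> edge_deg v u)"

text \<open>From \<open>w\<close>, walk along edges on which the facet inequality decreases.\<close>

lemma edge_nef_global:
  assumes nef: "edge_nef t" and v: "v \<in> V" and u: "u \<in> E v" and w: "w \<in> V"
  shows "t * coord v u (w - v) + coord v u (can w) \<ge> 1"
  using w
proof (induction "nat (coord v u (w - v))" arbitrary: w rule: less_induct)
  case (less w)
  note w = less.prems
  show ?case
  proof (cases "coord v u (w - v) = 0")
    case True
    then show ?thesis using coord_can_tight[OF v u w] by simp
  next
    case False
    then have pos: "coord v u (w - v) > 0" using coord_nonneg[OF v u w] by simp
    \<comment> \<open>Since \<open>v - w\<close> is a nonnegative combination of the edge directions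
      at \<open>w\<close>, some edge must descend if \<open>v\<close> is lower than
      \<open>w\<close>.\<close>
    have "\<exists>e\<in>E w. coord v u e < 0"
    proof (rule ccontr)
      assume "\<not> ?thesis"
      then have "0 \<le> (\<Sum>e\<in>E w. coord w e (v - w) * coord v u e)"
        using coord_nonneg[OF w _ v] by (intro sum_nonneg mult_nonneg_nonneg) auto
      also have "\<dots> = coord v u (v - w)" by (rule coord_expand[OF v u w, symmetric])
      finally show False using pos v u by (simp add: coord_simps)
    qed
    then obtain e where e: "e \<in> E w" "coord v u e < 0" by blast
    let ?w = "neighbour w e"
    have diff: "coord v u (?w - v) = coord v u (w - v) + edge_len w e * coord v u e"
      using v u by (simp add: neighbour_def coord_simps)
    have "edge_len w e * coord v u e < 0"
      using e edge_len_pos[OF w e(1)] by (simp add: mult_pos_neg)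
    then have "nat (coord v u (?w - v)) < nat (coord v u (w - v))"
      using diff pos by simp
    then have IH: "t * coord v u (?w - v) + coord v u (can ?w) \<ge> 1"
      by (rule less.hyps) (rule neighbour_in_V[OF w e(1)])
    have can: "coord v u (can ?w) = coord v u (can w) - edge_deg w e * coord v u e"
      using v u by (simp add: can_neighbour[OF w e(1)] coord_simps)
    \<comment> \<open>This product is the change of the left-hand side from \<open>w\<close> to its
      neighbour, so the bound at the neighbour carries back to \<open>w\<close>.\<close>
    have "(t * edge_len w e - edge_deg w e) * real_of_int (coord v u e) \<le> 0"
      using nef w e by (auto simp: edge_nef_def mult_le_0_iff)
    then show ?thesis using IH unfolding diff can by (simp add: algebra_simps)
  qed
qed

lemma V_E_nonempty: "v \<in> V \<Longrightarrow> E v \<noteq> {}"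
  using card_E by fastforce

definition edge_pairs :: "((int ^ 'n) \<times> (int ^ 'n)) set" where
  "edge_pairs = Sigma V E"

lemma edge_pairs: "finite edge_pairs" "edge_pairs \<noteq> {}"
  using finite_V finite_E V_nonempty V_E_nonempty by (auto simp: edge_pairs_def)

definition max_slope :: real where
  "max_slope = Max ((\<lambda>(v, u). real_of_int (edge_deg v u) / real_of_int (edge_len v u)) ` edge_pairs)"

lemma edge_nef_iff: "edge_nef t \<longleftrightarrow> max_slope \<le> t"
proof -
  have "max_slope \<le> t \<longleftrightarrow> (\<forall>(v, u)\<in>edge_pairs. real_of_int (edge_deg v u) / real_of_int (edge_len v u) \<le> t)"
    unfolding max_slope_def using edge_pairs by (subst Max_le_iff) auto
  also have "\<dots> \<longleftrightarrow> edge_nef t"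
    using edge_len_pos by (auto simp: edge_nef_def edge_pairs_def divide_le_eq)
  finally show ?thesis ..
qed

lemma max_slope_attained:
  obtains v u where "v \<in> V" "u \<in> E v" "real_of_int (edge_deg v u) = max_slope * real_of_int (edge_len v u)"
proof -
  have "max_slope \<in> (\<lambda>(v, u). real_of_int (edge_deg v u) / real_of_int (edge_len v u)) ` edge_pairs"
    unfolding max_slope_def using edge_pairs by (intro Max_in) auto
  then obtain v u where vu: "v \<in> V" "u \<in> E v" "max_slope = edge_deg v u / edge_len v u"
    by (auto simp: edge_pairs_def)
  then show thesis using that[OF vu(1,2)] edge_len_pos[OF vu(1,2)] by simp
qed

subsection \<open>Global sections\<close>

text \<open>Local sections are spanned by characters, so every monomial of a global section is a
  global section.\<close>

lemma global_sections_trivial_iff: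
  "global_sections P m = {0} \<longleftrightarrow> (\<nexists>x. \<forall>v\<in>V. x - m v \<in> chart_monoid P v)"
proof -
  have zero: "0 \<in> global_sections P m"
    by (auto simp: global_sections_def chart_sections_def chart_ring_def image_iff intro!: exI[of _ 0])
  have "Poly_Mapping.single x 1 \<in> global_sections P m"
    if x: "\<And>v. v \<in> V \<Longrightarrow> x - m v \<in> chart_monoid P v" for x
    unfolding global_sections_def
  proof (intro CollectI ballI)
    fix v assume v: "v \<in> V"
    have "(Poly_Mapping.single x 1 :: int ^ 'n \<Rightarrow>\<^sub>0 complex)
        = Poly_Mapping.single (m v) 1 * Poly_Mapping.single (x - m v) 1"
      by (simp add: mult_single)
    moreover have "(Poly_Mapping.single (x - m v) 1 :: int ^ 'n \<Rightarrow>\<^sub>0 complex) \<in> chart_ring P v"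
      using x[OF v] by (simp add: chart_ring_def)
    ultimately show "(Poly_Mapping.single x 1 :: int ^ 'n \<Rightarrow>\<^sub>0 complex) \<in> chart_sections P m v"
      unfolding chart_sections_def by blast
  qed
  moreover have "(Poly_Mapping.single x 1 :: int ^ 'n \<Rightarrow>\<^sub>0 complex) \<noteq> 0" for x
    by (metis keys_single keys_zero insert_not_empty one_neq_zero)
  moreover have "\<exists>x. \<forall>v\<in>V. x - m v \<in> chart_monoid P v"
    if f: "f \<in> global_sections P m" "f \<noteq> 0" for f
  proof -
    obtain x where x: "x \<in> Poly_Mapping.keys f" using f(2) by fastforce
    have "x - m v \<in> chart_monoid P v" if v: "v \<in> V" for v
    proof -
      obtain g where g: "g \<in> chart_ring P v" "f = Poly_Mapping.single (m v) 1 * g"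
        using f(1) v unfolding global_sections_def chart_sections_def by blast
      have "x \<in> {a + b |a b. a \<in> Poly_Mapping.keys (Poly_Mapping.single (m v) (1::complex)) \<and> b \<in> Poly_Mapping.keys g}"
        using keys_mult x g(2) by blast
      then obtain b where "x = m v + b" "b \<in> Poly_Mapping.keys g" by auto
      then show ?thesis using g(1) by (auto simp: chart_ring_def)
    qed
    then show ?thesis by blast
  qed
  ultimately show ?thesis using zero by blast
qed

text \<open>Each edge coordinate of the canonical exponent is 1; twisting by \<open>N\<close> times
  it raises the facet bounds of \<open>a P\<close> from 0 to \<open>N\<close>.\<close>

lemma adjoint_sections_trivial_iff:
  "global_sections P (adjoint_bundle P a N) = {0} \<longleftrightarrow>
     (\<nexists>x. \<forall>v\<in>V. \<forall>u\<in>E v. coord v u (x - a *s v) \<ge> N)"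
proof -
  have "x - adjoint_bundle P a N v \<in> chart_monoid P v \<longleftrightarrow> (\<forall>u\<in>E v. coord v u (x - a *s v) \<ge> N)"
    if v: "v \<in> V" for x v
  proof -
    have "coord v u (x - adjoint_bundle P a N v) = coord v u (x - a *s v) - N" if u: "u \<in> E v" for u
      using v u by (simp add: adjoint_bundle_def ample_bundle_def coord_simps coord_can)
    then show ?thesis using v by (simp add: chart_monoid_iff)
  qed
  then show ?thesis unfolding global_sections_trivial_iff by blast
qed

definition sectionless :: "real set" where
  "sectionless = {t. t \<in> \<rat> \<and>
     (\<forall>N>0. \<forall>a. of_int N * t = of_int a \<longrightarrow> global_sections P (adjoint_bundle P a N) = {0})}"

lemma spectral_value_eq: "spectral_value P = Sup sectionless"
  by (simp add: spectral_value_def sectionless_def)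

lemma not_sectionlessI:
  assumes "N > 0" "of_int N * t = of_int a" "\<And>v u. v \<in> V \<Longrightarrow> u \<in> E v \<Longrightarrow> coord v u (x - a *s v) \<ge> N"
  shows "t \<notin> sectionless"
  using assms unfolding sectionless_def adjoint_sections_trivial_iff by blast

text \<open>Multiples of the canonical bundle have no sections: at a vertex where a facet functional
  is maximal over \<open>V\<close> it is nonpositive on all edge directions, hence on any
  \<open>x\<close> with positive coordinates there, although the section condition makes it positive
  on \<open>x\<close>. This makes the supremum range over a nonempty set.\<close>

lemma zero_sectionless: "0 \<in> sectionless"
proof -
  have contr: False if x: "\<And>v u. v \<in> V \<Longrightarrow> u \<in> E v \<Longrightarrow> coord v u x \<ge> N" and N: "N > 0" for x N
  proof -
    obtain v u where v: "v \<in> V" and u: "u \<in> E v" using edge_pairs(2) by (auto simp: edge_pairs_def)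
    have "Max (coord v u ` V) \<in> coord v u ` V" using finite_V V_nonempty by (intro Max_in) auto
    then obtain w where w: "w \<in> V" "coord v u w = Max (coord v u ` V)" by auto
    have "coord v u e \<le> 0" if e: "e \<in> E w" for e
    proof -
      have "coord v u (neighbour w e) \<le> coord v u w"
        using w(2) neighbour_in_V[OF w(1) e] finite_V by simp
      then have "edge_len w e * coord v u e \<le> 0"
        using v u by (simp add: neighbour_def coord_simps)
      then show ?thesis using edge_len_pos[OF w(1) e] by (simp add: mult_le_0_iff)
    qed
    then have "(\<Sum>e\<in>E w. coord w e x * coord v u e) \<le> 0"
      using x[OF w(1)] N by (intro sum_nonpos mult_nonneg_nonpos) (auto intro: order_trans[of 0 N])
    then show False using coord_expand[OF v u w(1), of x] x[OF v u] N by simp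
  qed
  have "\<nexists>x. \<forall>v\<in>V. \<forall>u\<in>E v. N \<le> coord v u x" if "N > 0" for N
    using contr that by blast
  then show ?thesis unfolding sectionless_def adjoint_sections_trivial_iff by simp
qed

lemma Rats_quotient:
  assumes "t \<in> \<rat>" obtains N a :: int where "N > 0" "of_int N * t = of_int a"
proof -
  obtain a N :: int where "N > 0" "t = of_int a / of_int N" using assms by (rule Rats_cases')
  then show thesis using that by simp
qed

lemma sectionless_less: assumes "t \<in> sectionless" shows "t < max_slope"
proof (rule ccontr)
  assume "\<not> t < max_slope"
  then have nef: "edge_nef t" by (simp add: edge_nef_iff)
  have "t \<in> \<rat>" using assms by (simp add: sectionless_def)
  then obtain N a :: int where Na: "N > 0" "of_int N * t = of_int a" by (rule Rats_quotient)
  obtain w where w: "w \<in> V" using V_nonempty by blast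
  \<comment> \<open>The witness is the local generator of \<open>a L + N K\<close> at an arbitrary
    vertex \<open>w\<close>; by \<open>edge_nef_global\<close> it is regular on every chart.\<close>
  have "t \<notin> sectionless"
  proof (rule not_sectionlessI[OF Na])
    fix v u assume v: "v \<in> V" and u: "u \<in> E v"
    have "real_of_int N * (t * coord v u (w - v) + coord v u (can w)) \<ge> real_of_int N * 1"
      using edge_nef_global[OF nef v u w] Na(1) by (intro mult_left_mono) auto
    also have "real_of_int N * (t * coord v u (w - v) + coord v u (can w))
        = real_of_int (a * coord v u (w - v) + N * coord v u (can w))"
      using Na(2) by (simp add: algebra_simps flip: mult.assoc)
    also have "a * coord v u (w - v) + N * coord v u (can w) = coord v u (a *s w + N *s can w - a *s v)"
      using v u by (simp add: coord_simps algebra_simps)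
    finally show "coord v u (a *s w + N *s can w - a *s v) \<ge> N" by simp
  qed
  then show False using assms by blast
qed

lemma bdd_above_sectionless: "bdd_above sectionless"
  using sectionless_less by (auto simp: bdd_above_def less_imp_le intro!: exI[of _ max_slope])

lemma spectral_value_le: "spectral_value P \<le> max_slope"
  unfolding spectral_value_eq using zero_sectionless sectionless_less
  by (intro cSup_least) (auto simp: less_imp_le)

end

section \<open>Wall relations and the spectral value\<close>

context smooth_polytope
begin

lemma neighbour_diff:
  assumes "v \<in> V" "e \<in> E v"
  shows "v - neighbour v e = edge_len v e *s (- e)" "can v - can (neighbour v e) = edge_deg v e *s e"
  using can_neighbour[OF assms] by (simp_all add: neighbour_def vector_smult_rneg)

text \<open>
  The coefficients of the facet at the far end of an edge, in the coordinates of the near end;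
  the degree formula is the wall relation.
\<close>

definition wall_coeff :: "int ^ 'n \<Rightarrow> int ^ 'n \<Rightarrow> int ^ 'n \<Rightarrow> int" where
  "wall_coeff v e l = - coord (neighbour v e) (- e) l"

context
  fixes v e assumes v: "v \<in> V" and e: "e \<in> E v"
begin

lemmas far = neighbour_in_V[OF v e] neighbour_edge[OF v e]

lemma wall_coeff_self: "wall_coeff v e e = 1"
proof -
  have "coord (neighbour v e) (- e) (- e) = 1"
    using lattice_coord_basis[OF basis[OF far(1)] far(2) far(2)] by simp
  then show ?thesis using far by (simp add: wall_coeff_def lattice_coord_minus[OF basis])
qed

lemma wall_expand: "coord (neighbour v e) (- e) m = - (\<Sum>l\<in>E v. coord v l m * wall_coeff v e l)"
  by (subst coord_expand[OF far v]) (simp add: wall_coeff_def sum_negf)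

lemma wall_coord_near: "coord (neighbour v e) (- e) (v - neighbour v e) = edge_len v e"
  unfolding neighbour_diff[OF v e] using far wall_coeff_self
  by (simp add: wall_coeff_def lattice_coord_minus[OF basis] lattice_coord_smult[OF basis])

lemma wall_coord_can: "coord (neighbour v e) (- e) (can v) = 1 - edge_deg v e"
proof -
  have "coord (neighbour v e) (- e) (can v)
      = coord (neighbour v e) (- e) (can (neighbour v e)) + coord (neighbour v e) (- e) (edge_deg v e *s e)"
    using far by (simp add: coord_simps flip: neighbour_diff[OF v e])
  also have "\<dots> = 1 - edge_deg v e"
    using far wall_coeff_self by (simp add: coord_can coord_simps wall_coeff_def)
  finally show ?thesis .
qed

text \<open>The far facet functional is evaluated at \<open>can v\<close> twice: from the canonical
  exponent at the far end, and by expansion in the basis at \<open>v\<close>.\<close>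

lemma edge_deg_eq: "edge_deg v e = 1 + (\<Sum>l\<in>E v. wall_coeff v e l)"
proof -
  have "1 - edge_deg v e = - (\<Sum>l\<in>E v. coord v l (can v) * wall_coeff v e l)"
    by (simp only: wall_coord_can[symmetric] wall_expand)
  also have "(\<Sum>l\<in>E v. coord v l (can v) * wall_coeff v e l) = (\<Sum>l\<in>E v. wall_coeff v e l)"
    by (intro sum.cong) (simp_all add: coord_can v)
  finally show ?thesis by simp
qed

text \<open>Adding to the far facet inequality the inequalities at \<open>v\<close>, weighted by the
  wall coefficients, cancels the exponent \<open>x\<close>; what is left is
  \<open>N * edge_deg v e \<le> a * edge_len v e\<close>.\<close>

lemma nonneg_wall_sectionless:
  fixes t :: real
  assumes nonneg: "\<And>l. l \<in> E v \<Longrightarrow> wall_coeff v e l \<ge> 0"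
    and t: "t \<in> \<rat>" "t * edge_len v e < edge_deg v e"
  shows "t \<in> sectionless"
proof -
  have False if N: "N > 0" and Na: "real_of_int N * t = real_of_int a"
    and x: "\<And>w u. w \<in> V \<Longrightarrow> u \<in> E w \<Longrightarrow> coord w u (x - a *s w) \<ge> N" for N a x
  proof -
    let ?f = "coord (neighbour v e) (- e)"
    have "N \<le> ?f (x - a *s neighbour v e)" by (rule x[OF far])
    also have "x - a *s neighbour v e = (x - a *s v) + a *s (v - neighbour v e)"
      by (simp add: vec_eq_iff algebra_simps)
    also have "?f \<dots> = ?f (x - a *s v) + a * edge_len v e"
      by (simp only: lattice_coord_add[OF basis[OF far(1)] far(2)]
          lattice_coord_smult[OF basis[OF far(1)] far(2)] wall_coord_near)
    also have "?f (x - a *s v) = - (\<Sum>l\<in>E v. coord v l (x - a *s v) * wall_coeff v e l)"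
      by (rule wall_expand)
    finally have "N \<le> - (\<Sum>l\<in>E v. coord v l (x - a *s v) * wall_coeff v e l) + a * edge_len v e" .
    moreover have "(\<Sum>l\<in>E v. N * wall_coeff v e l) \<le> (\<Sum>l\<in>E v. coord v l (x - a *s v) * wall_coeff v e l)"
      using x[OF v] nonneg by (intro sum_mono mult_right_mono) auto
    ultimately have "N + N * (\<Sum>l\<in>E v. wall_coeff v e l) \<le> a * edge_len v e"
      by (simp add: sum_distrib_left)
    then have "N * edge_deg v e \<le> a * edge_len v e"
      by (simp add: edge_deg_eq algebra_simps)
    then have "real_of_int N * edge_deg v e \<le> real_of_int a * edge_len v e"
      by (metis of_int_le_iff of_int_mult)
    also have "\<dots> = real_of_int N * (t * edge_len v e)" by (simp flip: Na)
    finally show False using t(2) N by simp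
  qed
  then have "\<nexists>x. \<forall>w\<in>V. \<forall>u\<in>E w. N \<le> coord w u (x - a *s w)"
    if "N > 0" "real_of_int N * t = real_of_int a" for N a using that by blast
  then show ?thesis using t(1) unfolding sectionless_def adjoint_sections_trivial_iff by simp
qed

end

text \<open>
  The polytope contains the simplex spanned by \<open>v\<close> and the \<open>v + i\<close> with \<open>i \<in> I\<close>, a face over which
  it has slices of sizes \<open>1 - c l\<close> in the remaining directions \<open>l \<in> J\<close>.  If one \<open>c l\<close> is negative,
  a weighted sum of lattice points in the slices and of \<open>v\<close> is a section already for
  \<open>t = (n + 2) / 2\<close>.
\<close>

lemma wide_slice_not_sectionless:
  fixes c :: "int ^ 'n \<Rightarrow> int" and t :: real
  assumes v: "v \<in> V" and split: "E v = I \<union> J" "I \<inter> J = {}" "I \<noteq> {}"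
    and j0: "j0 \<in> J" "c j0 < 0" and c: "\<And>l. l \<in> J \<Longrightarrow> c l \<le> 0"
    and D: "D = int (card I) - int CARD('n) + int (card I) + sum c J" "D \<ge> 0"
    and p: "\<And>i l w m. i \<in> I \<Longrightarrow> l \<in> J \<Longrightarrow> w \<in> V \<Longrightarrow> m \<in> E w \<Longrightarrow> coord w m (v + l + (1 - c l) *s i - w) \<ge> 0"
    and t: "t \<in> \<rat>" "t \<ge> (real CARD('n) + 2) / 2"
  shows "t \<notin> sectionless"
proof -
  have fin: "finite I" "finite J" using split finite_E[OF v] by auto
  have n: "int CARD('n) = int (card I) + int (card J)"
    using split fin card_E[OF v] by (simp add: card_Un_disjoint)
  define k where "k = int (card I)"
  have k: "k > 0" using split(3) fin by (simp add: k_def card_gt_0_iff)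
  obtain N a :: int where Na: "N > 0" "of_int N * t = of_int a" using t(1) by (rule Rats_quotient)
  have "real_of_int N * ((real CARD('n) + 2) / 2) \<le> real_of_int a"
    unfolding Na(2)[symmetric] using t(2) Na(1) by (intro mult_left_mono) auto
  then have "real_of_int (N * (int CARD('n) + 2)) \<le> real_of_int (2 * a)" by simp
  then have a: "N * (int CARD('n) + 2) \<le> 2 * a" by (simp only: of_int_le_iff)
  \<comment> \<open>With weight \<open>2 N\<close> on every slice, the coordinate along each
    \<open>i\<close> in \<open>I\<close> is \<open>2 N (|J| - sum c J)\<close>, which differs from
    the required \<open>2 k N\<close> by \<open>2 N D\<close>. The extra weight \<open>N D\<close>
    on \<open>j0\<close> supplies this because \<open>1 - c j0\<close> is at least 2.\<close>
  define h where "h l = 2 * N + (if l = j0 then N * D else 0)" for l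
  have h: "h l \<ge> 2 * N" "h l \<ge> 0" for l using Na(1) D(2) by (auto simp: h_def)
  have hsum: "(\<Sum>l\<in>J. h l * g l) = 2 * N * sum g J + N * D * g j0" for g :: "int ^ 'n \<Rightarrow> int"
  proof -
    have "(\<Sum>l\<in>J. h l * g l) = (\<Sum>l\<in>J. 2 * N * g l + (if l = j0 then N * D * g j0 else 0))"
      by (intro sum.cong) (auto simp: h_def algebra_simps)
    then show ?thesis using fin j0 by (simp add: sum.distrib sum_distrib_left)
  qed
  define q where "q l i = l + (1 - c l) *s i" for l i :: "int ^ 'n"
  define y where "y = (\<Sum>l\<in>J. \<Sum>i\<in>I. h l *s q l i)"
  have y: "coord w m y = (\<Sum>l\<in>J. \<Sum>i\<in>I. h l * coord w m (q l i))" if "w \<in> V" "m \<in> E w" for w m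
    using that by (simp add: y_def lattice_coord_sum_vec[OF basis] lattice_coord_smult[OF basis])
  show ?thesis
  \<comment> \<open>The factor \<open>2 k\<close> clears the average over the \<open>k\<close>
    directions in \<open>I\<close> and the half weight \<open>N D / 2\<close> on
    \<open>j0\<close>.\<close>
  proof (rule not_sectionlessI[where N = "2 * k * N" and a = "2 * k * a" and x = "(2 * k * a) *s v + y"])
    show "2 * k * N > 0" using k Na(1) by simp
    show "of_int (2 * k * N) * t = of_int (2 * k * a)" using Na(2) by (simp add: mult.assoc)
    fix w m assume w: "w \<in> V" and m: "m \<in> E w"
    have eq: "coord w m ((2 * k * a) *s v + y - (2 * k * a) *s w) = 2 * k * a * coord w m (v - w) + coord w m y"
      using w m by (simp add: coord_simps algebra_simps)
    show "coord w m ((2 * k * a) *s v + y - (2 * k * a) *s w) \<ge> 2 * k * N"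
    proof (cases "coord w m (v - w) = 0")
      case True
      obtain m' where m': "m' \<in> E v" and cm: "\<And>z. coord w m z = coord v m' z"
        by (rule shared_facet[OF w m v True]) iprover
      have q: "coord v m' (q l i) = (if m' = l then 1 else 0) + (if m' = i then 1 - c l else 0)"
        if "l \<in> J" "i \<in> I" for l i
      proof -
        have "l \<in> E v" "i \<in> E v" using that split by auto
        then show ?thesis using v m' by (simp add: q_def coord_simps)
      qed
      have "coord w m y = (\<Sum>l\<in>J. \<Sum>i\<in>I. h l * ((if m' = l then 1 else 0) + (if m' = i then 1 - c l else 0)))"
        unfolding cm[of y] y[OF v m'] by (intro sum.cong refl) (simp add: q)
      also have "\<dots> = (\<Sum>l\<in>J. h l * ((if m' = l then k else 0) + (if m' \<in> I then 1 - c l else 0)))"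
        using fin by (intro sum.cong refl) (auto simp add: sum.distrib k_def simp flip: sum_distrib_left)
      also have "\<dots> \<ge> 2 * k * N"
      proof (cases "m' \<in> I")
        case True
        then have "(\<Sum>l\<in>J. h l * ((if m' = l then k else 0) + (if m' \<in> I then 1 - c l else 0)))
            = (\<Sum>l\<in>J. h l * (1 - c l))"
          using split by (intro sum.cong) auto
        also have "\<dots> = 2 * N * (int (card J) - sum c J) + N * D * (1 - c j0)"
          by (simp only: hsum) (simp add: sum_subtractf)
        finally have total: "(\<Sum>l\<in>J. h l * ((if m' = l then k else 0) + (if m' \<in> I then 1 - c l else 0)))
            = 2 * N * (int (card J) - sum c J) + N * D * (1 - c j0)" .
        have "N * D * (1 - c j0) \<ge> N * D * 2"
          using Na(1) D(2) j0(2) by (intro mult_left_mono) auto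
        moreover have "2 * N * (int (card J) - sum c J) + N * D * 2 = 2 * k * N"
          unfolding D(1) n k_def by (simp add: algebra_simps)
        ultimately show ?thesis unfolding total by linarith
      next
        case False
        then have m'J: "m' \<in> J" using m' split by auto
        have "(\<Sum>l\<in>J. h l * ((if m' = l then k else 0) + (if m' \<in> I then 1 - c l else 0)))
            = (\<Sum>l\<in>J. if m' = l then h m' * k else 0)"
          using False by (intro sum.cong) auto
        also have "\<dots> = h m' * k" using fin m'J by simp
        also have "\<dots> \<ge> 2 * N * k" using h(1) k by (intro mult_right_mono) auto
        finally show ?thesis by (simp add: algebra_simps)
      qed
      finally show ?thesis unfolding eq True by simp
    next
      case False
      \<comment> \<open>Off the facet, \<open>v\<close> has height at least 1, so it suffices that
        the weight left on \<open>v\<close> after all slice points are used is at least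
        \<open>2 k N\<close>.\<close>
      then have pos: "coord w m (v - w) \<ge> 1" using coord_nonneg[OF w m v] by simp
      have hJ: "(\<Sum>l\<in>J. h l) = 2 * N * int (card J) + N * D"
        using hsum[of "\<lambda>_. 1"] by simp
      have "coord w m (q l i) \<ge> - coord w m (v - w)" if "l \<in> J" "i \<in> I" for l i
      proof -
        have "v + l + (1 - c l) *s i - w = (v - w) + q l i" by (simp add: q_def)
        then have "0 \<le> coord w m ((v - w) + q l i)" using p[OF that(2,1) w m] by (simp only:)
        then show ?thesis using w m by (simp add: lattice_coord_add[OF basis])
      qed
      then have "coord w m y \<ge> (\<Sum>l\<in>J. \<Sum>i\<in>I. h l * (- coord w m (v - w)))"
        unfolding y[OF w m] using h(2) by (intro sum_mono mult_left_mono) auto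
      also have "(\<Sum>l\<in>J. \<Sum>i\<in>I. h l * (- coord w m (v - w))) = - (k * (\<Sum>l\<in>J. h l) * coord w m (v - w))"
        by (simp add: k_def sum_negf sum_distrib_left sum_distrib_right mult_ac)
      finally have "coord w m ((2 * k * a) *s v + y - (2 * k * a) *s w)
          \<ge> (2 * k * a - k * (\<Sum>l\<in>J. h l)) * coord w m (v - w)"
        unfolding eq by (simp add: algebra_simps)
      moreover have "2 * k * a - k * (\<Sum>l\<in>J. h l) \<ge> 2 * k * N"
      proof -
        \<comment> \<open>\<open>2 + 2 |J| + D\<close> equals \<open>n + 2 + sum c J\<close>; this
          is where \<open>t \<ge> (n + 2) / 2\<close> enters.\<close>
        have "sum c J \<le> 0" using c by (intro sum_nonpos) auto
        then have "N * (2 + 2 * int (card J) + D) \<le> N * (int CARD('n) + 2)"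
          using Na(1) unfolding D(1) n by (intro mult_left_mono) auto
        then have "N * (2 + 2 * int (card J) + D) \<le> 2 * a" using a by simp
        then have "k * (N * (2 + 2 * int (card J) + D)) \<le> k * (2 * a)"
          using k by (intro mult_left_mono) auto
        then show ?thesis unfolding hJ by (simp add: algebra_simps)
      qed
      moreover have "2 * k * N \<le> 2 * k * N * coord w m (v - w)"
        using mult_left_mono[OF pos, of "2 * k * N"] k Na(1) by simp
      moreover have "2 * k * N * coord w m (v - w) \<le> (2 * k * a - k * (\<Sum>l\<in>J. h l)) * coord w m (v - w)"
        using pos calculation(2) by (intro mult_right_mono) auto
      ultimately show ?thesis by linarith
    qed
  qed
qed

text \<open>
  An edge of maximal slope and, among those, of minimal length.  Minimality makes the positive wall
  coefficients equal to 1: if \<open>c l > 0\<close>, nefness forces the edge \<open>l\<close> to have maximal slope as well,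
  and it is at most \<open>1 / c l\<close> times as long.
\<close>

lemma minimal_edge:
  obtains v e where "v \<in> V" "e \<in> E v" "real_of_int (edge_deg v e) = max_slope * edge_len v e"
    "\<And>l. l \<in> E v \<Longrightarrow> wall_coeff v e l \<ge> 1 \<Longrightarrow> wall_coeff v e l = 1 \<and> edge_len v l = edge_len v e"
proof -
  let ?Q = "\<lambda>x. fst x \<in> V \<and> snd x \<in> E (fst x) \<and> real_of_int (edge_deg (fst x) (snd x)) = max_slope * edge_len (fst x) (snd x)"
  obtain v0 u0 where "v0 \<in> V" "u0 \<in> E v0" "real_of_int (edge_deg v0 u0) = max_slope * edge_len v0 u0"
    by (rule max_slope_attained) iprover
  then have "?Q (v0, u0)" by simp
  then obtain x where x: "?Q x" and
    xmin: "\<And>y. ?Q y \<Longrightarrow> nat (edge_len (fst x) (snd x)) \<le> nat (edge_len (fst y) (snd y))"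
    using ex_has_least_nat[of ?Q "(v0, u0)" "\<lambda>x. nat (edge_len (fst x) (snd x))"] by blast
  define v where "v = fst x" define e where "e = snd x"
  have v: "v \<in> V" and e: "e \<in> E v" and deg: "real_of_int (edge_deg v e) = max_slope * edge_len v e"
    using x by (simp_all add: v_def e_def)
  have min: "edge_len v e \<le> edge_len v l"
    if "l \<in> E v" "real_of_int (edge_deg v l) = max_slope * edge_len v l" for l
    using xmin[of "(v, l)"] that v edge_len_pos[OF v that(1)] by (simp add: v_def e_def)
  have nef: "edge_nef max_slope" by (simp add: edge_nef_iff)
  have "wall_coeff v e l = 1 \<and> edge_len v l = edge_len v e"
    if l: "l \<in> E v" and c: "wall_coeff v e l \<ge> 1" for l
  proof -
    let ?f = "coord (neighbour v e) (- e)" and ?c = "wall_coeff v e l"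
    note far = far[OF v e]
    have fl: "?f l = - ?c" by (simp add: wall_coeff_def)
    have near: "?f v - ?f (neighbour v e) = edge_len v e"
      using wall_coord_near[OF v e] far by (simp add: lattice_coord_diff[OF basis])
    have 1: "?f (neighbour v l - neighbour v e) = edge_len v e - edge_len v l * ?c"
      using far near fl by (simp add: neighbour_def[of v l] lattice_coord_diff[OF basis]
        lattice_coord_add[OF basis] lattice_coord_smult[OF basis])
    have 2: "?f (can (neighbour v l)) = 1 - edge_deg v e + edge_deg v l * ?c"
      using far fl wall_coord_can[OF v e]
      by (simp add: can_neighbour[OF v l] lattice_coord_diff[OF basis] lattice_coord_smult[OF basis])
    \<comment> \<open>Nefness for the far facet of \<open>e\<close>, tested at the far end of
      \<open>l\<close>; the contribution of \<open>e\<close> cancels because \<open>e\<close> has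
      maximal slope.\<close>
    have "max_slope * ?f (neighbour v l - neighbour v e) + ?f (can (neighbour v l)) \<ge> 1"
      by (rule edge_nef_global[OF nef far neighbour_in_V[OF v l]])
    then have "(edge_deg v l - max_slope * edge_len v l) * real_of_int ?c \<ge> 0"
      unfolding 1 2 using deg by (simp add: algebra_simps)
    then have "edge_deg v l \<ge> max_slope * edge_len v l" using c by (simp add: zero_le_mult_iff)
    moreover have "edge_deg v l \<le> max_slope * edge_len v l" using nef v l by (simp add: edge_nef_def)
    ultimately have "edge_len v e \<le> edge_len v l" using min l by simp
    \<comment> \<open>The far end of \<open>l\<close> satisfies the far facet inequality of
      \<open>e\<close>.\<close>
    moreover have le: "edge_len v l * ?c \<le> edge_len v e"
      using coord_nonneg[OF far neighbour_in_V[OF v l]] unfolding 1 by simp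
    moreover have "edge_len v l * 1 \<le> edge_len v l * ?c"
      using c edge_len_pos[OF v l] by (intro mult_left_mono) auto
    ultimately have "edge_len v l = edge_len v e" "edge_len v l * ?c = edge_len v l * 1" by linarith+
    then show ?thesis using edge_len_pos[OF v l] by simp
  qed
  then show thesis using that[OF v e deg] by blast
qed

text \<open>The facets at \<open>v + i\<close> are those at \<open>v\<close> without that of
  \<open>i\<close>, together with the far facet of \<open>e\<close>. The edge leaving the facet of
  \<open>l\<close> there has direction \<open>l - wall_coeff v e l *s i\<close>, and its first
  lattice point after \<open>v + i\<close> is the point in question.\<close>

lemma slice_point:
  assumes v: "v \<in> V" and e: "e \<in> E v" and i: "i \<in> E v" "wall_coeff v e i = 1"
    and len: "edge_len v e = 1" "edge_len v i = 1" and l: "l \<in> E v" "l \<noteq> i"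
    and w: "w \<in> V" and m: "m \<in> E w"
  shows "coord w m (v + l + (1 - wall_coeff v e l) *s i - w) \<ge> 0"
proof -
  let ?w = "neighbour v i" and ?f = "coord (neighbour v e) (- e)"
  have wi: "?w = v + i" using len by (simp add: neighbour_def)
  note far = far[OF v e] and fari = far[OF v i(1)]
  have fi: "?f i = - 1" and fl: "?f l = - wall_coeff v e l" using i(2) by (simp_all add: wall_coeff_def)
  have near: "?f v - ?f (neighbour v e) = 1"
    using wall_coord_near[OF v e] far len by (simp add: lattice_coord_diff[OF basis])
  \<comment> \<open>Length 1 and wall coefficient 1 of \<open>i\<close> put \<open>v + i\<close> on
    the far facet of \<open>e\<close>.\<close>
  have "?f (?w - neighbour v e) = 0"
    using far near fi by (simp add: wi lattice_coord_diff[OF basis] lattice_coord_add[OF basis])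
  then obtain g where g: "g \<in> E ?w" and fg: "\<And>z. ?f z = coord ?w g z"
    by (rule shared_facet[OF far fari(1)]) iprover
  have "coord ?w g (- i) = 1"
    unfolding fg[symmetric] using far fi by (simp add: lattice_coord_minus[OF basis])
  then have gi: "g = - i" using lattice_coord_basis[OF basis[OF fari(1)] g fari(2)] by (simp split: if_splits)
  have tight: "coord v m' (?w - v) = 0" if "m' \<in> E v" "m' \<noteq> i" for m'
    using that v i by (simp add: wi coord_simps)
  obtain l' where l': "l' \<in> E ?w" and cl: "\<And>z. coord v l z = coord ?w l' z"
    by (rule shared_facet[OF v l(1) fari(1) tight[OF l]]) iprover
  have "coord ?w l' (- i) = 0"
    unfolding cl[symmetric] using v l i by (simp add: coord_simps)
  then have l'i: "l' \<noteq> - i" using lattice_coord_basis[OF basis[OF fari(1)] l' fari(2)] by (simp split: if_splits)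
  have other: "coord v m' l' = (if m' = l then 1 else 0)" if m': "m' \<in> E v" "m' \<noteq> i" for m'
  proof -
    obtain m'' where m'': "m'' \<in> E ?w" and cm: "\<And>z. coord v m' z = coord ?w m'' z"
      by (rule shared_facet[OF v m'(1) fari(1) tight[OF m']]) iprover
    show ?thesis
    proof (cases "m' = l")
      case True
      then show ?thesis unfolding True cl[of l'] using lattice_coord_basis[OF basis[OF fari(1)] l' l'] by simp
    next
      case False
      have "m'' \<noteq> l'"
      proof
        assume "m'' = l'"
        then have "coord v m' l = coord v l l" unfolding cm[of l] cl[of l] by simp
        then show False using lattice_coord_basis[OF basis[OF v] m'(1) l(1)]
            lattice_coord_basis[OF basis[OF v] l(1) l(1)] False by simp
      qed
      then show ?thesis unfolding cm[of l'] using lattice_coord_basis[OF basis[OF fari(1)] m'' l'] False by simp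
    qed
  qed
  \<comment> \<open>The direction \<open>l'\<close> stays on the far facet, so the wall relation
    determines its coordinate along \<open>i\<close>.\<close>
  have "?f l' = 0"
    unfolding fg[of l'] using lattice_coord_basis[OF basis[OF fari(1)] g l'] gi l'i by simp
  also have "?f l' = - (\<Sum>m'\<in>E v. coord v m' l' * wall_coeff v e m')" by (rule wall_expand[OF v e])
  also have "(\<Sum>m'\<in>E v. coord v m' l' * wall_coeff v e m')
      = (\<Sum>m'\<in>E v. (if m' = l then wall_coeff v e l else 0) + (if m' = i then coord v i l' else 0))"
    using other l(2) i(2) by (intro sum.cong) auto
  also have "\<dots> = wall_coeff v e l + coord v i l'" using finite_E[OF v] l(1) i(1) by (simp add: sum.distrib)
  finally have il: "coord v i l' = - wall_coeff v e l" by simp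
  have "l' = l - wall_coeff v e l *s i"
  proof (rule lattice_coord_eqI[OF basis[OF v]])
    fix m' assume m': "m' \<in> E v"
    have "coord v m' (l - wall_coeff v e l *s i)
        = (if m' = l then 1 else 0) - wall_coeff v e l * (if m' = i then 1 else 0)"
      using v m' l(1) i(1) by (simp add: coord_simps)
    then show "coord v m' l' = coord v m' (l - wall_coeff v e l *s i)"
      using other[OF m'] il l(2) by (cases "m' = i") auto
  qed
  then have pt: "v + l + (1 - wall_coeff v e l) *s i - w = (?w - w) + l'"
    by (simp add: wi vec_eq_iff algebra_simps)
  have nb: "neighbour ?w l' - w = (?w - w) + edge_len ?w l' *s l'"
    unfolding neighbour_def[of ?w l'] by (simp only: algebra_simps)
  have "0 \<le> coord w m ((?w - w) + edge_len ?w l' *s l')"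
    using coord_nonneg[OF w m neighbour_in_V[OF fari(1) l']] by (simp only: nb)
  then have A: "0 \<le> coord w m (?w - w) + edge_len ?w l' * coord w m l'"
    using w m by (simp only: lattice_coord_add[OF basis] lattice_coord_smult[OF basis])
  have B: "0 \<le> coord w m (?w - w)" by (rule coord_nonneg[OF w m fari(1)])
  \<comment> \<open>The first lattice point lies between the two ends of the edge, where the
    inequality holds by \<open>A\<close> and \<open>B\<close>.\<close>
  have "0 \<le> coord w m (?w - w) + coord w m l'"
  proof (cases "coord w m l' \<ge> 0")
    case False
    then have "edge_len ?w l' * coord w m l' \<le> 1 * coord w m l'"
      using edge_len_pos[OF fari(1) l'] by (intro mult_right_mono_neg) auto
    then show ?thesis using A by simp
  qed (use B in simp)
  then show ?thesis unfolding pt using w m by (simp only: lattice_coord_add[OF basis])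
qed

lemma spectral_value_eq_max_slope:
  assumes mu: "spectral_value P > (real CARD('n) + 2) / 2"
  shows "spectral_value P = max_slope"
proof -
  obtain v e where v: "v \<in> V" and e: "e \<in> E v" and deg: "real_of_int (edge_deg v e) = max_slope * edge_len v e"
    and min: "\<And>l. l \<in> E v \<Longrightarrow> wall_coeff v e l \<ge> 1 \<Longrightarrow> wall_coeff v e l = 1 \<and> edge_len v l = edge_len v e"
    by (rule minimal_edge) blast
  let ?c = "wall_coeff v e"
  have c1: "?c l \<le> 1" if "l \<in> E v" for l using min[OF that] by linarith
  show ?thesis
  proof (cases "\<forall>l\<in>E v. ?c l \<ge> 0")
    case True
    have "t \<in> sectionless" if "t \<in> \<rat>" "t < max_slope" for t
    proof (rule nonneg_wall_sectionless[OF v e _ that(1)])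
      show "t * edge_len v e < edge_deg v e" unfolding deg using that edge_len_pos[OF v e] by simp
    qed (use True in blast)
    then have le: "t \<le> spectral_value P" if "t \<in> \<rat>" "t < max_slope" for t
      unfolding spectral_value_eq using that bdd_above_sectionless by (intro cSup_upper) auto
    have "max_slope \<le> spectral_value P"
    proof (rule ccontr)
      assume "\<not> ?thesis"
      then obtain t where "t \<in> \<rat>" "spectral_value P < t" "t < max_slope"
        using Rats_dense_in_real[of "spectral_value P" max_slope] by auto
      then show False using le by fastforce
    qed
    then show ?thesis using spectral_value_le by simp
  next
    case False
    then obtain j0 where j0: "j0 \<in> E v" "?c j0 < 0" by auto
    have "sum ?c (E v) \<le> of_nat (card (E v)) * 1" using c1 by (intro sum_bounded_above) auto
    then have deg_le: "edge_deg v e \<le> int CARD('n) + 1" using edge_deg_eq[OF v e] card_E[OF v] by simp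
    have slope: "2 * max_slope > real CARD('n) + 2" using mu spectral_value_le by simp
    have len: "edge_len v e = 1"
    proof (rule ccontr)
      assume "edge_len v e \<noteq> 1"
      then have "edge_len v e \<ge> 2" using edge_len_pos[OF v e] by simp
      then have "max_slope * 2 \<le> max_slope * edge_len v e"
        using slope by (intro mult_left_mono) auto
      also have "\<dots> \<le> real CARD('n) + 1" unfolding deg[symmetric] using deg_le by linarith
      finally show False using slope by simp
    qed
    define I where "I = {l \<in> E v. ?c l = 1}"
    define J where "J = {l \<in> E v. ?c l \<le> 0}"
    have fin: "finite I" "finite J" using finite_E[OF v] by (auto simp: I_def J_def)
    have split: "E v = I \<union> J" "I \<inter> J = {}" using c1 by (force simp: I_def J_def)+
    have eI: "e \<in> I" using e wall_coeff_self[OF v e] by (simp add: I_def)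
    have sums: "edge_deg v e = 1 + int (card I) + sum ?c J"
    proof -
      have "sum ?c I = int (card I)" by (simp add: I_def)
      then show ?thesis
        using edge_deg_eq[OF v e] fin split by (simp add: sum.union_disjoint)
    qed
    define D where "D = int (card I) - int CARD('n) + int (card I) + sum ?c J"
    have "sum ?c J \<le> ?c j0"
    proof -
      have "sum ?c J = ?c j0 + sum ?c (J - {j0})" using fin j0 by (intro sum.remove) (auto simp: J_def)
      moreover have "sum ?c (J - {j0}) \<le> 0" by (intro sum_nonpos) (auto simp: J_def)
      ultimately show ?thesis by simp
    qed
    moreover have "real_of_int (edge_deg v e) = max_slope" using deg len by simp
    then have "2 * edge_deg v e > int CARD('n) + 2" using slope by linarith
    \<comment> \<open>By \<open>sums\<close>, \<open>2 d > n + 2\<close> reads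
      \<open>D + sum ?c J > 0\<close>, and \<open>sum ?c J\<close> is negative because of
      \<open>j0\<close>.\<close>
    ultimately have D: "D \<ge> 0" using sums j0(2) unfolding D_def by linarith
    have "t < (real CARD('n) + 2) / 2" if t: "t \<in> sectionless" for t
    proof (rule ccontr)
      assume "\<not> ?thesis"
      then have tn: "t \<ge> (real CARD('n) + 2) / 2" by simp
      have "t \<in> \<rat>" using t by (simp add: sectionless_def)
      have "t \<notin> sectionless"
      proof (rule wide_slice_not_sectionless[OF v split _ _ j0(2) _ D_def D _ \<open>t \<in> \<rat>\<close> tn])
        show "I \<noteq> {}" using eI by auto
        show "j0 \<in> J" using j0 by (simp add: J_def)
        show "?c l \<le> 0" if "l \<in> J" for l using that by (simp add: J_def)
        show "0 \<le> coord w m (v + l + (1 - ?c l) *s i - w)"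
          if "i \<in> I" "l \<in> J" "w \<in> V" "m \<in> E w" for i l w m
          using that min[of i] len by (intro slice_point[OF v e]) (auto simp: I_def J_def)
      qed
      then show False using t by blast
    qed
    then have "spectral_value P \<le> (real CARD('n) + 2) / 2"
      unfolding spectral_value_eq using zero_sectionless by (intro cSup_least) (auto simp: less_imp_le)
    then show ?thesis using mu by simp
  qed
qed

end

subsection \<open>Homogeneous linear systems\<close>

text \<open>Elimination of one unknown per equation by cross multiplication, free of division, so
  that it applies over the ring of complex polynomials as well.\<close>

lemma homogeneous_system_nontrivial:
  fixes A :: "'i \<Rightarrow> 'j \<Rightarrow> 'a::idom"
  assumes "finite R" "finite C" "card R < card C"
  shows "\<exists>x. (\<exists>j\<in>C. x j \<noteq> 0) \<and> (\<forall>i\<in>R. (\<Sum>j\<in>C. A i j * x j) = 0)"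
  using assms
proof (induction R arbitrary: A C rule: finite_induct)
  case empty
  then obtain j where "j \<in> C" by fastforce
  then show ?case by (intro exI[of _ "\<lambda>_. 1"]) auto
next
  case (insert r R)
  show ?case
  proof (cases "\<forall>j\<in>C. A r j = 0")
    case True
    have "card R < card C" using insert.prems insert.hyps by simp
    then obtain x where "\<exists>j\<in>C. x j \<noteq> 0" "\<forall>i\<in>R. (\<Sum>j\<in>C. A i j * x j) = 0"
      using insert.IH[OF insert.prems(1), of A] by blast
    then show ?thesis using True by (intro exI[of _ x]) auto
  next
    case False
    then obtain k where k: "k \<in> C" "A r k \<noteq> 0" by blast
    let ?C = "C - {k}"
    have "card R < card ?C" using insert.prems insert.hyps k by (simp add: card_Diff_singleton)
    then obtain x where x: "\<exists>j\<in>?C. x j \<noteq> 0"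
      "\<forall>i\<in>R. (\<Sum>j\<in>?C. (A r k * A i j - A i k * A r j) * x j) = 0"
      using insert.IH[of ?C "\<lambda>i j. A r k * A i j - A i k * A r j"] insert.prems(1) by auto
    \<comment> \<open>The other unknowns are scaled by the pivot \<open>A r k\<close>, so that the
      value at \<open>k\<close> solving row \<open>r\<close> needs no division.\<close>
    define y where "y j = (if j = k then - (\<Sum>j\<in>?C. A r j * x j) else A r k * x j)" for j
    have y: "(\<Sum>j\<in>C. A i j * y j) = (\<Sum>j\<in>?C. (A r k * A i j - A i k * A r j) * x j)" for i
    proof -
      have "(\<Sum>j\<in>C. A i j * y j) = A i k * y k + (\<Sum>j\<in>?C. A i j * y j)"
        using insert.prems(1) k(1) by (rule sum.remove)
      also have "(\<Sum>j\<in>?C. A i j * y j) = (\<Sum>j\<in>?C. A r k * A i j * x j)"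
        by (intro sum.cong) (auto simp: y_def)
      also have "A i k * y k = - (\<Sum>j\<in>?C. A i k * A r j * x j)"
        by (simp add: y_def sum_distrib_left mult.assoc)
      finally show ?thesis by (simp add: left_diff_distrib sum_subtractf)
    qed
    have "\<exists>j\<in>C. y j \<noteq> 0" using x(1) k(2) by (auto simp: y_def)
    moreover have "\<forall>i\<in>insert r R. (\<Sum>j\<in>C. A i j * y j) = 0"
      unfolding y using x(2) by simp
    ultimately show ?thesis by blast
  qed
qed

subsection \<open>Places\<close>

locale place_field =
  fixes K :: "complex fls set"
  assumes K: "subfield_over_complex K"
begin

lemma const_in: "fls_const c \<in> K"
  and add_in: "x \<in> K \<Longrightarrow> y \<in> K \<Longrightarrow> x + y \<in> K"
  and mult_in: "x \<in> K \<Longrightarrow> y \<in> K \<Longrightarrow> x * y \<in> K"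
  and uminus_in: "x \<in> K \<Longrightarrow> - x \<in> K"
  and inverse_in: "x \<in> K \<Longrightarrow> inverse x \<in> K"
  using K by (auto simp: subfield_over_complex_def)

lemma one_in: "1 \<in> K" and zero_in: "0 \<in> K"
  using const_in[of 1] const_in[of 0] by simp_all

lemma divide_in: "x \<in> K \<Longrightarrow> y \<in> K \<Longrightarrow> x / y \<in> K"
  by (simp add: divide_inverse mult_in inverse_in)

lemma power_in: "x \<in> K \<Longrightarrow> x ^ n \<in> K"
  by (induction n) (auto simp: one_in mult_in)

lemma power_int_in: "x \<in> K \<Longrightarrow> x powi k \<in> K"
  by (simp add: power_int_def power_in inverse_in)

lemma sum_in: "(\<And>i. i \<in> I \<Longrightarrow> f i \<in> K) \<Longrightarrow> sum f I \<in> K"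
  by (induction I rule: infinite_finite_induct) (auto simp: zero_in add_in)

lemma prod_in: "(\<And>i. i \<in> I \<Longrightarrow> f i \<in> K) \<Longrightarrow> prod f I \<in> K"
  by (induction I rule: infinite_finite_induct) (auto simp: one_in mult_in)

context
  fixes p assumes p: "p \<in> places K"
begin

lemma place_const: "p (fls_const c) = 0"
  and place_mult: "x \<in> K \<Longrightarrow> y \<in> K \<Longrightarrow> x \<noteq> 0 \<Longrightarrow> y \<noteq> 0 \<Longrightarrow> p (x * y) = p x + p y"
  and place_add: "x \<in> K \<Longrightarrow> y \<in> K \<Longrightarrow> x \<noteq> 0 \<Longrightarrow> y \<noteq> 0 \<Longrightarrow> x + y \<noteq> 0 \<Longrightarrow> min (p x) (p y) \<le> p (x + y)"
  and place_outside: "x \<notin> K - {0} \<Longrightarrow> p x = 0"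
  and place_surj: "\<exists>x\<in>K - {0}. p x = k"
proof -
  show "\<exists>x\<in>K - {0}. p x = k"
  proof -
    have "k \<in> p ` (K - {0})" using p by (simp add: places_def)
    then show ?thesis by auto
  qed
qed (use p in \<open>simp_all add: places_def\<close>)

lemma place_one: "p 1 = 0" and place_zero: "p 0 = 0"
  using place_const[of 1] place_const[of 0] by simp_all

lemma place_uminus: assumes "x \<in> K" shows "p (- x) = p x"
proof (cases "x = 0")
  case False
  have "- x = fls_const (- 1) * x" by (simp add: fls_eq_iff)
  also have "p \<dots> = p (fls_const (- 1)) + p x"
    by (rule place_mult[OF const_in assms _ False]) simp
  also have "\<dots> = p x" by (simp only: place_const)
  finally show ?thesis .
qed simp

lemma place_inverse: assumes "x \<in> K" shows "p (inverse x) = - p x"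
proof (cases "x = 0")
  case False
  then have "p (x * inverse x) = p x + p (inverse x)"
    using assms by (intro place_mult) (auto simp: inverse_in)
  then show ?thesis using False by (simp add: place_one)
qed (simp add: place_zero)

lemma place_divide: "x \<in> K \<Longrightarrow> y \<in> K \<Longrightarrow> x \<noteq> 0 \<Longrightarrow> y \<noteq> 0 \<Longrightarrow> p (x / y) = p x - p y"
  by (simp add: divide_inverse place_mult place_inverse inverse_in)

lemma place_power: "x \<in> K \<Longrightarrow> x \<noteq> 0 \<Longrightarrow> p (x ^ n) = int n * p x"
  by (induction n) (auto simp: place_one place_mult power_in algebra_simps)

lemma place_power_int: "x \<in> K \<Longrightarrow> x \<noteq> 0 \<Longrightarrow> p (x powi k) = k * p x"
  by (cases "k \<ge> 0") (auto simp: power_int_def place_power place_inverse inverse_in)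

lemma place_prod:
  "(\<And>i. i \<in> I \<Longrightarrow> f i \<in> K \<and> f i \<noteq> 0) \<Longrightarrow> p (prod f I) = (\<Sum>i\<in>I. p (f i))"
proof (induction I rule: infinite_finite_induct)
  case (insert i I)
  then have "prod f I \<in> K" "prod f I \<noteq> 0" by (auto intro: prod_in)
  with insert show ?case by (simp add: place_mult)
qed (auto simp: place_one)

text \<open>The disjuncts with 0 stand for the value infinity, since a place has the conventional
  value 0 at 0.\<close>

lemma place_add_ge:
  assumes "x \<in> K" "y \<in> K" "x = 0 \<or> p x \<ge> k" "y = 0 \<or> p y \<ge> k"
  shows "x + y = 0 \<or> p (x + y) \<ge> k"
  using place_add[of x y] assms
  by (cases "x = 0"; cases "y = 0"; cases "x + y = 0") (auto simp: min_le_iff_disj)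

lemma place_sum_ge:
  assumes "\<And>i. i \<in> I \<Longrightarrow> f i \<in> K" "\<And>i. i \<in> I \<Longrightarrow> f i = 0 \<or> p (f i) \<ge> k"
  shows "sum f I = 0 \<or> p (sum f I) \<ge> k"
  using assms
proof (induction I rule: infinite_finite_induct)
  case (insert i I)
  have "f i + sum f I = 0 \<or> p (f i + sum f I) \<ge> k"
    using insert by (intro place_add_ge sum_in) auto
  then show ?case using insert.hyps by simp
qed auto

text \<open>The isosceles property of ultrametrics: the triangle inequality is applied to
  \<open>x + y\<close> and again to \<open>x = (x + y) - y\<close>.\<close>

lemma place_dominant:
  assumes "x \<in> K" "y \<in> K" "x \<noteq> 0" "y = 0 \<or> p y > p x"
  shows "x + y \<noteq> 0" "p (x + y) = p x"
proof -
  have "x + y \<noteq> 0 \<and> p (x + y) = p x"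
  proof (cases "y = 0")
    case False
    then have gt: "p y > p x" using assms by simp
    have ne: "x + y \<noteq> 0"
    proof
      assume "x + y = 0"
      then have "y = - x" by (simp add: eq_neg_iff_add_eq_0 add.commute)
      then show False using gt assms(1) by (simp add: place_uminus)
    qed
    have "min (p x) (p y) \<le> p (x + y)" using assms False ne by (intro place_add) auto
    moreover have "min (p (x + y)) (p (- y)) \<le> p (x + y + - y)"
      using assms False ne by (intro place_add) (auto simp: add_in uminus_in)
    ultimately show ?thesis using gt ne assms by (simp add: place_uminus min_def split: if_splits)
  qed (use assms in simp)
  then show "x + y \<noteq> 0" "p (x + y) = p x" by auto
qed

end

subsection \<open>Weak approximation\<close>

text \<open>If the valuation ring of \<open>p\<close> were contained in that of \<open>q\<close>,
  then \<open>q\<close> would be 0 on the units of \<open>p\<close>, hence an integer multiple of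
  \<open>p\<close>; surjectivity of both makes the factor 1.\<close>

lemma place_incomparable:
  assumes p: "p \<in> places K" and q: "q \<in> places K" and ne: "p \<noteq> q"
  shows "\<exists>a\<in>K - {0}. p a \<ge> 0 \<and> q a < 0"
proof (rule ccontr)
  assume neg: "\<not> ?thesis"
  have sub: "q a \<ge> 0" if "a \<in> K" "a \<noteq> 0" "p a \<ge> 0" for a
    using that neg by force
  obtain u where u: "u \<in> K" "u \<noteq> 0" "p u = 1" using place_surj[OF p, of 1] by auto
  have multiple: "q a = p a * q u" if a: "a \<in> K" "a \<noteq> 0" for a
  proof -
    let ?b = "a / u powi p a"
    have up: "u powi p a \<in> K" "u powi p a \<noteq> 0" using u by (auto simp: power_int_in)
    have b: "?b \<in> K" "?b \<noteq> 0" using a up by (auto simp: divide_in)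
    have "p ?b = 0" using a u up by (simp add: place_divide[OF p] place_power_int[OF p])
    then have "q ?b \<ge> 0" "q (inverse ?b) \<ge> 0"
      using b by (auto intro!: sub simp: inverse_in place_inverse[OF p] simp del: inverse_divide)
    then have "q ?b = 0" using b by (simp add: place_inverse[OF q] del: inverse_divide)
    then show ?thesis using a u up by (simp add: place_divide[OF q] place_power_int[OF q])
  qed
  obtain b where b: "b \<in> K" "b \<noteq> 0" "q b = 1" using place_surj[OF q, of 1] by auto
  have "p b * q u = 1" using multiple[OF b(1,2)] b(3) by simp
  moreover have "q u \<ge> 0" using u by (intro sub) auto
  ultimately have "q u = 1" by (auto simp: zmult_eq_1_iff)
  have "p x = q x" for x
  proof (cases "x \<in> K - {0}")
    case True
    then show ?thesis using multiple[of x] \<open>q u = 1\<close> by simp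
  next
    case False
    then show ?thesis using place_outside[OF p] place_outside[OF q] by simp
  qed
  then show False using ne by auto
qed

lemma place_separate_two:
  assumes p: "p \<in> places K" and q: "q \<in> places K" and ne: "p \<noteq> q"
  obtains z where "z \<in> K" "z \<noteq> 0" "p z > 0" "q z < 0"
proof -
  obtain a where a: "a \<in> K" "a \<noteq> 0" "p a \<ge> 0" "q a < 0" using place_incomparable[OF p q ne] by auto
  obtain b where b: "b \<in> K" "b \<noteq> 0" "q b \<ge> 0" "p b < 0" using place_incomparable[OF q p ne[symmetric]] by auto
  have "a / b \<in> K" "a / b \<noteq> 0" using a b by (auto simp: divide_in)
  moreover have "p (a / b) > 0" "q (a / b) < 0"
    using a b by (simp_all add: place_divide[OF p] place_divide[OF q])
  ultimately show thesis by (rule that)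
qed

text \<open>If the old \<open>z\<close> fails at the new place \<open>r\<close>, a high power of an
  element \<open>u\<close> separating \<open>p\<close> from \<open>r\<close> is added: at poles of
  \<open>u\<close> that power dominates \<open>z\<close>, and elsewhere in \<open>S\<close> the pole
  of \<open>z\<close> survives.\<close>

lemma place_separate:
  assumes "finite S" "S \<subseteq> places K" "p \<in> places K" "p \<notin> S"
  shows "\<exists>z\<in>K - {0}. p z > 0 \<and> (\<forall>q\<in>S. q z < 0)"
  using assms
proof (induction S rule: finite_induct)
  case empty
  have "\<exists>z\<in>K - {0}. p z = 1" by (rule place_surj[OF empty(2)])
  then show ?case by force
next
  case (insert r S)
  have p: "p \<in> places K" and r: "r \<in> places K" and S: "\<And>q. q \<in> S \<Longrightarrow> q \<in> places K"
    using insert.prems by auto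
  obtain z where z: "z \<in> K" "z \<noteq> 0" "p z > 0" "\<And>q. q \<in> S \<Longrightarrow> q z < 0"
    using insert by auto
  have "p \<noteq> r" using insert.prems by auto
  obtain u where u: "u \<in> K" "u \<noteq> 0" "p u > 0" "r u < 0" by (rule place_separate_two[OF p r \<open>p \<noteq> r\<close>])
  show ?case
  proof (cases "r z < 0")
    case True
    then show ?thesis using z by auto
  next
    case False
    \<comment> \<open>Exceeds every \<open>\<bar>q z\<bar>\<close>, so that a pole of
      \<open>u ^ m\<close> at a place of \<open>S\<close> is of higher order than that of
      \<open>z\<close>.\<close>
    define m where "m = Suc (\<Sum>q\<in>S. nat \<bar>q z\<bar>)"
    have m: "int m > \<bar>q z\<bar>" if "q \<in> S" for q
    proof -
      have "\<bar>q z\<bar> \<le> (\<Sum>q\<in>S. \<bar>q z\<bar>)" using that insert.hyps by (intro member_le_sum) auto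
      then show ?thesis by (simp add: m_def)
    qed
    have um: "u ^ m \<in> K" "u ^ m \<noteq> 0" using u by (auto simp: power_in)
    have pw: "q (u ^ m) = int m * q u" if "q \<in> places K" for q
      by (rule place_power[OF that u(1,2)])
    have m0: "int m > 0" unfolding of_nat_0_less_iff by (simp add: m_def)
    have "r (u ^ m) < 0" using pw[OF r] u(4) m0 by (simp add: mult_pos_neg)
    then have rw: "u ^ m + z \<noteq> 0" "r (u ^ m + z) < 0"
      using place_dominant[OF r um(1) z(1) um(2)] False by auto
    have "p (u ^ m) > 0" using pw[OF p] u(3) m0 by simp
    then have "p (u ^ m + z) \<ge> 1"
      using place_add_ge[OF p um(1) z(1), of 1] z(3) rw(1) by auto
    moreover have "q (u ^ m + z) < 0" if q: "q \<in> S" for q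
    proof (cases "q u \<ge> 0")
      case True
      then have "q (u ^ m) \<ge> 0" using pw[OF S[OF q]] by simp
      then have "q (z + u ^ m) = q z" using place_dominant(2)[OF S[OF q] z(1) um(1) z(2)] z(4)[OF q] by auto
      then show ?thesis using z(4)[OF q] by (simp add: add.commute)
    next
      case False
      then have "int m * q u \<le> int m * (- 1)" by (intro mult_left_mono) auto
      then have *: "q (u ^ m) < q z" using pw[OF S[OF q]] m[OF q] by simp
      then have "q (u ^ m + z) = q (u ^ m)" using place_dominant(2)[OF S[OF q] um(1) z(1) um(2)] by auto
      then show ?thesis using * z(4)[OF q] by simp
    qed
    moreover have "u ^ m + z \<in> K" using um z by (simp add: add_in)
    ultimately show ?thesis using rw by (intro bexI[of _ "u ^ m + z"]) auto
  qed
qed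

text \<open>For \<open>z\<close> vanishing at \<open>p\<close> with poles on \<open>S\<close>, the
  element \<open>1 / (1 + z)\<close> is a unit at \<open>p\<close> and vanishes on
  \<open>S\<close>.\<close>

lemma place_indicator:
  assumes "finite S" "S \<subseteq> places K" "p \<in> places K" "p \<notin> S"
  shows "\<exists>y\<in>K - {0}. p y = 0 \<and> (\<forall>q\<in>S. q y > 0)"
proof -
  obtain z where z: "z \<in> K" "z \<noteq> 0" "p z > 0" "\<And>q. q \<in> S \<Longrightarrow> q z < 0"
    using place_separate[OF assms] by auto
  have 1: "1 + z \<noteq> 0" "p (1 + z) = 0"
    using place_dominant[OF assms(3) one_in z(1)] z(3) place_one[OF assms(3)] by auto
  have "q (1 + z) < 0" if q: "q \<in> S" for q
  proof -
    have qK: "q \<in> places K" using q assms by auto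
    have "q (z + 1) = q z" using place_dominant(2)[OF qK z(1) one_in z(2)] place_one[OF qK] z(4)[OF q] by auto
    then show ?thesis using z(4)[OF q] by (simp add: add.commute)
  qed
  then have "\<forall>q\<in>S. q (inverse (1 + z)) > 0"
    using assms(2) z(1) by (auto simp: place_inverse add_in one_in)
  moreover have "p (inverse (1 + z)) = 0" using 1 assms(3) z(1) by (simp add: place_inverse add_in one_in)
  ultimately show ?thesis using 1 z(1) by (intro bexI[of _ "inverse (1 + z)"]) (auto simp: inverse_in add_in one_in)
qed

end

subsection \<open>Finiteness of the set of poles\<close>

definition eval_poly_fls :: "complex poly \<Rightarrow> complex fls \<Rightarrow> complex fls" where
  "eval_poly_fls f x = poly (map_poly fls_const f) x"

lemma eval_poly_fls_pCons [simp]: "eval_poly_fls (pCons a f) x = fls_const a + x * eval_poly_fls f x"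
  by (simp add: eval_poly_fls_def map_poly_pCons)

lemma eval_poly_fls_0 [simp]: "eval_poly_fls 0 x = 0"
  by (simp add: eval_poly_fls_def)

lemma eval_poly_fls_1 [simp]: "eval_poly_fls 1 x = 1"
  by (simp add: one_pCons)

lemma eval_poly_fls_add: "eval_poly_fls (f + g) x = eval_poly_fls f x + eval_poly_fls g x"
  by (induction f g rule: poly_induct2) (simp_all add: algebra_simps flip: fls_plus_const)

lemma eval_poly_fls_smult: "eval_poly_fls (smult a f) x = fls_const a * eval_poly_fls f x"
  by (induction f) (simp_all add: algebra_simps)

lemma eval_poly_fls_mult: "eval_poly_fls (f * g) x = eval_poly_fls f x * eval_poly_fls g x"
  by (induction f) (simp_all add: algebra_simps eval_poly_fls_add eval_poly_fls_smult)

lemma eval_poly_fls_minus: "eval_poly_fls (- f) x = - eval_poly_fls f x"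
  using eval_poly_fls_smult[of "-1" f x] by simp

lemma eval_poly_fls_sum: "eval_poly_fls (\<Sum>i\<in>I. f i) x = (\<Sum>i\<in>I. eval_poly_fls (f i) x)"
  by (induction I rule: infinite_finite_induct) (simp_all add: eval_poly_fls_add)

lemma alg_dependent_iff:
  "alg_dependent x y \<longleftrightarrow> (\<exists>F :: complex poly poly. F \<noteq> 0 \<and> (\<Sum>k\<le>degree F. eval_poly_fls (coeff F k) x * y ^ k) = 0)"
proof -
  have "poly (map_poly (\<lambda>c. poly (map_poly fls_const c) x) F) y
      = (\<Sum>k\<le>degree F. eval_poly_fls (coeff F k) x * y ^ k)" for F :: "complex poly poly"
  proof -
    let ?G = "map_poly (\<lambda>c. eval_poly_fls c x) F"
    \<comment> \<open>Evaluating the coefficients at \<open>x\<close> may kill the leading one, so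
      the degree of \<open>?G\<close> may drop below that of \<open>F\<close>.\<close>
    have "poly ?G y = (\<Sum>k\<le>degree F. coeff ?G k * y ^ k)"
      unfolding poly_altdef
      by (intro sum.mono_neutral_left) (auto simp: map_poly_degree_leq coeff_eq_0)
    then show ?thesis by (simp add: coeff_map_poly eval_poly_fls_def)
  qed
  then show ?thesis by (simp add: alg_dependent_def)
qed

text \<open>The complex algebra generated by \<open>Y\<close>. Products are formed with one
  generator at a time, so that containment in a span needs only its stability under multiplication
  by generators.\<close>

inductive_set generated_ring :: "complex fls set \<Rightarrow> complex fls set" for Y where
  const: "fls_const c \<in> generated_ring Y"
| add: "a \<in> generated_ring Y \<Longrightarrow> b \<in> generated_ring Y \<Longrightarrow> a + b \<in> generated_ring Y"
| mult: "y \<in> Y \<Longrightarrow> a \<in> generated_ring Y \<Longrightarrow> y * a \<in> generated_ring Y"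

lemma generated_ring_mult:
  assumes "a \<in> generated_ring Y" "b \<in> generated_ring Y" shows "a * b \<in> generated_ring Y"
  using assms(1)
proof induction
  case (const c)
  show ?case using assms(2)
  proof induction
    case (const d)
    then show ?case by (simp add: generated_ring.const)
  next
    case (add a b)
    then show ?case by (simp add: distrib_left generated_ring.add)
  next
    case (mult y a)
    then show ?case using generated_ring.mult[OF mult(1), of "fls_const c * a"]
      by (simp add: mult.left_commute)
  qed
next
  case (add a b')
  then show ?case by (simp add: distrib_right generated_ring.add)
next
  case (mult y a)
  then show ?case by (simp add: mult.assoc generated_ring.mult)
qed

lemma generated_ring_prod:
  "(\<And>i. i \<in> I \<Longrightarrow> f i \<in> generated_ring Y) \<Longrightarrow> prod f I \<in> generated_ring Y"
  using generated_ring.const[of 1 Y]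
  by (induction I rule: infinite_finite_induct) (auto simp: generated_ring_mult)

text \<open>The span of \<open>M\<close> over the field generated by \<open>x\<close>, with denominators cleared.\<close>

definition rational_span :: "complex fls \<Rightarrow> complex fls set \<Rightarrow> complex fls set" where
  "rational_span x M = {g. \<exists>d f. d \<noteq> 0 \<and> eval_poly_fls d x * g = (\<Sum>b\<in>M. eval_poly_fls (f b) x * b)}"

lemma rational_span_base: "finite M \<Longrightarrow> b \<in> M \<Longrightarrow> b \<in> rational_span x M"
  unfolding rational_span_def
  by (auto intro!: exI[of _ "1 :: complex poly"] exI[of _ "\<lambda>c. if c = b then 1 else 0"]
      simp: if_distrib[of "\<lambda>f. eval_poly_fls f _ * _"] cong: if_cong)

lemma rational_span_add:
  assumes "g \<in> rational_span x M" "h \<in> rational_span x M" shows "g + h \<in> rational_span x M"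
proof -
  obtain d f where d: "d \<noteq> 0" "eval_poly_fls d x * g = (\<Sum>b\<in>M. eval_poly_fls (f b) x * b)"
    using assms(1) by (auto simp: rational_span_def)
  obtain d' f' where d': "d' \<noteq> 0" "eval_poly_fls d' x * h = (\<Sum>b\<in>M. eval_poly_fls (f' b) x * b)"
    using assms(2) by (auto simp: rational_span_def)
  have "eval_poly_fls (d * d') x * (g + h)
      = eval_poly_fls d' x * (eval_poly_fls d x * g) + eval_poly_fls d x * (eval_poly_fls d' x * h)"
    by (simp add: eval_poly_fls_mult algebra_simps)
  also have "\<dots> = (\<Sum>b\<in>M. eval_poly_fls (d' * f b + d * f' b) x * b)"
    unfolding d(2) d'(2)
    by (simp add: eval_poly_fls_mult eval_poly_fls_add sum_distrib_left sum.distrib algebra_simps)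
  finally show ?thesis
    unfolding rational_span_def using d(1) d'(1)
    by (intro CollectI exI[of _ "d * d'"] exI[of _ "\<lambda>b. d' * f b + d * f' b"]) simp
qed

lemma rational_span_scale:
  assumes "g \<in> rational_span x M" shows "eval_poly_fls c x * g \<in> rational_span x M"
proof -
  obtain d f where d: "d \<noteq> 0" "eval_poly_fls d x * g = (\<Sum>b\<in>M. eval_poly_fls (f b) x * b)"
    using assms(1) by (auto simp: rational_span_def)
  have "eval_poly_fls d x * (eval_poly_fls c x * g) = eval_poly_fls c x * (eval_poly_fls d x * g)"
    by (simp add: algebra_simps)
  also have "\<dots> = (\<Sum>b\<in>M. eval_poly_fls (c * f b) x * b)"
    unfolding d(2) by (simp add: eval_poly_fls_mult sum_distrib_left mult.assoc)
  finally show ?thesis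
    unfolding rational_span_def using d(1)
    by (intro CollectI exI[of _ d] exI[of _ "\<lambda>b. c * f b"]) simp
qed

lemma rational_span_cancel:
  assumes "eval_poly_fls c x * g \<in> rational_span x M" "c \<noteq> 0" shows "g \<in> rational_span x M"
proof -
  obtain d f where d: "d \<noteq> 0" "eval_poly_fls d x * (eval_poly_fls c x * g) = (\<Sum>b\<in>M. eval_poly_fls (f b) x * b)"
    using assms(1) by (auto simp: rational_span_def)
  then show ?thesis
    unfolding rational_span_def using assms(2)
    by (intro CollectI exI[of _ "d * c"] exI[of _ f]) (simp add: eval_poly_fls_mult mult.assoc)
qed

lemma rational_span_0: "0 \<in> rational_span x M"
  unfolding rational_span_def by (intro CollectI exI[of _ 1] exI[of _ "\<lambda>_. 0"]) simp

lemma rational_span_sum: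
  "(\<And>i. i \<in> I \<Longrightarrow> f i \<in> rational_span x M) \<Longrightarrow> sum f I \<in> rational_span x M"
  by (induction I rule: infinite_finite_induct) (auto simp: rational_span_add rational_span_0)

text \<open>There are more elements than spanning vectors, so the cleared numerators satisfy a
  linear relation over the polynomials.\<close>

lemma rational_span_relation:
  assumes "finite M" "finite S" "card M < card S" "\<And>i. i \<in> S \<Longrightarrow> g i \<in> rational_span x M"
  shows "\<exists>f. (\<exists>i\<in>S. f i \<noteq> 0) \<and> (\<Sum>i\<in>S. eval_poly_fls (f i) x * g i) = 0"
proof -
  have "\<forall>i\<in>S. \<exists>df. fst df \<noteq> 0 \<and> eval_poly_fls (fst df) x * g i = (\<Sum>b\<in>M. eval_poly_fls (snd df b) x * b)"
    using assms(4) by (force simp: rational_span_def)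
  from bchoice[OF this] obtain df where df: "\<And>i. i \<in> S \<Longrightarrow> fst (df i) \<noteq> 0"
    "\<And>i. i \<in> S \<Longrightarrow> eval_poly_fls (fst (df i)) x * g i = (\<Sum>b\<in>M. eval_poly_fls (snd (df i) b) x * b)"
    by blast
  obtain h where h: "\<exists>i\<in>S. h i \<noteq> 0" "\<forall>b\<in>M. (\<Sum>i\<in>S. snd (df i) b * h i) = 0"
    using homogeneous_system_nontrivial[OF assms(1,2,3), of "\<lambda>b i. snd (df i) b"] by blast
  have "(\<Sum>i\<in>S. eval_poly_fls (h i * fst (df i)) x * g i)
      = (\<Sum>i\<in>S. eval_poly_fls (h i) x * (eval_poly_fls (fst (df i)) x * g i))"
    by (simp add: eval_poly_fls_mult mult.assoc)
  also have "\<dots> = (\<Sum>i\<in>S. \<Sum>b\<in>M. eval_poly_fls (snd (df i) b * h i) x * b)"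
  proof (intro sum.cong refl)
    fix i assume i: "i \<in> S"
    show "eval_poly_fls (h i) x * (eval_poly_fls (fst (df i)) x * g i)
        = (\<Sum>b\<in>M. eval_poly_fls (snd (df i) b * h i) x * b)"
      unfolding df(2)[OF i] by (simp add: eval_poly_fls_mult sum_distrib_left mult_ac)
  qed
  also have "\<dots> = (\<Sum>b\<in>M. eval_poly_fls (\<Sum>i\<in>S. snd (df i) b * h i) x * b)"
    by (subst sum.swap) (simp add: eval_poly_fls_sum sum_distrib_right)
  also have "\<dots> = 0" using h(2) by simp
  finally show ?thesis
    \<comment> \<open>The coefficients absorb the denominators, which are nonzero, so the relation
      stays nontrivial.\<close>
    using h(1) df(1) by (intro exI[of _ "\<lambda>i. h i * fst (df i)"]) auto
qed

text \<open>
  \<open>M\<close> consists of the products of powers of the generators with exponents below their degrees over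
  the field generated by \<open>x\<close>.
\<close>

lemma generated_ring_rational_span:
  assumes Y: "finite Y" and alg: "\<And>y. y \<in> Y \<Longrightarrow> alg_dependent x y"
    and tr: "\<And>f. f \<noteq> 0 \<Longrightarrow> eval_poly_fls f x \<noteq> 0"
  obtains M where "finite M" "generated_ring Y \<subseteq> rational_span x M"
proof -
  have "\<forall>y\<in>Y. \<exists>F :: complex poly poly. F \<noteq> 0 \<and> (\<Sum>k\<le>degree F. eval_poly_fls (coeff F k) x * y ^ k) = 0"
    using alg unfolding alg_dependent_iff by blast
  from bchoice[OF this] obtain F where F: "\<And>y. y \<in> Y \<Longrightarrow> F y \<noteq> (0 :: complex poly poly)"
    "\<And>y. y \<in> Y \<Longrightarrow> (\<Sum>k\<le>degree (F y). eval_poly_fls (coeff (F y) k) x * y ^ k) = 0"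
    by blast
  define A where "A = {\<alpha>. (\<forall>y\<in>Y. \<alpha> y < degree (F y)) \<and> (\<forall>y. y \<notin> Y \<longrightarrow> \<alpha> y = (0::nat))}"
  define mono where "mono \<alpha> = (\<Prod>y\<in>Y. y ^ \<alpha> y)" for \<alpha> :: "complex fls \<Rightarrow> nat"
  define M where "M = mono ` A"
  have "finite A"
  proof (rule finite_subset)
    let ?m = "Max (insert 0 ((\<lambda>y. degree (F y)) ` Y))"
    show "A \<subseteq> {\<alpha>. \<forall>y. (y \<in> Y \<longrightarrow> \<alpha> y \<in> {..?m}) \<and> (y \<notin> Y \<longrightarrow> \<alpha> y = 0)}"
    proof
      fix \<alpha> assume a: "\<alpha> \<in> A"
      have "\<alpha> y \<le> ?m" if "y \<in> Y" for y
      proof -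
        have "degree (F y) \<le> ?m" using Y that by (intro Max_ge) auto
        then show ?thesis using a that by (fastforce simp: A_def)
      qed
      then show "\<alpha> \<in> {\<alpha>. \<forall>y. (y \<in> Y \<longrightarrow> \<alpha> y \<in> {..?m}) \<and> (y \<notin> Y \<longrightarrow> \<alpha> y = 0)}"
        using a by (auto simp: A_def)
    qed
    show "finite {\<alpha>. \<forall>y. (y \<in> Y \<longrightarrow> \<alpha> y \<in> {..?m}) \<and> (y \<notin> Y \<longrightarrow> \<alpha> y = 0)}"
      using Y by (intro finite_set_of_finite_funs) auto
  qed
  then have M: "finite M" by (simp add: M_def)
  \<comment> \<open>A relation of degree 0 in \<open>y\<close> would be a polynomial equation for
    \<open>x\<close>, excluded by \<open>tr\<close>.\<close>
  have deg: "degree (F y) > 0" if y: "y \<in> Y" for y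
  proof (rule ccontr)
    assume "\<not> ?thesis"
    then have "eval_poly_fls (lead_coeff (F y)) x = 0" using F(2)[OF y] by simp
    then show False using tr F(1)[OF y] by (metis leading_coeff_0_iff)
  qed
  have upd: "mono (\<alpha>(y := k)) = y ^ k * (\<Prod>z\<in>Y-{y}. z ^ \<alpha> z)" if "y \<in> Y" for \<alpha> y k
  proof -
    have "mono (\<alpha>(y := k)) = y ^ (\<alpha>(y := k)) y * (\<Prod>z\<in>Y-{y}. z ^ (\<alpha>(y := k)) z)"
      unfolding mono_def using Y that by (rule prod.remove)
    also have "(\<Prod>z\<in>Y-{y}. z ^ (\<alpha>(y := k)) z) = (\<Prod>z\<in>Y-{y}. z ^ \<alpha> z)"
      by (intro prod.cong) auto
    finally show ?thesis by (simp only: fun_upd_same)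
  qed
  have step: "y * mono \<alpha> \<in> rational_span x M" if y: "y \<in> Y" and a: "\<alpha> \<in> A" for y \<alpha>
  proof -
    let ?b = "\<Prod>z\<in>Y-{y}. z ^ \<alpha> z"
    have ma: "mono \<alpha> = y ^ \<alpha> y * ?b" using upd[OF y, of \<alpha> "\<alpha> y"] by simp
    have low: "y ^ k * ?b \<in> rational_span x M" if k: "k < degree (F y)" for k
    proof (rule rational_span_base[OF M])
      have "\<alpha>(y := k) \<in> A" using a k y by (auto simp: A_def)
      then show "y ^ k * ?b \<in> M" unfolding upd[OF y, symmetric] M_def by (rule imageI)
    qed
    show ?thesis
    proof (cases "Suc (\<alpha> y) < degree (F y)")
      case True
      then show ?thesis using low[OF True] by (simp add: ma mult.assoc)
    next
      case False
      have "\<alpha> y < degree (F y)" using a y by (simp add: A_def)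
      \<comment> \<open>At the largest exponent the relation of \<open>y\<close> rewrites the next
        power by lower ones; its leading coefficient, a polynomial in \<open>x\<close>, is then
        cancelled.\<close>
      with False have D: "degree (F y) = Suc (\<alpha> y)" by simp
      have "(\<Sum>k<degree (F y). eval_poly_fls (coeff (F y) k) x * y ^ k)
          + eval_poly_fls (lead_coeff (F y)) x * y ^ degree (F y) = 0"
        using F(2)[OF y] by (simp add: lessThan_Suc_atMost[symmetric])
      then have "eval_poly_fls (lead_coeff (F y)) x * y ^ degree (F y)
          = - (\<Sum>k<degree (F y). eval_poly_fls (coeff (F y) k) x * y ^ k)"
        by (simp add: eq_neg_iff_add_eq_0 add.commute)
      then have "eval_poly_fls (lead_coeff (F y)) x * (y ^ degree (F y) * ?b)
          = - (\<Sum>k<degree (F y). eval_poly_fls (coeff (F y) k) x * y ^ k) * ?b"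
        by (simp add: mult.assoc[symmetric])
      also have "\<dots> = (\<Sum>k<degree (F y). eval_poly_fls (- coeff (F y) k) x * (y ^ k * ?b))"
        by (simp add: eval_poly_fls_minus sum_distrib_right mult.assoc sum_negf)
      also have "\<dots> \<in> rational_span x M"
        by (intro rational_span_sum rational_span_scale low) simp
      finally have "y ^ degree (F y) * ?b \<in> rational_span x M"
        by (rule rational_span_cancel) (use F(1)[OF y] in simp)
      then show ?thesis by (simp add: ma D mult.assoc)
    qed
  qed
  have mult: "y * g \<in> rational_span x M" if y: "y \<in> Y" and g: "g \<in> rational_span x M" for y g
  proof -
    obtain d f where d: "d \<noteq> 0" "eval_poly_fls d x * g = (\<Sum>b\<in>M. eval_poly_fls (f b) x * b)"
      using g by (auto simp: rational_span_def)
    have "eval_poly_fls d x * (y * g) = y * (\<Sum>b\<in>M. eval_poly_fls (f b) x * b)"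
      by (simp flip: d(2) add: mult.left_commute)
    also have "\<dots> = (\<Sum>b\<in>M. eval_poly_fls (f b) x * (y * b))"
      by (simp add: sum_distrib_left mult.left_commute)
    also have "\<dots> \<in> rational_span x M"
    proof (intro rational_span_sum rational_span_scale)
      fix b assume "b \<in> M"
      then obtain \<alpha> where "\<alpha> \<in> A" "b = mono \<alpha>" by (auto simp: M_def)
      then show "y * b \<in> rational_span x M" using step[OF y] by simp
    qed
    finally show ?thesis by (rule rational_span_cancel[OF _ d(1)])
  qed
  have one: "1 \<in> rational_span x M"
  proof (rule rational_span_base[OF M])
    have "mono (\<lambda>_. 0) \<in> M" unfolding M_def using deg by (intro imageI) (simp add: A_def)
    then show "1 \<in> M" by (simp add: mono_def)
  qed
  have "g \<in> rational_span x M" if "g \<in> generated_ring Y" for g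
    using that
  proof induction
    case (const c)
    then show ?case using rational_span_scale[OF one, of "[:c:]"] by simp
  next
    case (add a b)
    then show ?case by (simp add: rational_span_add)
  next
    case (mult y a)
    then show ?case by (simp add: \<open>\<And>y g. y \<in> Y \<Longrightarrow> g \<in> rational_span x M \<Longrightarrow> y * g \<in> rational_span x M\<close>)
  qed
  then show thesis using that[OF M] by blast
qed

context place_field
begin

lemma eval_poly_fls_in: "x \<in> K \<Longrightarrow> eval_poly_fls f x \<in> K"
  by (induction f) (auto simp: zero_in const_in add_in mult_in)

text \<open>At a pole of \<open>x\<close> the leading term dominates; in Horner form each constant
  has larger value than the part multiplied by \<open>x\<close>.\<close>

lemma place_eval_poly:
  assumes p: "p \<in> places K" and x: "x \<in> K" "p x < 0" and f: "f \<noteq> 0"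
  shows "eval_poly_fls f x \<noteq> 0 \<and> p (eval_poly_fls f x) = int (degree f) * p x"
  using f
proof (induction f)
  case (pCons a f)
  have x0: "x \<noteq> 0" using x place_zero[OF p] by auto
  show ?case
  proof (cases "f = 0")
    case True
    then show ?thesis using pCons.hyps by (simp add: place_const[OF p])
  next
    case False
    then have IH: "eval_poly_fls f x \<noteq> 0" "p (eval_poly_fls f x) = int (degree f) * p x"
      using pCons.IH by auto
    let ?y = "x * eval_poly_fls f x"
    have y: "?y \<in> K" "?y \<noteq> 0" using x IH x0 by (auto simp: mult_in eval_poly_fls_in)
    have py: "p ?y = (1 + int (degree f)) * p x"
      using x IH x0 by (simp add: place_mult[OF p] eval_poly_fls_in algebra_simps)
    also have "\<dots> < 0" using x by (intro mult_pos_neg) auto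
    finally have "p ?y < p (fls_const a)" by (simp add: place_const[OF p])
    then have "?y + fls_const a \<noteq> 0" "p (?y + fls_const a) = p ?y"
      using place_dominant[OF p y(1) const_in y(2)] by auto
    then show ?thesis using False py by (simp add: add.commute algebra_simps)
  qed
qed simp

text \<open>
  If \<open>y p\<close> is a unit at the place \<open>p\<close> and vanishes at the other places of \<open>S\<close>, then the \<open>y p\<close> are
  linearly independent over the polynomials in \<open>x\<close>: look at the place at which the polynomial
  coefficient has the largest degree.
\<close>

lemma finite_poles:
  assumes Y: "finite Y" and frac: "\<And>z. z \<in> K \<Longrightarrow> \<exists>g\<in>generated_ring Y. \<exists>h\<in>generated_ring Y. h \<noteq> 0 \<and> z = g / h"
    and YK: "Y \<subseteq> K" and alg: "\<And>x y. x \<in> K \<Longrightarrow> y \<in> K \<Longrightarrow> alg_dependent x y" and x: "x \<in> K"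
  shows "finite {p \<in> places K. p x < 0}"
proof (cases "{p \<in> places K. p x < 0} = {}")
  case False
  then obtain p0 where p0: "p0 \<in> places K" "p0 x < 0" by auto
  obtain M where M: "finite M" "generated_ring Y \<subseteq> rational_span x M"
  proof (rule generated_ring_rational_span[OF Y])
    show "alg_dependent x y" if "y \<in> Y" for y using alg[OF x] that YK by blast
    show "eval_poly_fls f x \<noteq> 0" if "f \<noteq> 0" for f using place_eval_poly[OF p0(1) x p0(2) that] by simp
  qed iprover
  have bound: "card S \<le> card M" if S: "S \<subseteq> {p \<in> places K. p x < 0}" "finite S" for S
  proof (rule ccontr)
    assume "\<not> card S \<le> card M"
    then have card: "card M < card S" by simp
    have SK: "\<And>p. p \<in> S \<Longrightarrow> p \<in> places K" and neg: "\<And>p. p \<in> S \<Longrightarrow> p x < 0" using S by auto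
    have "\<forall>p\<in>S. \<exists>y. y \<in> K \<and> y \<noteq> 0 \<and> p y = 0 \<and> (\<forall>q\<in>S-{p}. q y > 0)"
    proof
      fix p assume p: "p \<in> S"
      have "\<exists>y\<in>K - {0}. p y = 0 \<and> (\<forall>q\<in>S-{p}. q y > 0)"
        using S SK p by (intro place_indicator) auto
      then show "\<exists>y. y \<in> K \<and> y \<noteq> 0 \<and> p y = 0 \<and> (\<forall>q\<in>S-{p}. q y > 0)" by auto
    qed
    from bchoice[OF this] obtain y where y: "\<And>p. p \<in> S \<Longrightarrow> y p \<in> K" "\<And>p. p \<in> S \<Longrightarrow> y p \<noteq> 0"
      "\<And>p. p \<in> S \<Longrightarrow> p (y p) = 0" "\<And>p q. p \<in> S \<Longrightarrow> q \<in> S \<Longrightarrow> q \<noteq> p \<Longrightarrow> q (y p) > 0"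
      by blast
    have "\<forall>p\<in>S. \<exists>h. h \<in> generated_ring Y \<and> h \<noteq> 0 \<and> y p * h \<in> generated_ring Y"
    proof
      fix p assume "p \<in> S"
      then obtain g h where "g \<in> generated_ring Y" "h \<in> generated_ring Y" "h \<noteq> 0" "y p = g / h"
        using frac[OF y(1)] by blast
      then show "\<exists>h. h \<in> generated_ring Y \<and> h \<noteq> 0 \<and> y p * h \<in> generated_ring Y"
        by (intro exI[of _ h]) simp
    qed
    from bchoice[OF this] obtain h where h: "\<And>p. p \<in> S \<Longrightarrow> h p \<in> generated_ring Y"
      "\<And>p. p \<in> S \<Longrightarrow> h p \<noteq> 0" "\<And>p. p \<in> S \<Longrightarrow> y p * h p \<in> generated_ring Y"
      by blast
    \<comment> \<open>A common denominator moves all \<open>y p\<close> into the ring to which the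
      span bound applies; as a common factor it cancels from the relation.\<close>
    define H where "H = prod h S"
    have H0: "H \<noteq> 0" using h(2) S(2) by (simp add: H_def)
    have rH: "y p * H \<in> generated_ring Y" if p: "p \<in> S" for p
    proof -
      have "H = h p * prod h (S - {p})" unfolding H_def using S(2) p by (rule prod.remove)
      then have "y p * H = (y p * h p) * prod h (S - {p})" by (simp add: mult.assoc)
      also have "\<dots> \<in> generated_ring Y"
        using h by (intro generated_ring_mult[OF h(3)[OF p]] generated_ring_prod) auto
      finally show ?thesis .
    qed
    have span: "y p * H \<in> rational_span x M" if "p \<in> S" for p using rH[OF that] by (rule subsetD[OF M(2)])
    have "\<exists>f. (\<exists>p\<in>S. f p \<noteq> 0) \<and> (\<Sum>p\<in>S. eval_poly_fls (f p) x * (y p * H)) = 0"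
      by (rule rational_span_relation[OF M(1) S(2) card span])
    then obtain f where
      f: "\<exists>p\<in>S. f p \<noteq> 0" and rel: "(\<Sum>p\<in>S. eval_poly_fls (f p) x * (y p * H)) = 0"
      by (elim exE conjE)
    have "(\<Sum>p\<in>S. eval_poly_fls (f p) x * y p) * H = 0"
      using rel by (simp add: sum_distrib_right mult.assoc)
    then have rel: "(\<Sum>p\<in>S. eval_poly_fls (f p) x * y p) = 0" using H0 by simp
    define T where "T = {p \<in> S. f p \<noteq> 0}"
    have T: "finite T" "T \<noteq> {}" using S f by (auto simp: T_def)
    obtain q where q: "q \<in> T" "\<And>p. p \<in> T \<Longrightarrow> degree (f p) \<le> degree (f q)"
    proof -
      have "Max ((\<lambda>p. degree (f p)) ` T) \<in> (\<lambda>p. degree (f p)) ` T" using T by (intro Max_in) auto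
      then obtain q where "q \<in> T" "degree (f q) = Max ((\<lambda>p. degree (f p)) ` T)" by auto
      then show thesis using T by (intro that[of q]) auto
    qed
    have qS: "q \<in> S" "f q \<noteq> 0" using q by (auto simp: T_def)
    note qK = SK[OF qS(1)]
    let ?t = "\<lambda>p. eval_poly_fls (f p) x * y p"
    have tK: "?t p \<in> K" if "p \<in> S" for p using that x y by (auto simp: mult_in eval_poly_fls_in)
    have tq: "?t q \<noteq> 0" "q (?t q) = int (degree (f q)) * q x"
      using place_eval_poly[OF qK x neg[OF qS(1)] qS(2)] y qS x
      by (simp_all add: place_mult[OF qK] eval_poly_fls_in)
    have tp: "?t p = 0 \<or> q (?t p) \<ge> q (?t q) + 1" if p: "p \<in> S - {q}" for p
    proof (cases "f p = 0")
      case False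
      have "eval_poly_fls (f p) x \<noteq> 0" "q (eval_poly_fls (f p) x) = int (degree (f p)) * q x"
        using place_eval_poly[OF qK x neg[OF qS(1)] False] by auto
      then have "q (?t p) = int (degree (f p)) * q x + q (y p)"
        using p y x by (simp add: place_mult[OF qK] eval_poly_fls_in)
      moreover have "int (degree (f q)) * q x \<le> int (degree (f p)) * q x"
        using q(2)[of p] p False neg[OF qS(1)] by (intro mult_right_mono_neg) (auto simp: T_def)
      moreover have "q (y p) > 0" using y(4) p qS by auto
      ultimately show ?thesis unfolding tq(2) by linarith
    qed simp
    have "sum ?t (S - {q}) = 0 \<or> q (sum ?t (S - {q})) \<ge> q (?t q) + 1"
      using tK tp by (intro place_sum_ge[OF qK]) auto
    then have gt: "sum ?t (S - {q}) = 0 \<or> q (sum ?t (S - {q})) > q (?t q)" by linarith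
    have sK: "sum ?t (S - {q}) \<in> K" by (rule sum_in) (use tK in blast)
    have "?t q + sum ?t (S - {q}) \<noteq> 0"
      by (rule place_dominant(1)[OF qK tK[OF qS(1)] sK tq(1) gt])
    also have "?t q + sum ?t (S - {q}) = sum ?t S" by (rule sum.remove[OF S(2) qS(1), symmetric])
    finally show False using rel by (rule notE)
  qed
  show ?thesis
  proof (rule ccontr)
    assume "infinite {p \<in> places K. p x < 0}"
    from infinite_arbitrarily_large[OF this, of "Suc (card M)"]
    obtain S where S: "finite S" "card S = Suc (card M)" "S \<subseteq> {p \<in> places K. p x < 0}"
      by (elim exE conjE)
    show False using bound[OF S(3,1)] S(2) by simp
  qed
next
  case True
  then show ?thesis by (simp only: finite.emptyI)
qed

end

subsection \<open>Compatibility of Cartier data\<close>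

context smooth_polytope
begin

lemma E_in_chart_monoid: "v \<in> V \<Longrightarrow> u \<in> E v \<Longrightarrow> u \<in> chart_monoid P v"
  by (simp add: chart_monoid_iff coord_simps)

lemma chart_monoid_add:
  "v \<in> V \<Longrightarrow> a \<in> chart_monoid P v \<Longrightarrow> b \<in> chart_monoid P v \<Longrightarrow> a + b \<in> chart_monoid P v"
  by (simp add: chart_monoid_iff coord_simps)

lemma zero_in_chart_monoid: "v \<in> V \<Longrightarrow> 0 \<in> chart_monoid P v"
  by (simp add: chart_monoid_iff coord_simps)

lemma overlap_left: "w \<in> V \<Longrightarrow> a \<in> chart_monoid P v \<Longrightarrow> a \<in> overlap_monoid P v w"
  using zero_in_chart_monoid[of w] by (force simp: overlap_monoid_def)

lemma overlap_right: "v \<in> V \<Longrightarrow> b \<in> chart_monoid P w \<Longrightarrow> b \<in> overlap_monoid P v w"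
  using zero_in_chart_monoid[of v] by (force simp: overlap_monoid_def)

lemma vertex_diff_in_chart_monoid: "v \<in> V \<Longrightarrow> w \<in> V \<Longrightarrow> w - v \<in> chart_monoid P v"
  by (simp add: chart_monoid_iff coord_nonneg)

text \<open>The facet passes through \<open>w\<close>, so its functional is nonnegative on the edge
  directions at \<open>w\<close>, which generate the monoid.\<close>

lemma coord_tight_chart_nonneg:
  assumes v: "v \<in> V" and u: "u \<in> E v" and w: "w \<in> V" and tight: "coord v u (w - v) = 0"
    and b: "b \<in> chart_monoid P w"
  shows "coord v u b \<ge> 0"
proof -
  have "0 \<le> (\<Sum>e\<in>E w. coord w e b * coord v u e)"
    using b w coord_edge_nonneg[OF v u w tight]
    by (intro sum_nonneg mult_nonneg_nonneg) (auto simp: chart_monoid_iff)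
  then show ?thesis by (simp only: coord_expand[OF v u w, of b])
qed

text \<open>What orders require of Cartier data. By symmetry in \<open>v\<close> and
  \<open>w\<close> the first clause makes the quotient of two local generators a unit on the
  overlap; by the second it involves no facet through both vertices, so it makes sense on curves
  inside such divisors.\<close>

definition compatible :: "'n cartier \<Rightarrow> bool" where
  "compatible m \<longleftrightarrow> (\<forall>v\<in>V. \<forall>w\<in>V. m v - m w \<in> overlap_monoid P v w \<and>
     (\<forall>u\<in>E v. coord v u (w - v) = 0 \<longrightarrow> coord v u (m v - m w) = 0))"

lemma compatible_ample: "compatible ample_bundle"
  unfolding compatible_def ample_bundle_def
proof (intro ballI conjI impI)
  fix v w assume v: "v \<in> V" and w: "w \<in> V"
  show "v - w \<in> overlap_monoid P v w"
    using overlap_right vertex_diff_in_chart_monoid v w by blast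
  fix u assume "u \<in> E v" "coord v u (w - v) = 0"
  then show "coord v u (v - w) = 0" using v by (simp add: coord_simps)
qed

lemma compatible_can: "compatible can"
  unfolding compatible_def
proof (intro ballI conjI impI)
  fix v w assume v: "v \<in> V" and w: "w \<in> V"
  \<comment> \<open>On facets at \<open>w\<close> that miss \<open>v\<close>, the height of
    \<open>v\<close> is at least 1, so adding \<open>N *s (v - w)\<close> outweighs any negative
    coordinate; the opposite multiple lies in the chart monoid of \<open>v\<close>.\<close>
  define N where "N = 1 + (\<Sum>e\<in>E w. \<bar>coord w e (can v)\<bar>)"
  have N: "N \<ge> 1 + \<bar>coord w e (can v)\<bar>" if e: "e \<in> E w" for e
  proof -
    have "\<bar>coord w e (can v)\<bar> \<le> (\<Sum>e\<in>E w. \<bar>coord w e (can v)\<bar>)"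
      using e finite_E[OF w] by (intro member_le_sum) auto
    then show ?thesis by (simp add: N_def)
  qed
  have N0: "N \<ge> 0" by (simp add: N_def sum_nonneg)
  have "N *s (w - v) \<in> chart_monoid P v"
    unfolding chart_monoid_iff[OF v]
  proof
    fix u assume u: "u \<in> E v"
    show "0 \<le> coord v u (N *s (w - v))"
      unfolding lattice_coord_smult[OF basis[OF v] u]
      by (intro mult_nonneg_nonneg N0 coord_nonneg[OF v u w])
  qed
  moreover have "N *s (v - w) + (can v - can w) \<in> chart_monoid P w"
    unfolding chart_monoid_iff[OF w]
  proof
    fix e assume e: "e \<in> E w"
    have eq: "coord w e (N *s (v - w) + (can v - can w)) = N * coord w e (v - w) + coord w e (can v) - 1"
      using w e by (simp add: lattice_coord_add[OF basis] lattice_coord_smult[OF basis]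
          lattice_coord_diff[OF basis] coord_can algebra_simps)
    show "0 \<le> coord w e (N *s (v - w) + (can v - can w))"
    proof (cases "coord w e (v - w) = 0")
      case True
      then show ?thesis unfolding eq using coord_can_tight[OF w e v] by simp
    next
      case False
      then have "coord w e (v - w) \<ge> 1" using coord_nonneg[OF w e v] by simp
      then have "N * 1 \<le> N * coord w e (v - w)" using N0 by (intro mult_left_mono) auto
      then show ?thesis unfolding eq using N[OF e] by linarith
    qed
  qed
  moreover have "can v - can w = N *s (w - v) + (N *s (v - w) + (can v - can w))"
    by (simp add: vec_eq_iff algebra_simps)
  ultimately show "can v - can w \<in> overlap_monoid P v w"
    unfolding overlap_monoid_def by blast
  fix u assume u: "u \<in> E v" "coord v u (w - v) = 0"
  then show "coord v u (can v - can w) = 0"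
    using v w coord_can coord_can_tight by (simp add: lattice_coord_diff[OF basis])
qed

end

subsection \<open>Orders along a curve\<close>

lemma subfield_curve_field: "subfield_over_complex (curve_field P v \<phi>)"
  unfolding curve_field_def by (rule hull_in) (auto simp: subfield_over_complex_def image_subset_iff)

locale toric_point = smooth_polytope P for P :: "(real ^ 'n) set" +
  fixes v :: "int ^ 'n" and \<phi> :: "int ^ 'n \<Rightarrow> complex fls"
  assumes v: "v \<in> V" and hom: "monoid_hom_on (chart_monoid P v) \<phi>"
begin

abbreviation K where "K \<equiv> curve_field P v \<phi>"

sublocale place_field K
  by unfold_locales (rule subfield_curve_field)

lemma \<phi>_in: "m \<in> chart_monoid P v \<Longrightarrow> \<phi> m \<in> K"
  unfolding curve_field_def by (intro hull_inc imageI)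

lemma \<phi>_E_in: "u \<in> E v \<Longrightarrow> \<phi> u \<in> K"
  by (intro \<phi>_in E_in_chart_monoid v)

lemma \<phi>_add: "a \<in> chart_monoid P v \<Longrightarrow> b \<in> chart_monoid P v \<Longrightarrow> \<phi> (a + b) = \<phi> a * \<phi> b"
  and \<phi>_0: "\<phi> 0 = 1"
  using hom by (simp_all add: monoid_hom_on_def)

lemma \<phi>_multiple:
  assumes u: "u \<in> E v" shows "int k *s u \<in> chart_monoid P v \<and> \<phi> (int k *s u) = \<phi> u ^ k"
proof (induction k)
  case 0
  then show ?case using zero_in_chart_monoid[OF v] \<phi>_0 by simp
next
  case (Suc k)
  have "int (Suc k) *s u = u + int k *s u" by (simp add: vec_eq_iff algebra_simps)
  then show ?case
    using Suc \<phi>_add[OF E_in_chart_monoid[OF v u]] chart_monoid_add[OF v E_in_chart_monoid[OF v u]]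
    by simp
qed

text \<open>The chart monoid is free on the edge directions, so \<open>\<phi>\<close> is given by
  its values there.\<close>

lemma \<phi>_eq_prod:
  assumes m: "m \<in> chart_monoid P v"
  shows "\<phi> m = (\<Prod>u\<in>E v. \<phi> u ^ nat (coord v u m))"
proof -
  have "(\<Sum>u\<in>F. int (nat (coord v u m)) *s u) \<in> chart_monoid P v \<and>
    \<phi> (\<Sum>u\<in>F. int (nat (coord v u m)) *s u) = (\<Prod>u\<in>F. \<phi> u ^ nat (coord v u m))"
    if "finite F" "F \<subseteq> E v" for F
    using that
  proof (induction F rule: finite_induct)
    case empty
    then show ?case using zero_in_chart_monoid[OF v] \<phi>_0 by simp
  next
    case (insert u F)
    then have IH: "(\<Sum>u\<in>F. int (nat (coord v u m)) *s u) \<in> chart_monoid P v"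
      "\<phi> (\<Sum>u\<in>F. int (nat (coord v u m)) *s u) = (\<Prod>u\<in>F. \<phi> u ^ nat (coord v u m))" by auto
    have u: "u \<in> E v" using insert.prems by simp
    note mu = \<phi>_multiple[OF u, of "nat (coord v u m)"]
    show ?case
      unfolding sum.insert[OF insert.hyps] prod.insert[OF insert.hyps]
    proof
      show "int (nat (coord v u m)) *s u + (\<Sum>u\<in>F. int (nat (coord v u m)) *s u) \<in> chart_monoid P v"
        by (rule chart_monoid_add[OF v conjunct1[OF mu] IH(1)])
      show "\<phi> (int (nat (coord v u m)) *s u + (\<Sum>u\<in>F. int (nat (coord v u m)) *s u))
          = \<phi> u ^ nat (coord v u m) * (\<Prod>u\<in>F. \<phi> u ^ nat (coord v u m))"
        unfolding \<phi>_add[OF conjunct1[OF mu] IH(1)] conjunct2[OF mu] IH(2) ..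
    qed
  qed
  from this[OF finite_E[OF v] subset_refl]
  have "\<phi> (\<Sum>u\<in>E v. int (nat (coord v u m)) *s u) = (\<Prod>u\<in>E v. \<phi> u ^ nat (coord v u m))" by blast
  moreover have "(\<Sum>u\<in>E v. int (nat (coord v u m)) *s u) = (\<Sum>u\<in>E v. coord v u m *s u)"
    using m v by (intro sum.cong) (auto simp: chart_monoid_iff)
  ultimately show ?thesis by (simp only: lattice_coord_sum[OF basis[OF v]])
qed

text \<open>\<open>\<phi> u = 0\<close> means that the curve lies in the invariant divisor of the
  facet of \<open>u\<close>. The exponents selected are the characters of the torus orbit containing
  its generic point.\<close>

definition supported :: "int ^ 'n \<Rightarrow> bool" where
  "supported m \<longleftrightarrow> (\<forall>u\<in>E v. \<phi> u = 0 \<longrightarrow> coord v u m = 0)"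

text \<open>The additive extension of the order of \<open>\<phi> m\<close> to exponents outside the
  chart monoid. Directions with \<open>\<phi> u = 0\<close> contribute 0 by the convention for
  places at 0, so the value is an order only for supported exponents.\<close>

definition ord_at :: "(complex fls \<Rightarrow> int) \<Rightarrow> int ^ 'n \<Rightarrow> int" where
  "ord_at p m = (\<Sum>u\<in>E v. coord v u m * p (\<phi> u))"

lemma \<phi>_nonzero_iff:
  assumes "m \<in> chart_monoid P v" shows "\<phi> m \<noteq> 0 \<longleftrightarrow> supported m"
proof -
  have "\<phi> m \<noteq> 0 \<longleftrightarrow> (\<forall>u\<in>E v. \<phi> u = 0 \<longrightarrow> nat (coord v u m) = 0)"
    unfolding \<phi>_eq_prod[OF assms] using finite_E[OF v] by auto
  also have "\<dots> \<longleftrightarrow> supported m"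
    using assms v by (force simp: supported_def chart_monoid_iff)
  finally show ?thesis .
qed

lemma supported_add: "supported a \<Longrightarrow> supported b \<Longrightarrow> supported (a + b)"
  and supported_diff: "supported a \<Longrightarrow> supported b \<Longrightarrow> supported (a - b)"
  using v by (simp_all add: supported_def coord_simps)

lemma ord_at_add: "ord_at p (a + b) = ord_at p a + ord_at p b"
  and ord_at_diff: "ord_at p (a - b) = ord_at p a - ord_at p b"
  and ord_at_smult: "ord_at p (k *s a) = k * ord_at p a"
  using v by (simp_all add: ord_at_def coord_simps sum.distrib sum_subtractf algebra_simps sum_distrib_left)

lemma ord_at_0: "ord_at p 0 = 0"
  using ord_at_smult[of p 0 0] by simp

lemma ord_at_sum: "ord_at p (\<Sum>i\<in>I. f i) = (\<Sum>i\<in>I. ord_at p (f i))"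
proof (induction I rule: infinite_finite_induct)
  case (insert i I)
  then show ?case by (simp add: ord_at_add)
qed (simp_all add: ord_at_0)

lemma ord_at_expand:
  assumes w: "w \<in> V" shows "ord_at p m = (\<Sum>e\<in>E w. coord w e m * ord_at p e)"
proof -
  have "ord_at p m = ord_at p (\<Sum>e\<in>E w. coord w e m *s e)"
    by (simp only: lattice_coord_sum[OF basis[OF w]])
  then show ?thesis by (simp only: ord_at_sum ord_at_smult)
qed

lemma place_\<phi>:
  assumes p: "p \<in> places K" and m: "m \<in> chart_monoid P v" "supported m"
  shows "p (\<phi> m) = ord_at p m"
proof -
  have nz: "\<phi> u \<noteq> 0" if "u \<in> E v" "nat (coord v u m) \<noteq> 0" for u
    using that m(2) by (auto simp: supported_def)
  have "p (\<phi> m) = (\<Sum>u\<in>E v. p (\<phi> u ^ nat (coord v u m)))"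
    unfolding \<phi>_eq_prod[OF m(1)] using nz
    by (intro place_prod[OF p] conjI power_in \<phi>_E_in) auto
  also have "\<dots> = (\<Sum>u\<in>E v. coord v u m * p (\<phi> u))"
  proof (intro sum.cong refl)
    fix u assume u: "u \<in> E v"
    have c: "coord v u m \<ge> 0" using m(1) u v by (simp add: chart_monoid_iff)
    show "p (\<phi> u ^ nat (coord v u m)) = coord v u m * p (\<phi> u)"
    proof (cases "\<phi> u = 0")
      case True
      then have "coord v u m = 0" using m(2) u by (simp add: supported_def)
      then show ?thesis by (simp add: place_one[OF p])
    next
      case False
      then show ?thesis using c by (simp add: place_power[OF p \<phi>_E_in[OF u]])
    qed
  qed
  finally show ?thesis by (simp add: ord_at_def)
qed

text \<open>Along the vanishing directions both summands have nonnegative coordinates, and these add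
  up to 0.\<close>

lemma supported_split:
  assumes w: "w \<in> V" "supported (w - v)" and w': "w' \<in> V" "supported (w' - v)"
    and a: "a \<in> chart_monoid P w" and b: "b \<in> chart_monoid P w'" and ab: "supported (a + b)"
  shows "supported a" "supported b"
proof -
  have "coord v u a = 0 \<and> coord v u b = 0" if u: "u \<in> E v" "\<phi> u = 0" for u
  proof -
    have "coord v u a \<ge> 0" "coord v u b \<ge> 0"
      using w w' u a b coord_tight_chart_nonneg[OF v u(1)] by (auto simp: supported_def)
    moreover have "coord v u a + coord v u b = 0"
      using ab u v by (simp add: supported_def lattice_coord_add[OF basis])
    ultimately show ?thesis by simp
  qed
  then show "supported a" "supported b" by (auto simp: supported_def)
qed

lemma supported_0: "supported 0"
  using v by (simp add: supported_def coord_simps)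

text \<open>\<open>\<theta> (w - v)\<close> is a unit with inverse \<open>\<theta> (v - w)\<close>,
  hence nonzero.\<close>

lemma centered_supported:
  assumes c: "centered_in P v \<phi> p w \<theta>" shows "w \<in> V" "supported (w - v)"
proof -
  show w: "w \<in> V" using c by (simp add: centered_in_def)
  let ?O = "overlap_monoid P v w"
  have a: "w - v \<in> chart_monoid P v" "v - w \<in> chart_monoid P w"
    using vertex_diff_in_chart_monoid v w by auto
  have "\<theta> ((w - v) + (v - w)) = \<theta> (w - v) * \<theta> (v - w)" "\<theta> 0 = 1"
    using c overlap_left[OF w a(1)] overlap_right[OF v a(2)] by (simp_all only: centered_in_def monoid_hom_on_def)
  then have "\<theta> (w - v) \<noteq> 0" by auto
  then show "supported (w - v)"
    using c a(1) by (simp add: centered_in_def \<phi>_nonzero_iff[symmetric])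
qed

text \<open>Adding its negative part \<open>neg\<close> moves \<open>m\<close> into the chart monoid
  of \<open>v\<close> and keeps it supported, so \<open>\<theta> m\<close> is a quotient of two
  nonzero values of \<open>\<phi>\<close>.\<close>

lemma centered_value:
  assumes p: "p \<in> places K" and c: "centered_in P v \<phi> p w \<theta>"
    and m: "m \<in> overlap_monoid P v w" "supported m"
  shows "\<theta> m \<noteq> 0" "p (\<theta> m) = ord_at p m"
proof -
  have w: "w \<in> V" by (rule centered_supported[OF c])
  define neg where "neg = (\<Sum>u\<in>E v. max 0 (- coord v u m) *s u)"
  have cn: "coord v u neg = max 0 (- coord v u m)" if "u \<in> E v" for u
    unfolding neg_def using that by (rule lattice_coord_unique[OF basis[OF v] refl])
  have n: "neg \<in> chart_monoid P v" "supported neg"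
    using m v by (auto simp: chart_monoid_iff cn supported_def)
  have mn: "m + neg \<in> chart_monoid P v" "supported (m + neg)"
    using m n v by (auto simp: chart_monoid_iff cn lattice_coord_add[OF basis] supported_add)
  have "\<theta> (m + neg) = \<theta> m * \<theta> neg"
    using c m(1) overlap_left[OF w n(1)] by (simp add: centered_in_def monoid_hom_on_def)
  then have eq: "\<phi> (m + neg) = \<theta> m * \<phi> neg"
    using c n(1) mn(1) by (simp add: centered_in_def)
  have nz: "\<phi> (m + neg) \<noteq> 0" "\<phi> neg \<noteq> 0" using n mn \<phi>_nonzero_iff by auto
  then show "\<theta> m \<noteq> 0" using eq by auto
  have "\<theta> m = \<phi> (m + neg) / \<phi> neg" using eq nz by simp
  then have "p (\<theta> m) = p (\<phi> (m + neg)) - p (\<phi> neg)"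
    using nz n mn by (simp add: place_divide[OF p] \<phi>_in)
  also have "\<dots> = ord_at p m"
    using n mn by (simp add: place_\<phi>[OF p] ord_at_add)
  finally show "p (\<theta> m) = ord_at p m" .
qed

lemma centered_ord_nonneg:
  assumes p: "p \<in> places K" and c: "centered_in P v \<phi> p w \<theta>"
    and b: "b \<in> chart_monoid P w" "supported b"
  shows "ord_at p b \<ge> 0"
  using centered_value[OF p c overlap_right[OF v b(1)] b(2)] c b(1) by (auto simp: centered_in_def)

lemma compatible_supported:
  assumes "compatible m" "w \<in> V" "supported (w - v)" shows "supported (m v - m w)"
  using assms v by (simp add: supported_def compatible_def)

text \<open>The choice of chart does not matter: for two charts containing the center, the
  difference of the local exponents is a sum of one exponent regular on each, both of nonnegative
  order; exchanging the charts gives equality. This justifies the \<open>THE\<close>.\<close>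

lemma section_order_eq:
  assumes p: "p \<in> places K" and m: "compatible m" and c: "centered_in P v \<phi> p w \<theta>"
  shows "section_order P m v \<phi> p = ord_at p (m v - m w)"
proof -
  have val: "p (\<theta> (m v - m w)) = ord_at p (m v - m w)" if c: "centered_in P v \<phi> p w \<theta>" for w \<theta>
    using centered_supported[OF c] compatible_supported[OF m] m v
    by (intro centered_value[OF p c]) (auto simp: compatible_def)
  have le: "ord_at p (m v - m w') \<ge> ord_at p (m v - m w)"
    if c: "centered_in P v \<phi> p w \<theta>" and c': "centered_in P v \<phi> p w' \<theta>'" for w \<theta> w' \<theta>'
  proof -
    note s = centered_supported[OF c] and s' = centered_supported[OF c']
    have "m w - m w' \<in> overlap_monoid P w w'" using m s s' by (simp add: compatible_def)
    then obtain a b where ab: "m w - m w' = a + b" "a \<in> chart_monoid P w" "b \<in> chart_monoid P w'"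
      by (auto simp: overlap_monoid_def)
    have "supported ((m v - m w') - (m v - m w))"
      using compatible_supported[OF m s] compatible_supported[OF m s'] by (rule supported_diff[rotated])
    then have sab: "supported (a + b)" by (simp add: ab(1)[symmetric])
    have "supported a" "supported b" by (rule supported_split[OF s s' ab(2,3) sab])+
    then have "0 \<le> ord_at p (m w - m w')"
      unfolding ab(1) ord_at_add
      using centered_ord_nonneg[OF p c ab(2)] centered_ord_nonneg[OF p c' ab(3)] by simp
    then show ?thesis by (simp add: ord_at_diff)
  qed
  show ?thesis
    unfolding section_order_def
  proof (rule the_equality)
    show "\<exists>w' \<theta>. centered_in P v \<phi> p w' \<theta> \<and> ord_at p (m v - m w) = p (\<theta> (m v - m w'))"
      by (intro exI[of _ w] exI[of _ \<theta>] conjI c val[OF c, symmetric])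
    fix k assume "\<exists>w \<theta>. centered_in P v \<phi> p w \<theta> \<and> k = p (\<theta> (m v - m w))"
    then obtain w' \<theta>' where c': "centered_in P v \<phi> p w' \<theta>'" and k: "k = p (\<theta>' (m v - m w'))" by blast
    show "k = ord_at p (m v - m w)"
      unfolding k val[OF c'] using le[OF c c'] le[OF c' c] by simp
  qed
qed

text \<open>
  The valuative criterion of properness: the center lies in the chart of a vertex at which the
  order is minimal, among the vertices of the face spanned by the curve.
\<close>

lemma centered_at_minimum:
  assumes p: "p \<in> places K" and w: "w \<in> V" "supported (w - v)"
    and min: "\<And>w'. w' \<in> V \<Longrightarrow> supported (w' - v) \<Longrightarrow> ord_at p (w - v) \<le> ord_at p (w' - v)"
  shows "\<exists>\<theta>. centered_in P v \<phi> p w \<theta>"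
proof -
  \<comment> \<open>Characters of the orbit become Laurent monomials in the nonzero coordinates; all
    other exponents are sent to 0.\<close>
  define \<theta> where "\<theta> m = (if supported m then (\<Prod>u | u \<in> E v \<and> \<phi> u \<noteq> 0. \<phi> u powi coord v u m) else 0)" for m
  have \<theta>\<phi>: "\<theta> a = \<phi> a" if a: "a \<in> chart_monoid P v" for a
  proof (cases "supported a")
    case True
    have "\<phi> a = (\<Prod>u\<in>E v. \<phi> u ^ nat (coord v u a))" by (rule \<phi>_eq_prod[OF a])
    also have "\<dots> = (\<Prod>u | u \<in> E v \<and> \<phi> u \<noteq> 0. \<phi> u powi coord v u a)"
    proof (rule prod.mono_neutral_cong_right)
      show "\<forall>u\<in>E v - {u \<in> E v. \<phi> u \<noteq> 0}. \<phi> u ^ nat (coord v u a) = 1"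
        using True by (auto simp: supported_def)
      show "\<phi> u ^ nat (coord v u a) = \<phi> u powi coord v u a" if "u \<in> {u \<in> E v. \<phi> u \<noteq> 0}" for u
        using a v that by (auto simp: chart_monoid_iff power_int_def)
    qed (use finite_E[OF v] in auto)
    finally show ?thesis using True by (simp add: \<theta>_def)
  next
    case False
    then show ?thesis using \<phi>_nonzero_iff[OF a] by (simp add: \<theta>_def)
  qed
  have hom: "\<theta> (a + b) = \<theta> a * \<theta> b" if ab: "a \<in> overlap_monoid P v w" "b \<in> overlap_monoid P v w" for a b
  proof (cases "supported a \<and> supported b")
    case True
    then show ?thesis
      using v by (simp add: \<theta>_def supported_add lattice_coord_add[OF basis] power_int_add prod.distrib)
  next
    case False
    have nonneg: "coord v u a \<ge> 0" if a: "a \<in> overlap_monoid P v w" and u: "u \<in> E v" "\<phi> u = 0" for a u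
    proof -
      obtain x y where xy: "a = x + y" "x \<in> chart_monoid P v" "y \<in> chart_monoid P w"
        using a by (auto simp: overlap_monoid_def)
      have "coord v u (w - v) = 0" using w u by (simp add: supported_def)
      from coord_tight_chart_nonneg[OF v u(1) w(1) this xy(3)] show ?thesis
        using xy(2) u v unfolding xy(1) by (simp add: chart_monoid_iff lattice_coord_add[OF basis])
    qed
    \<comment> \<open>On the overlap the coordinates along vanishing directions are nonnegative, so
      a nonzero one cannot cancel in the sum.\<close>
    have "\<not> supported (a + b)"
    proof
      assume s: "supported (a + b)"
      have "coord v u a = 0 \<and> coord v u b = 0" if u: "u \<in> E v" "\<phi> u = 0" for u
      proof -
        have "coord v u a + coord v u b = 0"
          using s u v by (simp add: supported_def lattice_coord_add[OF basis])
        then show ?thesis using nonneg[OF ab(1) u] nonneg[OF ab(2) u] by simp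
      qed
      then show False using False by (auto simp: supported_def)
    qed
    then show ?thesis using False by (auto simp: \<theta>_def)
  qed
  have pos: "p (\<theta> b) \<ge> 0" if b: "b \<in> chart_monoid P w" and nz: "\<theta> b \<noteq> 0" for b
  proof -
    have s: "supported b" using nz by (auto simp: \<theta>_def split: if_splits)
    have "\<theta> b = (\<Prod>u | u \<in> E v \<and> \<phi> u \<noteq> 0. \<phi> u powi coord v u b)" using s by (simp add: \<theta>_def)
    also have "p \<dots> = (\<Sum>u | u \<in> E v \<and> \<phi> u \<noteq> 0. p (\<phi> u powi coord v u b))"
      by (rule place_prod[OF p]) (auto intro: power_int_in \<phi>_E_in)
    also have "\<dots> = (\<Sum>u | u \<in> E v \<and> \<phi> u \<noteq> 0. coord v u b * p (\<phi> u))"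
      by (intro sum.cong) (auto simp: place_power_int[OF p] \<phi>_E_in)
    also have "\<dots> = ord_at p b"
      unfolding ord_at_def using finite_E[OF v]
      by (intro sum.mono_neutral_left) (auto simp: place_zero[OF p])
    also have "\<dots> = (\<Sum>e\<in>E w. coord w e b * ord_at p e)" by (rule ord_at_expand[OF w(1)])
    also have "\<dots> \<ge> 0"
    proof (rule sum_nonneg)
      fix e assume e: "e \<in> E w"
      have cb: "coord w e' b \<ge> 0" if "e' \<in> E w" for e' using b w that by (simp add: chart_monoid_iff)
      show "0 \<le> coord w e b * ord_at p e"
      proof (cases "coord w e b = 0")
        case False
        \<comment> \<open>An edge that occurs in the supported exponent \<open>b\<close> is itself
          supported, so its far end competes for the minimum and \<open>e\<close> has nonnegative
          order.\<close>
        have se: "supported e"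
          unfolding supported_def
        proof (intro ballI impI)
          fix u assume u: "u \<in> E v" "\<phi> u = 0"
          have tight: "coord v u (w - v) = 0" using w u by (simp add: supported_def)
          have "(\<Sum>e\<in>E w. coord w e b * coord v u e) = coord v u b"
            by (rule coord_expand[OF v u(1) w(1), symmetric])
          also have "\<dots> = 0" using s u by (simp add: supported_def)
          finally have "coord w e b * coord v u e = 0"
            by (rule sum_nonneg_0[OF finite_E[OF w(1)] _ _ e, rotated])
               (intro mult_nonneg_nonneg cb coord_edge_nonneg[OF v u(1) w(1) tight])
          then show "coord v u e = 0" using False by simp
        qed
        let ?w = "neighbour w e"
        have diff: "?w - v = (w - v) + edge_len w e *s e" by (simp add: neighbour_def)
        have "supported (edge_len w e *s e)"
          using se v by (simp add: supported_def lattice_coord_smult[OF basis])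
        then have "supported (?w - v)" unfolding diff by (rule supported_add[OF w(2)])
        then have "ord_at p (w - v) \<le> ord_at p (?w - v)" by (rule min[OF neighbour_in_V[OF w(1) e]])
        then have "0 \<le> edge_len w e * ord_at p e" unfolding diff ord_at_add ord_at_smult by simp
        then have "0 \<le> ord_at p e" using edge_len_pos[OF w(1) e] by (simp add: zero_le_mult_iff)
        then show ?thesis using cb[OF e] by simp
      qed simp
    qed
    finally show ?thesis .
  qed
  have "\<theta> 0 = 1" using \<theta>\<phi>[OF zero_in_chart_monoid[OF v]] \<phi>_0 by simp
  then show ?thesis
    unfolding centered_in_def monoid_hom_on_def using w(1) hom \<theta>\<phi> pos by blast
qed

lemma centered_exists:
  assumes p: "p \<in> places K" obtains w \<theta> where "centered_in P v \<phi> p w \<theta>"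
proof -
  let ?W = "{w \<in> V. supported (w - v)}"
  have W: "finite ?W" "?W \<noteq> {}" using finite_V v supported_0 by auto
  have "Min ((\<lambda>w. ord_at p (w - v)) ` ?W) \<in> (\<lambda>w. ord_at p (w - v)) ` ?W" using W by (intro Min_in) auto
  then obtain w where w: "w \<in> V" "supported (w - v)" "ord_at p (w - v) = Min ((\<lambda>w. ord_at p (w - v)) ` ?W)"
    by auto
  have "\<exists>\<theta>. centered_in P v \<phi> p w \<theta>"
  proof (rule centered_at_minimum[OF p w(1,2)])
    fix w' assume "w' \<in> V" "supported (w' - v)"
    then show "ord_at p (w - v) \<le> ord_at p (w' - v)" unfolding w(3) using W by (intro Min_le) auto
  qed
  then show thesis using that by blast
qed

text \<open>If all coordinates of the chart of \<open>v\<close> are regular at \<open>p\<close>,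
  then \<open>v\<close> minimizes the order, and the section is measured against itself.\<close>

lemma section_order_0:
  assumes p: "p \<in> places K" and m: "compatible m" and reg: "\<And>u. u \<in> E v \<Longrightarrow> p (\<phi> u) \<ge> 0"
  shows "section_order P m v \<phi> p = 0"
proof -
  have "\<exists>\<theta>. centered_in P v \<phi> p v \<theta>"
  proof (rule centered_at_minimum[OF p v])
    show "supported (v - v)" by (simp add: supported_0)
    fix w' assume "w' \<in> V"
    then have "0 \<le> ord_at p (w' - v)"
      unfolding ord_at_def using reg coord_nonneg[OF v] by (intro sum_nonneg mult_nonneg_nonneg) auto
    then show "ord_at p (v - v) \<le> ord_at p (w' - v)" by (simp add: ord_at_diff ord_at_0)
  qed
  then obtain \<theta> where "centered_in P v \<phi> p v \<theta>" by blast
  from section_order_eq[OF p m this] show ?thesis by (simp add: ord_at_0)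
qed

text \<open>At a vertex \<open>w\<close> whose chart contains the center, nefness makes the
  coordinates of \<open>t (v - w) + can v - can w\<close> nonnegative; each edge that occurs with
  nonzero coordinate is supported and regular at \<open>p\<close>.\<close>

lemma nef_order_nonneg:
  assumes p: "p \<in> places K" and nef: "edge_nef t"
  shows "t * section_order P ample_bundle v \<phi> p + section_order P can v \<phi> p \<ge> 0"
proof -
  obtain w \<theta> where c: "centered_in P v \<phi> p w \<theta>" by (rule centered_exists[OF p])
  note w = centered_supported[OF c]
  define x where "x e = t * coord w e (v - w) + coord w e (can v - can w)" for e
  have x: "x e \<ge> 0" if e: "e \<in> E w" for e
    using edge_nef_global[OF nef w(1) e v] w(1) e
    by (simp add: x_def lattice_coord_diff[OF basis] coord_can)
  \<comment> \<open>Since \<open>t\<close> is real, the exponent is not a lattice vector; it is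
    handled through its coordinates \<open>x e\<close>.\<close>
  have expand: "t * f (v - w) + f (can v - can w) = (\<Sum>e\<in>E w. x e * f e)"
    if "\<And>m. f m = (\<Sum>e\<in>E w. coord w e m * f e)" for f :: "int ^ 'n \<Rightarrow> int"
  proof -
    have r: "real_of_int (f m) = (\<Sum>e\<in>E w. coord w e m * real_of_int (f e))" for m
      by (subst that) simp
    show ?thesis
      unfolding r[of "v - w"] r[of "can v - can w"]
      by (simp add: x_def sum_distrib_left sum.distrib algebra_simps)
  qed
  have "t * section_order P ample_bundle v \<phi> p + section_order P can v \<phi> p
      = t * ord_at p (v - w) + ord_at p (can v - can w)"
    using section_order_eq[OF p compatible_ample c] section_order_eq[OF p compatible_can c]
    by (simp add: ample_bundle_def)
  also have "\<dots> = (\<Sum>e\<in>E w. x e * ord_at p e)"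
    by (rule expand) (rule ord_at_expand[OF w(1)])
  also have "\<dots> \<ge> 0"
  proof (rule sum_nonneg)
    fix e assume e: "e \<in> E w"
    show "0 \<le> x e * real_of_int (ord_at p e)"
    proof (cases "x e = 0")
      case False
      have "supported e"
        unfolding supported_def
      proof (intro ballI impI)
        fix u assume u: "u \<in> E v" "\<phi> u = 0"
        have tight: "coord v u (w - v) = 0" using w u by (simp add: supported_def)
        have tight2: "coord v u (v - w) = 0" "coord v u (can v - can w) = 0"
          using compatible_supported[OF compatible_ample w] compatible_supported[OF compatible_can w] u
          by (simp_all add: supported_def ample_bundle_def)
        have "(\<Sum>e\<in>E w. x e * coord v u e) = t * coord v u (v - w) + coord v u (can v - can w)"
          by (rule expand[symmetric]) (rule coord_expand[OF v u(1) w(1)])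
        also have "\<dots> = 0" by (simp add: tight2)
        finally have "x e * coord v u e = 0"
          by (rule sum_nonneg_0[OF finite_E[OF w(1)] _ _ e, rotated])
             (use x coord_edge_nonneg[OF v u(1) w(1) tight] in auto)
        then show "coord v u e = 0" using False by simp
      qed
      then have "ord_at p e \<ge> 0"
        by (rule centered_ord_nonneg[OF p c E_in_chart_monoid[OF w(1) e]])
      then show ?thesis using x[OF e] by simp
    qed simp
  qed
  finally show ?thesis .
qed

text \<open>The fractions form a subfield containing all values of \<open>\<phi>\<close>, and the
  hull is the smallest such subfield.\<close>

lemma curve_field_fractions:
  assumes "z \<in> K"
  shows "\<exists>g\<in>generated_ring (\<phi> ` E v). \<exists>h\<in>generated_ring (\<phi> ` E v). h \<noteq> 0 \<and> z = g / h"
proof -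
  let ?R = "generated_ring (\<phi> ` E v)"
  let ?Q = "{z. \<exists>g\<in>?R. \<exists>h\<in>?R. h \<noteq> 0 \<and> z = g / h}"
  have one: "1 \<in> ?R" using generated_ring.const[of 1] by simp
  have QI: "g / h \<in> ?Q" if "g \<in> ?R" "h \<in> ?R" "h \<noteq> 0" for g h using that by blast
  have sub: "r \<in> ?Q" if "r \<in> ?R" for r using QI[OF that one] by simp
  have neg: "- r \<in> ?R" if "r \<in> ?R" for r
    using generated_ring_mult[OF generated_ring.const[of "-1"] that] by simp
  have "subfield_over_complex ?Q"
    unfolding subfield_over_complex_def
  proof (intro conjI ballI)
    show "range fls_const \<subseteq> ?Q" by (rule image_subsetI) (rule sub, rule generated_ring.const)
    fix x assume "x \<in> ?Q"
    then obtain g h where gh: "g \<in> ?R" "h \<in> ?R" "h \<noteq> 0" "x = g / h" by blast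
    have "- x = (- g) / h" unfolding gh(4) by simp
    also have "\<dots> \<in> ?Q" by (rule QI[OF neg[OF gh(1)] gh(2,3)])
    finally show "- x \<in> ?Q" .
    show "inverse x \<in> ?Q"
    proof (cases "g = 0")
      case True
      then have "inverse x = 0" unfolding gh(4) by simp
      moreover have "fls_const 0 \<in> ?Q" by (rule sub[OF generated_ring.const])
      ultimately show ?thesis by (simp only: fls_const_0)
    next
      case False
      have "inverse x = h / g" unfolding gh(4) by simp
      also have "\<dots> \<in> ?Q" by (rule QI[OF gh(2,1) False])
      finally show ?thesis .
    qed
    fix y assume "y \<in> ?Q"
    then obtain g' h' where gh': "g' \<in> ?R" "h' \<in> ?R" "h' \<noteq> 0" "y = g' / h'" by blast
    have hh: "h * h' \<in> ?R" "h * h' \<noteq> 0" using gh(3) gh'(3) by (auto intro: generated_ring_mult[OF gh(2) gh'(2)])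
    have "x + y = (g * h' + g' * h) / (h * h')"
      unfolding gh(4) gh'(4) using gh(3) gh'(3) by (rule add_frac_eq)
    also have "\<dots> \<in> ?Q"
      by (rule QI[OF generated_ring.add[OF generated_ring_mult[OF gh(1) gh'(2)] generated_ring_mult[OF gh'(1) gh(2)]] hh])
    finally show "x + y \<in> ?Q" .
    have "x * y = (g * g') / (h * h')" unfolding gh(4) gh'(4) by simp
    also have "\<dots> \<in> ?Q" by (rule QI[OF generated_ring_mult[OF gh(1) gh'(1)] hh])
    finally show "x * y \<in> ?Q" .
  qed
  moreover have "\<phi> ` chart_monoid P v \<subseteq> ?Q"
  proof
    fix y assume "y \<in> \<phi> ` chart_monoid P v"
    then obtain m where m: "m \<in> chart_monoid P v" "y = \<phi> m" by blast
    have pow: "\<phi> u ^ k \<in> ?R" if "u \<in> E v" for u k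
      using that one by (induction k) (auto intro: generated_ring.mult)
    have "y \<in> ?R" unfolding m(2) \<phi>_eq_prod[OF m(1)] by (intro generated_ring_prod pow)
    then show "y \<in> ?Q" by (rule sub)
  qed
  ultimately have "K \<subseteq> ?Q" unfolding curve_field_def by (rule hull_minimal[rotated])
  from subsetD[OF this assms] show ?thesis by (rule CollectD)
qed

lemma adjoint_degree_nonneg:
  assumes trdeg: "trdeg_one K" and nef: "edge_nef t"
  shows "t * of_int (curve_degree P ample_bundle v \<phi>) + of_int (curve_degree P can v \<phi>) \<ge> 0"
proof -
  \<comment> \<open>Outside the poles of the coordinates every section order is 0, so this one
    finite set serves both degrees.\<close>
  define A where "A = (\<Union>u\<in>E v. {p \<in> places K. p (\<phi> u) < 0})"
  have A: "finite A"
    unfolding A_def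
  proof (intro finite_UN_I finite_E[OF v] finite_poles[where Y = "\<phi> ` E v"])
    show "finite (\<phi> ` E v)" using finite_E[OF v] by simp
    show "\<phi> ` E v \<subseteq> K" using \<phi>_E_in by blast
  qed (use trdeg \<phi>_E_in curve_field_fractions in \<open>auto simp: trdeg_one_def\<close>)
  have deg: "curve_degree P m v \<phi> = (\<Sum>p\<in>A. section_order P m v \<phi> p)" if m: "compatible m" for m
    unfolding curve_degree_def
  proof (rule sum.mono_neutral_left[OF A])
    show "{p \<in> places K. section_order P m v \<phi> p \<noteq> 0} \<subseteq> A"
    proof
      fix p assume p: "p \<in> {p \<in> places K. section_order P m v \<phi> p \<noteq> 0}"
      show "p \<in> A"
      proof (rule ccontr)
        assume "p \<notin> A"
        then have "p (\<phi> u) \<ge> 0" if "u \<in> E v" for u using p that by (auto simp: A_def not_less)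
        then have "section_order P m v \<phi> p = 0" using p by (intro section_order_0 m) auto
        then show False using p by simp
      qed
    qed
    show "\<forall>p\<in>A - {p \<in> places K. section_order P m v \<phi> p \<noteq> 0}. section_order P m v \<phi> p = 0"
      by (auto simp: A_def)
  qed
  have "0 \<le> (\<Sum>p\<in>A. t * section_order P ample_bundle v \<phi> p + section_order P can v \<phi> p)"
    using nef_order_nonneg[OF _ nef] by (intro sum_nonneg) (auto simp: A_def)
  then show ?thesis
    by (simp add: deg[OF compatible_ample] deg[OF compatible_can] sum.distrib sum_distrib_left)
qed

end

lemma (in smooth_polytope) edge_nef_imp_adjoint_nef:
  assumes "edge_nef t" shows "adjoint_nef P t"
  unfolding adjoint_nef_def
proof (intro allI impI)
  fix v \<phi> assume c: "curve P v \<phi>"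
  interpret toric_point P v \<phi> by unfold_locales (use c in \<open>simp_all add: curve_def\<close>)
  show "0 \<le> t * of_int (curve_degree P ample_bundle v \<phi>) + of_int (curve_degree P can v \<phi>)"
    using c by (intro adjoint_degree_nonneg assms) (simp add: curve_def)
qed

subsection \<open>The curve of an edge\<close>

lemma eval_poly_fls_monom: "eval_poly_fls (monom c k) x = fls_const c * x ^ k"
  by (simp add: eval_poly_fls_def map_poly_monom poly_monom)

text \<open>
  After clearing denominators, the number of monomials in the two functions exceeds the dimension of
  the space of polynomials of that degree.
\<close>

lemma alg_dependent_rational:
  fixes g h g' h' :: "complex poly"
  assumes nz: "eval_poly_fls h x \<noteq> 0" "eval_poly_fls h' x \<noteq> 0"
  shows "alg_dependent (eval_poly_fls g x / eval_poly_fls h x) (eval_poly_fls g' x / eval_poly_fls h' x)"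
    (is "alg_dependent ?a ?b")
proof -
  define s where "s = Suc (degree g + degree h + degree g' + degree h')"
  have s0: "s > 0" by (simp add: s_def)
  define D where "D = 2 * s"
  \<comment> \<open>The numerators of the monomials in the two functions over the common denominator
    \<open>(h h') ^ D\<close>.\<close>
  define q where "q ij = g ^ fst ij * h ^ (D - fst ij) * (g' ^ snd ij * h' ^ (D - snd ij))" for ij
  let ?C = "{..D} \<times> {..D}"
  have deg: "degree (q ij) \<le> 2 * D * s" if ij: "ij \<in> ?C" for ij
  proof -
    have pw: "degree (f ^ k) \<le> k * s" if "degree f \<le> s" for f :: "complex poly" and k
      using order_trans[OF degree_power_le[of f k] mult_le_mono1[OF that, of k]] by (simp add: mult.commute)
    have le: "degree g \<le> s" "degree h \<le> s" "degree g' \<le> s" "degree h' \<le> s" by (simp_all add: s_def)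
    have "degree (q ij) \<le> (fst ij * s + (D - fst ij) * s) + (snd ij * s + (D - snd ij) * s)"
      unfolding q_def
      by (intro order_trans[OF degree_mult_le] add_mono pw le)
    also have "\<dots> = (fst ij + (D - fst ij)) * s + (snd ij + (D - snd ij)) * s"
      by (simp only: add_mult_distrib)
    also have "\<dots> = 2 * D * s" using ij by auto
    finally show ?thesis .
  qed
  have "card {..2 * D * s} < card ?C" using s0 by (simp add: D_def card_cartesian_product)
  then obtain c where c: "\<exists>ij\<in>?C. c ij \<noteq> 0" "\<forall>r\<in>{..2 * D * s}. (\<Sum>ij\<in>?C. coeff (q ij) r * c ij) = 0"
    using homogeneous_system_nontrivial[of "{..2 * D * s}" ?C "\<lambda>r ij. coeff (q ij) r"] by auto
  have rel: "(\<Sum>ij\<in>?C. smult (c ij) (q ij)) = 0"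
  proof (rule poly_eqI)
    fix r
    show "coeff (\<Sum>ij\<in>?C. smult (c ij) (q ij)) r = coeff 0 r"
    proof (cases "r \<le> 2 * D * s")
      case True
      then show ?thesis using c(2) by (simp add: coeff_sum mult.commute)
    next
      case False
      then have "coeff (q ij) r = 0" if "ij \<in> ?C" for ij using deg[OF that] by (intro coeff_eq_0) auto
      then show ?thesis by (simp add: coeff_sum)
    qed
  qed
  define F where "F = (\<Sum>j\<le>D. monom (\<Sum>i\<le>D. monom (c (i, j)) i) j)"
  have coF: "coeff F j = (if j \<le> D then (\<Sum>i\<le>D. monom (c (i, j)) i) else 0)" for j
    by (simp add: F_def coeff_sum coeff_monom)
  have coF2: "coeff (coeff F j) i = c (i, j)" if "i \<le> D" "j \<le> D" for i j
    using that by (simp add: coF coeff_sum coeff_monom)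
  have "F \<noteq> 0"
  proof
    assume "F = 0"
    then have "c ij = 0" if "ij \<in> ?C" for ij using coF2[of "fst ij" "snd ij"] that by auto
    then show False using c(1) by blast
  qed
  moreover have "(\<Sum>k\<le>degree F. eval_poly_fls (coeff F k) ?a * ?b ^ k) = 0"
  proof -
    have "degree F \<le> D" by (rule degree_le) (simp add: coF)
    then have "(\<Sum>k\<le>degree F. eval_poly_fls (coeff F k) ?a * ?b ^ k) = (\<Sum>k\<le>D. eval_poly_fls (coeff F k) ?a * ?b ^ k)"
      by (intro sum.mono_neutral_left) (auto simp: coeff_eq_0)
    also have "\<dots> = (\<Sum>j\<le>D. \<Sum>i\<le>D. fls_const (c (i, j)) * ?a ^ i * ?b ^ j)"
      by (intro sum.cong refl) (simp add: coF eval_poly_fls_sum eval_poly_fls_monom sum_distrib_right)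
    also have "\<dots> = (\<Sum>ij\<in>?C. fls_const (c ij) * ?a ^ fst ij * ?b ^ snd ij)"
      by (subst sum.swap) (simp add: sum.cartesian_product case_prod_unfold)
    also have "\<dots> = (\<Sum>ij\<in>?C. eval_poly_fls (smult (c ij) (q ij)) x / (eval_poly_fls h x * eval_poly_fls h' x) ^ D)"
    proof (intro sum.cong refl)
      fix ij assume ij: "ij \<in> ?C"
      have pow: "eval_poly_fls (f ^ k) x = eval_poly_fls f x ^ k" for f k
        by (induction k) (simp_all add: eval_poly_fls_mult)
      have fr: "u ^ i * w ^ (D - i) / w ^ D = (u / w) ^ i" if "w \<noteq> 0" "i \<le> D" for u w :: "complex fls" and i
        using that by (simp add: power_divide field_simps flip: power_add)
      have "eval_poly_fls (smult (c ij) (q ij)) x / (eval_poly_fls h x * eval_poly_fls h' x) ^ D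
          = fls_const (c ij) * (eval_poly_fls g x ^ fst ij * eval_poly_fls h x ^ (D - fst ij) / eval_poly_fls h x ^ D)
            * (eval_poly_fls g' x ^ snd ij * eval_poly_fls h' x ^ (D - snd ij) / eval_poly_fls h' x ^ D)"
        by (simp add: q_def eval_poly_fls_smult eval_poly_fls_mult pow power_mult_distrib)
      also have "\<dots> = fls_const (c ij) * ?a ^ fst ij * ?b ^ snd ij"
        using ij by (subst (1 2) fr) (use nz in auto)
      finally show "fls_const (c ij) * ?a ^ fst ij * ?b ^ snd ij
          = eval_poly_fls (smult (c ij) (q ij)) x / (eval_poly_fls h x * eval_poly_fls h' x) ^ D" ..
    qed
    also have "\<dots> = eval_poly_fls (\<Sum>ij\<in>?C. smult (c ij) (q ij)) x / (eval_poly_fls h x * eval_poly_fls h' x) ^ D"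
      by (simp only: eval_poly_fls_sum sum_divide_distrib)
    also have "\<dots> = 0" by (simp add: rel)
    finally show ?thesis .
  qed
  ultimately show ?thesis unfolding alg_dependent_iff by blast
qed

lemma (in place_field) subdegree_place:
  assumes "fls_X \<in> K"
  shows "(\<lambda>z. if z \<in> K - {0} then fls_subdegree z else 0) \<in> places K"
proof -
  have "\<exists>z\<in>K - {0}. fls_subdegree z = k" for k
  proof (intro bexI)
    show "fls_X powi k \<in> K - {0}" using power_int_in[OF assms, of k] by simp
  qed simp
  then have "(\<lambda>z. if z \<in> K - {0} then fls_subdegree z else 0) ` (K - {0}) = UNIV"
    by (auto simp: image_iff) metis
  then show ?thesis
    using fls_plus_subdegree by (auto simp: places_def mult_in add_in)
qed

definition pole_gen :: "complex fls" where "pole_gen = inverse fls_X"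

lemma pole_gen_nonzero: "pole_gen \<noteq> 0" and inverse_pole_gen: "inverse pole_gen = fls_X"
  and pole_gen_subdegree: "fls_subdegree pole_gen = - 1"
proof -
  have X: "(fls_X :: complex fls) \<noteq> 0" by simp
  then show "pole_gen \<noteq> 0" "inverse pole_gen = fls_X" by (simp_all add: pole_gen_def del: fls_inverse_X)
  have "fls_subdegree (pole_gen * fls_X) = fls_subdegree pole_gen + fls_subdegree (fls_X :: complex fls)"
    using \<open>pole_gen \<noteq> 0\<close> X by (rule fls_subdegree_mult)
  moreover have "pole_gen * fls_X = 1" unfolding pole_gen_def using X by (rule left_inverse)
  ultimately show "fls_subdegree pole_gen = - 1" by simp
qed

context smooth_polytope
begin

context
  fixes v e assumes v: "v \<in> V" and e: "e \<in> E v"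
begin

text \<open>
  The coordinate \<open>X\<close> of \<open>\<complex>((X))\<close> is a coordinate at the far end of the edge, so that the place
  outside the chart of \<open>v\<close> is the order in \<open>X\<close>.
\<close>

definition edge_point :: "int ^ 'n \<Rightarrow> complex fls" where
  "edge_point m = (if \<forall>u\<in>E v. u \<noteq> e \<longrightarrow> coord v u m = 0 then pole_gen powi coord v e m else 0)"

lemma edge_point_edge: "edge_point e = pole_gen"
  using v e by (simp add: edge_point_def lattice_coord_basis[OF basis])

lemma edge_point_other: "u \<in> E v \<Longrightarrow> u \<noteq> e \<Longrightarrow> edge_point u = 0"
  using v by (auto simp: edge_point_def lattice_coord_basis[OF basis])

lemma edge_point_eq_0_iff: "u \<in> E v \<Longrightarrow> edge_point u = 0 \<longleftrightarrow> u \<noteq> e"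
  using edge_point_other edge_point_edge pole_gen_nonzero by auto

lemma edge_point_hom: "monoid_hom_on (chart_monoid P v) edge_point"
  unfolding monoid_hom_on_def
proof (intro conjI ballI)
  show "edge_point 0 = 1" using v e by (simp add: edge_point_def lattice_coord_0[OF basis])
  fix a b assume "a \<in> chart_monoid P v" "b \<in> chart_monoid P v"
  then have nn: "\<And>u. u \<in> E v \<Longrightarrow> coord v u a \<ge> 0" "\<And>u. u \<in> E v \<Longrightarrow> coord v u b \<ge> 0"
    using v by (simp_all add: chart_monoid_iff)
  have "(coord v u (a + b) = 0) \<longleftrightarrow> coord v u a = 0 \<and> coord v u b = 0" if "u \<in> E v" for u
    using nn[OF that] v that by (simp add: lattice_coord_add[OF basis] add_nonneg_eq_0_iff)
  then have iff: "(\<forall>u\<in>E v. u \<noteq> e \<longrightarrow> coord v u (a + b) = 0) \<longleftrightarrow>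
      (\<forall>u\<in>E v. u \<noteq> e \<longrightarrow> coord v u a = 0) \<and> (\<forall>u\<in>E v. u \<noteq> e \<longrightarrow> coord v u b = 0)" by blast
  show "edge_point (a + b) = edge_point a * edge_point b"
    unfolding edge_point_def iff using v e
    by (auto simp: lattice_coord_add[OF basis] power_int_add pole_gen_nonzero)
qed

interpretation edge: toric_point P v edge_point
  by unfold_locales (use v edge_point_hom in auto)

lemma pole_gen_in: "pole_gen \<in> edge.K"
  using edge.\<phi>_E_in[OF e] by (simp only: edge_point_edge)

lemma edge_ring: "r \<in> generated_ring (edge_point ` E v) \<Longrightarrow> \<exists>f. r = eval_poly_fls f pole_gen"
proof (induction rule: generated_ring.induct)
  case (const c)
  then show ?case by (intro exI[of _ "[:c:]"]) simp
next
  case (add a b)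
  then show ?case by (metis eval_poly_fls_add)
next
  case (mult y a)
  then obtain u f where u: "u \<in> E v" "y = edge_point u" and a: "a = eval_poly_fls f pole_gen" by blast
  show ?case
  proof (cases "u = e")
    case True
    then have "y * a = eval_poly_fls (pCons 0 f) pole_gen" using u a by (simp add: edge_point_edge)
    then show ?thesis by blast
  next
    case False
    then have "y * a = eval_poly_fls 0 pole_gen" using u by (simp add: edge_point_other)
    then show ?thesis by blast
  qed
qed

lemma edge_field:
  assumes "z \<in> edge.K"
  obtains g h where "eval_poly_fls h pole_gen \<noteq> 0" "z = eval_poly_fls g pole_gen / eval_poly_fls h pole_gen"
proof -
  obtain a b where ab: "a \<in> generated_ring (edge_point ` E v)" "b \<in> generated_ring (edge_point ` E v)"
    "b \<noteq> 0" "z = a / b"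
    using edge.curve_field_fractions[OF assms] by blast
  obtain g h where "a = eval_poly_fls g pole_gen" "b = eval_poly_fls h pole_gen"
    using edge_ring[OF ab(1)] edge_ring[OF ab(2)] by blast
  then show thesis using ab(3,4) by (intro that[of h g]) auto
qed

definition far_place :: "complex fls \<Rightarrow> int" where
  "far_place z = (if z \<in> edge.K - {0} then fls_subdegree z else 0)"

lemma far_place: "far_place \<in> places edge.K"
proof -
  have "fls_X \<in> edge.K" using edge.inverse_in[OF pole_gen_in] by (simp only: inverse_pole_gen)
  from edge.subdegree_place[OF this] show ?thesis
    by (simp add: far_place_def[abs_def])
qed

lemma far_place_gen: "far_place pole_gen = - 1"
  using pole_gen_in by (simp add: far_place_def pole_gen_nonzero pole_gen_subdegree)

lemma place_edge_value:
  assumes p: "p \<in> places edge.K" "p pole_gen < 0"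
    and h: "eval_poly_fls h pole_gen \<noteq> 0" and g: "eval_poly_fls g pole_gen \<noteq> 0"
  shows "p (eval_poly_fls g pole_gen / eval_poly_fls h pole_gen) = (int (degree g) - int (degree h)) * p pole_gen"
proof -
  have "g \<noteq> 0" "h \<noteq> 0" using g h by auto
  then show ?thesis
    using edge.place_eval_poly[OF p(1) pole_gen_in p(2)] g h
    by (simp add: edge.place_divide[OF p(1)] edge.eval_poly_fls_in pole_gen_in left_diff_distrib)
qed

text \<open>The field is generated by \<open>pole_gen\<close>, and a place with a pole there is its
  degree valuation up to scale; surjectivity fixes the scale.\<close>

lemma place_edge_unique:
  assumes p: "p \<in> places edge.K" "p pole_gen < 0"
  shows "p = far_place"
proof -
  have val: "p z = - far_place z * p pole_gen" if z: "z \<in> edge.K - {0}" for z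
  proof -
    obtain g h where gh: "eval_poly_fls h pole_gen \<noteq> 0" "z = eval_poly_fls g pole_gen / eval_poly_fls h pole_gen"
      using edge_field[of z] z by blast
    have g: "eval_poly_fls g pole_gen \<noteq> 0" using z gh by auto
    have "far_place z = (int (degree g) - int (degree h)) * - 1"
      unfolding gh(2) by (subst place_edge_value[OF far_place _ gh(1) g]) (simp_all add: far_place_gen)
    moreover have "p z = (int (degree g) - int (degree h)) * p pole_gen"
      unfolding gh(2) by (rule place_edge_value[OF p gh(1) g])
    ultimately show ?thesis by simp
  qed
  obtain z where z: "z \<in> edge.K - {0}" "p z = 1" using edge.place_surj[OF p(1), of 1] by blast
  have "far_place z * (- p pole_gen) = 1" using val[OF z(1)] z(2) by simp
  then have "- p pole_gen = 1 \<or> - p pole_gen = - 1" unfolding zmult_eq_1_iff by blast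
  then have gen: "p pole_gen = - 1" using p(2) by linarith
  show ?thesis
  proof
    fix z
    show "p z = far_place z"
    proof (cases "z \<in> edge.K - {0}")
      case True
      then show ?thesis using val[OF True] gen by simp
    next
      case False
      then show ?thesis using edge.place_outside[OF p(1) False] edge.place_outside[OF far_place False] by simp
    qed
  qed
qed

lemma edge_curve: "curve P v edge_point"
proof -
  have "transcendental pole_gen"
    unfolding transcendental_def
  proof (intro allI impI)
    fix f :: "complex poly" assume "poly (map_poly fls_const f) pole_gen = 0"
    then have "eval_poly_fls f pole_gen = 0" by (simp add: eval_poly_fls_def)
    then show "f = 0" using edge.place_eval_poly[OF far_place pole_gen_in, of f] far_place_gen by auto
  qed
  moreover have "alg_dependent x y" if xy: "x \<in> edge.K" "y \<in> edge.K" for x y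
  proof -
    obtain g h where gh: "eval_poly_fls h pole_gen \<noteq> 0" "x = eval_poly_fls g pole_gen / eval_poly_fls h pole_gen"
      by (rule edge_field[OF xy(1)])
    obtain g' h' where gh': "eval_poly_fls h' pole_gen \<noteq> 0" "y = eval_poly_fls g' pole_gen / eval_poly_fls h' pole_gen"
      by (rule edge_field[OF xy(2)])
    show ?thesis unfolding gh(2) gh'(2) by (rule alg_dependent_rational[OF gh(1) gh'(1)])
  qed
  ultimately have "trdeg_one edge.K" unfolding trdeg_one_def using pole_gen_in by blast
  then show ?thesis using v edge_point_hom by (simp add: curve_def)
qed

lemma ord_at_far_place:
  assumes "edge.supported m" shows "edge.ord_at far_place m = - coord v e m"
proof -
  have "edge.ord_at far_place m = (\<Sum>u\<in>E v. if u = e then - coord v e m else 0)"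
    unfolding edge.ord_at_def
  proof (intro sum.cong refl)
    fix u assume u: "u \<in> E v"
    show "coord v u m * far_place (edge_point u) = (if u = e then - coord v e m else 0)"
      using edge_point_other[OF u] edge.place_zero[OF far_place]
      by (auto simp: edge_point_edge far_place_gen)
  qed
  then show ?thesis using finite_E[OF v] e by simp
qed

lemma supported_edge_iff: "edge.supported m \<longleftrightarrow> (\<forall>u\<in>E v. u \<noteq> e \<longrightarrow> coord v u m = 0)"
  by (simp add: edge.supported_def edge_point_eq_0_iff cong: ball_cong)

text \<open>At every place but \<open>far_place\<close> the generator \<open>pole_gen\<close> is
  regular, so the center lies in the chart of \<open>v\<close> and the order is 0; at
  \<open>far_place\<close> the center lies in the chart of the far end.\<close>

lemma edge_curve_degree:
  assumes m: "compatible m"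
  shows "curve_degree P m v edge_point = - coord v e (m v - m (neighbour v e))"
proof -
  let ?w = "neighbour v e"
  have w: "?w \<in> V" by (rule neighbour_in_V[OF v e])
  have diff: "?w - v = edge_len v e *s e" by (simp add: neighbour_def)
  have sw: "edge.supported (?w - v)"
    unfolding supported_edge_iff diff using v e
    by (auto simp: lattice_coord_smult[OF basis] lattice_coord_basis[OF basis])
  have "\<exists>\<theta>. centered_in P v edge_point far_place ?w \<theta>"
  proof (rule edge.centered_at_minimum[OF far_place w sw])
    fix w' assume w': "w' \<in> V" "edge.supported (w' - v)"
    let ?c = "coord v e (w' - v)"
    have "w' - v = ?c *s e"
    proof (rule lattice_coord_eqI[OF basis[OF v]])
      fix u assume "u \<in> E v"
      then show "coord v u (w' - v) = coord v u (?c *s e)"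
        using w'(2) v e by (auto simp: supported_edge_iff lattice_coord_smult[OF basis] lattice_coord_basis[OF basis])
    qed
    \<comment> \<open>The competing vertices lie on the line of the edge, and the facet inequality
      at the far end keeps them from passing it.\<close>
    then have "w' - ?w = (edge_len v e - ?c) *s (- e)"
      using diff by (simp add: vec_eq_iff algebra_simps)
    then have "0 \<le> coord ?w (- e) ((edge_len v e - ?c) *s (- e))"
      using coord_nonneg[OF w neighbour_edge[OF v e] w'(1)] by (simp only:)
    then have "?c \<le> edge_len v e"
      unfolding lattice_coord_smult[OF basis[OF w] neighbour_edge[OF v e]]
        lattice_coord_basis[OF basis[OF w] neighbour_edge[OF v e] neighbour_edge[OF v e]] by simp
    then show "edge.ord_at far_place (?w - v) \<le> edge.ord_at far_place (w' - v)"
      unfolding ord_at_far_place[OF sw] ord_at_far_place[OF w'(2)]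
      unfolding diff using v e by (simp add: lattice_coord_smult[OF basis] lattice_coord_basis[OF basis])
  qed
  then obtain \<theta> where c: "centered_in P v edge_point far_place ?w \<theta>" by blast
  have "section_order P m v edge_point far_place = - coord v e (m v - m ?w)"
    unfolding edge.section_order_eq[OF far_place m c]
    by (rule ord_at_far_place[OF edge.compatible_supported[OF m w sw]])
  moreover have "curve_degree P m v edge_point = (\<Sum>p\<in>{far_place}. section_order P m v edge_point p)"
    unfolding curve_degree_def
  proof (rule sum.mono_neutral_left)
    show "{p \<in> places edge.K. section_order P m v edge_point p \<noteq> 0} \<subseteq> {far_place}"
    proof
      fix p assume p: "p \<in> {p \<in> places edge.K. section_order P m v edge_point p \<noteq> 0}"
      then have pl: "p \<in> places edge.K" by blast
      show "p \<in> {far_place}"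
      proof (rule ccontr)
        assume "p \<notin> {far_place}"
        then have "p pole_gen \<ge> 0" using place_edge_unique[OF pl] by (simp add: not_less[symmetric]) blast
        then have "p (edge_point u) \<ge> 0" if "u \<in> E v" for u
          using edge_point_other[OF that] edge_point_edge edge.place_zero[OF pl] by (cases "u = e") auto
        then have "section_order P m v edge_point p = 0" by (rule edge.section_order_0[OF pl m])
        then show False using p by blast
      qed
    qed
  qed (use far_place in auto)
  ultimately show ?thesis by simp
qed

lemma adjoint_nef_edge:
  assumes "adjoint_nef P t" shows "t * edge_len v e \<ge> edge_deg v e"
proof -
  have L: "curve_degree P ample_bundle v edge_point = edge_len v e"
    using v e by (simp add: edge_curve_degree[OF compatible_ample] ample_bundle_def neighbour_def
      lattice_coord_minus[OF basis] lattice_coord_smult[OF basis] lattice_coord_basis[OF basis])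
  have "curve_degree P can v edge_point = - edge_deg v e"
    by (simp add: edge_curve_degree[OF compatible_can] edge_deg_def)
  then show ?thesis using assms edge_curve L unfolding adjoint_nef_def by fastforce
qed

end

section \<open>The nef-value as maximal slope, and the theorem\<close>

lemma adjoint_nef_iff: "adjoint_nef P t \<longleftrightarrow> max_slope \<le> t"
  using adjoint_nef_edge edge_nef_imp_adjoint_nef[of t] by (auto simp: edge_nef_def simp flip: edge_nef_iff)

lemma nef_value_eq: "nef_value P = max_slope"
  by (simp add: nef_value_def adjoint_nef_iff cInf_atLeast flip: atLeast_def)

end

theorem corollary1p5:
  fixes P :: "(real ^ 'n) set"
  assumes "smooth_lattice_polytope P"
    and "spectral_value P > (real CARD('n) + 2) / 2"
  shows "Q_normal P"
proof -
  interpret smooth_polytope P by unfold_locales (rule assms(1))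
  show ?thesis
    unfolding Q_normal_def nef_value_eq by (rule spectral_value_eq_max_slope[OF assms(2)])
qed

end
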